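(* Let $\mathbb{K}$ be an algebraically closed field. For every integer $n\geq 4$ and every integer $m\geq 4$ there exists a connected curve $C\subset\mathbb{P}^n_{\mathbb{K}}$ of maximal regularity with $\Xi(C)=m$ which has no extremal secant line. Moreover, for $n=4$ and every $m\geq 4$ there exists a connected curve $C\subset\mathbb{P}^4_{\mathbb{K}}$ of maximal regularity with $\Xi(C)=m$ which has no extremal secants of any dimension.
   Context: $\mathbb{K}$ is an algebraically closed field of arbitrary characteristic, $S=\mathbb{K}[x_0,\dots,x_n]$ and $\mathbb{P}^n_{\mathbb{K}}=\mathrm{Proj}(S)$. A curve is a reduced one-dimensional scheme embedded in some $\mathbb{P}^n_{\mathbb{K}}$. $\mathrm{Span}(C)$ is the smallest linear subspace containing $C$. A graded $S$-module $M$ is $r$-regular if its $i$-th syzygy module is generated in degrees $\le r+i$ for all $i$; $\mathrm{reg}(M)$ is the infimum of such $r$. For a subscheme $X$ of projective space, $\mathrm{reg}(X)$ is the regularity of its saturated homogeneous ideal $I_X$. For a curve $C$ put $\Xi(C)=\deg(C)-\dim(\mathrm{Span}(C))+2$. A connected curve $C$ has maximal regularity if $\mathrm{reg}(C)=\Xi(C)$. A linear subspace $L\subset\mathbb{P}^n_{\mathbb{K}}$ is an extremal secant of a curve $C\subset\mathbb{P}^n_{\mathbb{K}}$ if the scheme $C\cap L$ is finite and $\mathrm{reg}(C\cap L)=\Xi(C)$; an extremal secant line is an extremal secant of dimension 1. *)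

theory Defs
  imports
    "HOL-Analysis.Analysis"
    "HOL-Library.Poly_Mapping"
    "HOL-Computational_Algebra.Polynomial"
    "HOL-Algebra.Ideal"
begin

section \<open>The graded polynomial ring\<close>

text \<open>
  A polynomial is a finitely supported map from monomials (themselves finitely supported exponent
  maps \<open>nat \<Rightarrow>\<^sub>0 nat\<close>) to coefficients; the type carries the convolution product.
  \<open>poly_carrier n\<close> consists of the polynomials in the variables \<open>x\<^sub>0, \<dots>, x\<^sub>n\<close> only.
\<close>

type_synonym 'k mpoly = "(nat \<Rightarrow>\<^sub>0 nat) \<Rightarrow>\<^sub>0 'k"

definition var :: "nat \<Rightarrow> 'k::field mpoly" where
  "var i = Poly_Mapping.single (Poly_Mapping.single i 1) 1"

definition poly_carrier :: "nat \<Rightarrow> 'k::field mpoly set" where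
  "poly_carrier n = {p. \<forall>m\<in>Poly_Mapping.keys p. Poly_Mapping.keys m \<subseteq> {..n}}"

definition poly_ring :: "nat \<Rightarrow> 'k::field mpoly ring" where
  "poly_ring n = \<lparr>carrier = poly_carrier n, mult = (*), one = 1, zero = 0, add = (+)\<rparr>"

definition mdeg :: "(nat \<Rightarrow>\<^sub>0 nat) \<Rightarrow> nat" where
  "mdeg m = (\<Sum>i\<in>Poly_Mapping.keys m. Poly_Mapping.lookup m i)"

definition homogeneous_poly :: "nat \<Rightarrow> 'k::field mpoly \<Rightarrow> bool" where
  "homogeneous_poly d p \<longleftrightarrow> (\<forall>m\<in>Poly_Mapping.keys p. mdeg m = d)"

definition hom_component :: "nat \<Rightarrow> 'k::field mpoly \<Rightarrow> 'k mpoly" where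
  "hom_component d p =
     (\<Sum>m\<in>{m\<in>Poly_Mapping.keys p. mdeg m = d}. Poly_Mapping.single m (Poly_Mapping.lookup p m))"

definition forms :: "nat \<Rightarrow> nat \<Rightarrow> 'k::field mpoly set" where
  "forms n d = {p \<in> poly_carrier n. homogeneous_poly d p}"

text \<open>
  Used both for constants acting on polynomials and for polynomials acting on vectors of
  polynomials.
\<close>

definition smul :: "'b::mult_zero \<Rightarrow> ('a \<Rightarrow>\<^sub>0 'b) \<Rightarrow> ('a \<Rightarrow>\<^sub>0 'b)" where
  "smul c v = Poly_Mapping.map ((*) c) v"

abbreviation vdim :: "'k::field mpoly set \<Rightarrow> nat" where
  "vdim \<equiv> vector_space.dim smul"

lemma lookup_smul [simp]: "Poly_Mapping.lookup (smul c v) i = c * Poly_Mapping.lookup v i"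
  by (simp add: smul_def Poly_Mapping.map.rep_eq when_def)

lemma vector_space_smul: "vector_space (smul :: 'k::field \<Rightarrow> 'k mpoly \<Rightarrow> 'k mpoly)"
  by (unfold_locales; rule poly_mapping_eqI) (simp_all add: lookup_add algebra_simps)

lemma poly_carrier_mult:
  assumes "p \<in> poly_carrier n" "q \<in> poly_carrier n"
  shows "p * q \<in> poly_carrier n"
  unfolding poly_carrier_def
proof (intro CollectI ballI)
  fix m assume "m \<in> Poly_Mapping.keys (p * q)"
  then obtain a b where "a \<in> Poly_Mapping.keys p" "b \<in> Poly_Mapping.keys q" "m = a + b"
    using keys_mult[of p q] by blast
  then show "Poly_Mapping.keys m \<subseteq> {..n}"
    using assms Poly_Mapping.keys_add[of a b] unfolding poly_carrier_def by blast
qed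

lemma poly_carrier_add:
  assumes "p \<in> poly_carrier n" "q \<in> poly_carrier n"
  shows "p + q \<in> poly_carrier n"
  using assms Poly_Mapping.keys_add[of p q] unfolding poly_carrier_def by blast

lemma poly_carrier_closed [simp]:
  "0 \<in> poly_carrier n" "1 \<in> poly_carrier n"
  "p \<in> poly_carrier n \<Longrightarrow> - p \<in> poly_carrier n"
  by (simp_all add: poly_carrier_def)

lemma cring_poly_ring: "cring (poly_ring n :: 'k::field mpoly ring)"
proof (rule cringI)
  show "abelian_group (poly_ring n :: 'k mpoly ring)"
  proof (rule abelian_groupI)
    fix p :: "'k mpoly"
    assume "p \<in> carrier (poly_ring n)"
    then show "\<exists>q\<in>carrier (poly_ring n). q \<oplus>\<^bsub>poly_ring n\<^esub> p = \<zero>\<^bsub>poly_ring n\<^esub>"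
      by (intro bexI[of _ "- p"]) (simp_all add: poly_ring_def)
  qed (simp_all add: poly_ring_def poly_carrier_add add_ac)
next
  show "comm_monoid (poly_ring n :: 'k mpoly ring)"
    by (rule comm_monoidI) (simp_all add: poly_ring_def poly_carrier_mult mult_ac)
qed (simp add: poly_ring_def algebra_simps)

section \<open>Closed subschemes of projective space\<close>

text \<open>
  A closed subscheme \<open>X\<close> of \<open>\<P>\<^sup>n\<close> is represented by its saturated homogeneous ideal; inclusion of
  subschemes is reverse inclusion of these ideals, and the empty scheme is the unit ideal.
\<close>

definition homogeneous_ideal :: "nat \<Rightarrow> 'k::field mpoly set \<Rightarrow> bool" where
  "homogeneous_ideal n I \<longleftrightarrow> ideal I (poly_ring n) \<and> (\<forall>f\<in>I. \<forall>d. hom_component d f \<in> I)"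

definition saturation :: "nat \<Rightarrow> 'k::field mpoly set \<Rightarrow> 'k mpoly set" where
  "saturation n I = {f \<in> poly_carrier n. \<forall>i\<le>n. \<exists>k. var i ^ k * f \<in> I}"

definition closed_subscheme :: "nat \<Rightarrow> 'k::field mpoly set \<Rightarrow> bool" where
  "closed_subscheme n X \<longleftrightarrow> homogeneous_ideal n X \<and> saturation n X = X"

definition reduced_subscheme :: "nat \<Rightarrow> 'k::field mpoly set \<Rightarrow> bool" where
  "reduced_subscheme n X \<longleftrightarrow>
     closed_subscheme n X \<and> (\<forall>f\<in>poly_carrier n. \<forall>k. f ^ k \<in> X \<longrightarrow> f \<in> X)"

definition scheme_inter :: "nat \<Rightarrow> 'k::field mpoly set \<Rightarrow> 'k mpoly set \<Rightarrow> 'k mpoly set" where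
  "scheme_inter n X Y = saturation n (X <+>\<^bsub>poly_ring n\<^esub> Y)"

definition Proj :: "nat \<Rightarrow> 'k::field mpoly set set" where
  "Proj n = {P. primeideal P (poly_ring n) \<and> homogeneous_ideal n P \<and> (\<exists>i\<le>n. var i \<notin> P)}"

definition zariski :: "nat \<Rightarrow> 'k::field mpoly set topology" where
  "zariski n = topology_generated_by {{P \<in> Proj n. f \<notin> P} | f. \<exists>d. f \<in> forms n d}"

definition underlying_space :: "nat \<Rightarrow> 'k::field mpoly set \<Rightarrow> 'k mpoly set topology" where
  "underlying_space n X = subtopology (zariski n) {P. X \<subseteq> P}"

definition irreducible_closed :: "'a topology \<Rightarrow> 'a set \<Rightarrow> bool" where
  "irreducible_closed T A \<longleftrightarrow> closedin T A \<and> A \<noteq> {} \<and>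
     (\<forall>B B'. closedin T B \<longrightarrow> closedin T B' \<longrightarrow> A \<subseteq> B \<union> B' \<longrightarrow> A \<subseteq> B \<or> A \<subseteq> B')"

text \<open>Krull dimension; the supremum is taken in \<open>ereal\<close>, so the empty space has dimension \<open>-\<infinity>\<close>.\<close>

definition krull_dim :: "'a topology \<Rightarrow> ereal" where
  "krull_dim T = (SUP d\<in>{d::nat. \<exists>A. (\<forall>i\<le>d. irreducible_closed T (A i)) \<and>
                                    (\<forall>i<d. A i \<subset> A (Suc i))}. ereal (real d))"

definition finite_subscheme :: "nat \<Rightarrow> 'k::field mpoly set \<Rightarrow> bool" where
  "finite_subscheme n X \<longleftrightarrow> closed_subscheme n X \<and> finite (topspace (underlying_space n X))"

text \<open>
  The degree of \<open>X\<close> is \<open>d!\<close> times the leading coefficient of the Hilbert polynomial of \<open>S / I\<^sub>X\<close>,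
  where \<open>d\<close> is the degree of that polynomial.
\<close>

definition hilbert_function :: "nat \<Rightarrow> 'k::field mpoly set \<Rightarrow> nat \<Rightarrow> int" where
  "hilbert_function n X t = int (vdim (forms n t :: 'k mpoly set)) - int (vdim (X \<inter> forms n t))"

definition hilbert_polynomial :: "nat \<Rightarrow> 'k::field mpoly set \<Rightarrow> real Polynomial.poly" where
  "hilbert_polynomial n X =
     (THE p. \<forall>\<^sub>F t in sequentially. Polynomial.poly p (real t) = of_int (hilbert_function n X t))"

definition scheme_degree :: "nat \<Rightarrow> 'k::field mpoly set \<Rightarrow> real" where
  "scheme_degree n X = fact (Polynomial.degree (hilbert_polynomial n X)) *
                       Polynomial.lead_coeff (hilbert_polynomial n X)"

section \<open>Linear subspaces\<close>

text \<open>
  The saturation only matters when \<open>W\<close> spans all linear forms: it turns the irrelevant ideal into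
  the unit ideal, the empty linear subspace, of dimension \<open>-1\<close>.
\<close>

definition linear_subspace :: "nat \<Rightarrow> 'k::field mpoly set \<Rightarrow> bool" where
  "linear_subspace n L \<longleftrightarrow> (\<exists>W \<subseteq> forms n 1. L = saturation n (Idl\<^bsub>poly_ring n\<^esub> W))"

definition linear_dim :: "nat \<Rightarrow> 'k::field mpoly set \<Rightarrow> int" where
  "linear_dim n L = int n - int (vdim (L \<inter> forms n 1))"

text \<open>Smallest linear subspace containing \<open>X\<close>, hence the greatest ideal.\<close>

definition Span :: "nat \<Rightarrow> 'k::field mpoly set \<Rightarrow> 'k mpoly set" where
  "Span n X = (GREATEST L. linear_subspace n L \<and> L \<subseteq> X)"

section \<open>Regularity\<close>

text \<open>
  Elements of a free module \<open>S\<^sup>k\<close> are finitely supported maps supported on \<open>{..<k}\<close>.  A list \<open>a\<close> of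
  integers encodes the graded free module whose \<open>j\<close>-th basis vector has degree \<open>a ! j\<close>.
  Graded modules occur as graded submodules of such free modules.
\<close>

type_synonym 'k mvec = "nat \<Rightarrow>\<^sub>0 'k mpoly"

definition free_module :: "nat \<Rightarrow> nat \<Rightarrow> 'k::field mvec set" where
  "free_module n k = {v. Poly_Mapping.keys v \<subseteq> {..<k} \<and>
                         (\<forall>j. Poly_Mapping.lookup v j \<in> poly_carrier n)}"

definition homogeneous_vec :: "int list \<Rightarrow> int \<Rightarrow> 'k::field mvec \<Rightarrow> bool" where
  "homogeneous_vec a d v \<longleftrightarrow>
     (\<forall>j<length a. \<forall>m\<in>Poly_Mapping.keys (Poly_Mapping.lookup v j). int (mdeg m) + a ! j = d)"

definition is_submodule :: "nat \<Rightarrow> 'k::field mvec set \<Rightarrow> bool" where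
  "is_submodule n M \<longleftrightarrow> 0 \<in> M \<and> (\<forall>v\<in>M. \<forall>w\<in>M. v + w \<in> M) \<and>
     (\<forall>f\<in>poly_carrier n. \<forall>v\<in>M. smul f v \<in> M)"

definition syz :: "nat \<Rightarrow> 'k::field mvec list \<Rightarrow> 'k mvec set" where
  "syz n gs = {c \<in> free_module n (length gs).
                 (\<Sum>j<length gs. smul (Poly_Mapping.lookup c j) (gs ! j)) = 0}"

text \<open>
  Stage \<open>i\<close> of a free resolution of \<open>M\<close> is given by a list \<open>gs i\<close> of homogeneous generators, of
  degrees \<open>a (Suc i)\<close>, of the \<open>i\<close>-th syzygy module, which lies in the free module with degrees \<open>a i\<close>.
\<close>

primrec syzygy_module ::
    "nat \<Rightarrow> 'k::field mvec set \<Rightarrow> (nat \<Rightarrow> 'k mvec list) \<Rightarrow> nat \<Rightarrow> 'k mvec set" where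
  "syzygy_module n M gs 0 = M"
| "syzygy_module n M gs (Suc i) = syz n (gs i)"

text \<open>
  The last conjunct is minimality: the differentials of the resolution have image in the
  irrelevant ideal times the free module, i.e. no syzygy has a coefficient with a constant term.
\<close>

definition minimal_free_resolution ::
    "nat \<Rightarrow> 'k::field mvec set \<Rightarrow> (nat \<Rightarrow> int list) \<Rightarrow> (nat \<Rightarrow> 'k mvec list) \<Rightarrow> bool" where
  "minimal_free_resolution n M a gs \<longleftrightarrow>
     M \<subseteq> free_module n (length (a 0)) \<and>
     (\<forall>i. length (gs i) = length (a (Suc i)) \<and>
          (\<forall>j<length (gs i). homogeneous_vec (a i) (a (Suc i) ! j) (gs i ! j)) \<and>
          is_submodule n hull set (gs i) = syzygy_module n M gs i \<and>
          (\<forall>c\<in>syz n (gs i). \<forall>j. Poly_Mapping.lookup (Poly_Mapping.lookup c j) 0 = 0))"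

definition generated_in_degrees_le ::
    "nat \<Rightarrow> int list \<Rightarrow> 'k::field mvec set \<Rightarrow> int \<Rightarrow> bool" where
  "generated_in_degrees_le n a Z r \<longleftrightarrow>
     is_submodule n hull {v \<in> Z. \<exists>d\<le>r. homogeneous_vec a d v} = Z"

definition regular :: "nat \<Rightarrow> int list \<Rightarrow> 'k::field mvec set \<Rightarrow> int \<Rightarrow> bool" where
  "regular n b M r \<longleftrightarrow>
     (\<exists>a gs. a 0 = b \<and> minimal_free_resolution n M a gs \<and>
        (\<forall>i. generated_in_degrees_le n (a i) (syzygy_module n M gs i) (r + int i)))"

text \<open>The infimum is taken in \<open>ereal\<close>, since the zero module has regularity \<open>-\<infinity>\<close>.\<close>

definition regularity :: "nat \<Rightarrow> int list \<Rightarrow> 'k::field mvec set \<Rightarrow> ereal" where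
  "regularity n b M = (INF r\<in>{r. regular n b M r}. ereal (of_int r))"

definition scheme_reg :: "nat \<Rightarrow> 'k::field mpoly set \<Rightarrow> ereal" where
  "scheme_reg n X = regularity n [0] (Poly_Mapping.single 0 ` X)"

section \<open>Curves of maximal regularity and extremal secants\<close>

definition curve :: "nat \<Rightarrow> 'k::field mpoly set \<Rightarrow> bool" where
  "curve n C \<longleftrightarrow> reduced_subscheme n C \<and> krull_dim (underlying_space n C) = 1"

definition connected_curve :: "nat \<Rightarrow> 'k::field mpoly set \<Rightarrow> bool" where
  "connected_curve n C \<longleftrightarrow> curve n C \<and> connected_space (underlying_space n C)"

definition Xi :: "nat \<Rightarrow> 'k::field mpoly set \<Rightarrow> real" where
  "Xi n C = scheme_degree n C - of_int (linear_dim n (Span n C)) + 2"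

definition maximal_regularity :: "nat \<Rightarrow> 'k::field mpoly set \<Rightarrow> bool" where
  "maximal_regularity n C \<longleftrightarrow> scheme_reg n C = ereal (Xi n C)"

definition extremal_secant :: "nat \<Rightarrow> 'k::field mpoly set \<Rightarrow> 'k mpoly set \<Rightarrow> bool" where
  "extremal_secant n C L \<longleftrightarrow> linear_subspace n L \<and>
     finite_subscheme n (scheme_inter n C L) \<and> scheme_reg n (scheme_inter n C L) = ereal (Xi n C)"

definition extremal_secant_line :: "nat \<Rightarrow> 'k::field mpoly set \<Rightarrow> 'k mpoly set \<Rightarrow> bool" where
  "extremal_secant_line n C L \<longleftrightarrow> extremal_secant n C L \<and> linear_dim n L = 1"

end

theory Submission
  imports Defs
begin

text \<open>
  One curve serves for all \<open>n\<close>. Let \<open>k = m\<close>, choose distinct nonzero scalars \<open>a\<^sub>0, \<dots>, a\<^bsub>k-1\<^esub>\<close> and let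
  \<open>C\<close> consist of the spine \<open>T = {x\<^sub>2 = x\<^sub>3 = 0}\<close> in a three-space together with the \<open>k\<close> lines joining
  \<open>(1 : a\<^sub>i : 0 : 0)\<close> to \<open>(0 : a\<^sub>i\<^sup>3 : 1 : a\<^sub>i)\<close>. It is connected of degree \<open>k + 1\<close> and spans the
  three-space, so \<open>\<Xi>(C) = k\<close>.

  The \<open>k\<close> lines meet not only \<open>T\<close> but also the double structure of \<open>T\<close> on the quadric
  \<open>x\<^sub>0 x\<^sub>3 = x\<^sub>1 x\<^sub>2\<close>, in a scheme of length \<open>2k\<close>. Thus \<open>T\<close> counts twice as a common transversal. One of
  the two is lost because \<open>T\<close> belongs to \<open>C\<close>; the other one makes every form of degree \<open>< k\<close> in the
  ideal of \<open>C\<close> vanish on the double structure (\<open>low_degree_tangent\<close>), so that a generator of degree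
  \<open>k\<close> is needed (\<open>not_regular_C\<close>). The extremal secant has become infinitely near to a component of
  the curve. Because of the cubic terms there is no other common transversal of four of the lines.

  All cohomological information is contained in explicit interpolation. Sections of the structure
  sheaf of \<open>C\<close> are tuples of univariate polynomials that agree at the nodes (\<open>tuples\<close>). Every section
  of degree \<open>\<ge> k - 1\<close> is the restriction of a form (\<open>lift_tuples\<close>), which gives the Hilbert
  polynomial and the upper bound for the regularity (\<open>regular_C\<close>). In degree \<open>k - 2\<close> the forms have
  codimension one, and the multiples of any linear form that vanishes on no component supply what is
  missing (\<open>tuples_decompose\<close>). A linear space \<open>L\<close> with finite \<open>C \<inter> L\<close> lies in a hyperplane of this
  kind; hence \<open>C \<inter> L\<close> has regularity at most \<open>k - 1\<close> (\<open>scheme_reg_secant\<close>), and \<open>L\<close> is not an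
  extremal secant, whatever its dimension.

  Upper bounds for the regularity, which is defined by minimal free resolutions, come from sequences
  of linear coordinates each of which is injective in degrees \<open>\<ge> r\<close> modulo the module and the
  preceding coordinates. The condition passes to syzygy modules with \<open>r + 1\<close> in place of \<open>r\<close>
  (\<open>filter_regular_syz\<close>) and bounds the degrees of generators (\<open>filter_regular_generated\<close>), so a
  resolution by minimal generators has the required degrees (\<open>filter_regular_imp_regular\<close>).
\<close>

abbreviation single :: "'a \<Rightarrow> 'b::zero \<Rightarrow> ('a \<Rightarrow>\<^sub>0 'b)" where "single \<equiv> Poly_Mapping.single"
abbreviation coef :: "('a \<Rightarrow>\<^sub>0 'b::zero) \<Rightarrow> 'a \<Rightarrow> 'b" where "coef \<equiv> Poly_Mapping.lookup"
abbreviation supp :: "('a \<Rightarrow>\<^sub>0 'b::zero) \<Rightarrow> 'a set" where "supp \<equiv> Poly_Mapping.keys"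
abbreviation const :: "'k::field \<Rightarrow> 'k mpoly" where "const \<equiv> single 0"

section \<open>Monomials, graded components and evaluation\<close>

lemma mdeg_eq_sum:
  assumes "finite A" "supp m \<subseteq> A"
  shows "mdeg m = (\<Sum>i\<in>A. coef m i)"
  unfolding mdeg_def using assms by (intro sum.mono_neutral_left) (auto simp: in_keys_iff)

lemma mdeg_add: "mdeg (m + m') = mdeg m + mdeg m'"
proof -
  let ?A = "supp m \<union> supp m'"
  have "mdeg (m + m') = (\<Sum>i\<in>?A. coef (m + m') i)"
    by (rule mdeg_eq_sum) (use Poly_Mapping.keys_add[of m m'] in auto)
  then show ?thesis
    using mdeg_eq_sum[of ?A m] mdeg_eq_sum[of ?A m'] by (simp add: lookup_add sum.distrib)
qed

lemma mdeg_0 [simp]: "mdeg 0 = 0" by (simp add: mdeg_def)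

lemma mdeg_single [simp]: "mdeg (single i e) = e"
  by (simp add: mdeg_def)

lemma mdeg_eq_0_iff: "mdeg m = 0 \<longleftrightarrow> m = 0"
  by (metis finite_keys in_keys_iff lookup_zero mdeg_0 mdeg_def poly_mapping_eqI sum_eq_0_iff)

lemma poly_mapping_sum_single:
  assumes "finite A" "supp p \<subseteq> A"
  shows "p = (\<Sum>m\<in>A. single m (coef p m))"
proof (rule poly_mapping_eqI)
  fix x
  show "coef p x = coef (\<Sum>m\<in>A. single m (coef p m)) x"
    using assms by (auto simp: lookup_sum lookup_single when_def in_keys_iff)
qed

lemma coef_hom_component: "coef (hom_component d p) m = (if mdeg m = d then coef p m else 0)"
  by (auto simp: hom_component_def lookup_sum lookup_single when_def in_keys_iff)

lemma hom_component_add: "hom_component d (p + q) = hom_component d p + hom_component d q"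
  by (rule poly_mapping_eqI) (simp add: coef_hom_component lookup_add)

lemma hom_component_0 [simp]: "hom_component d 0 = 0"
  by (rule poly_mapping_eqI) (simp add: coef_hom_component)

lemma hom_component_diff: "hom_component d (p - q) = hom_component d p - hom_component d q"
  by (rule poly_mapping_eqI) (simp add: coef_hom_component lookup_minus)

lemma hom_component_sum: "hom_component d (\<Sum>i\<in>A. f i) = (\<Sum>i\<in>A. hom_component d (f i))"
  by (induction A rule: infinite_finite_induct) (simp_all add: hom_component_add)

lemma homogeneous_hom_component: "homogeneous_poly d (hom_component d p)"
  by (auto simp: homogeneous_poly_def in_keys_iff coef_hom_component split: if_splits)

lemma homogeneous_coef: "homogeneous_poly d p \<longleftrightarrow> (\<forall>m. coef p m \<noteq> 0 \<longrightarrow> mdeg m = d)"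
  by (auto simp: homogeneous_poly_def in_keys_iff)

lemma hom_component_homogeneous:
  "homogeneous_poly e p \<Longrightarrow> hom_component d p = (if d = e then p else 0)"
  by (rule poly_mapping_eqI) (auto simp: coef_hom_component homogeneous_coef)

lemma supp_hom_component: "supp (hom_component d p) \<subseteq> supp p"
  by (auto simp: in_keys_iff coef_hom_component split: if_splits)

lemma hom_component_carrier: "p \<in> poly_carrier n \<Longrightarrow> hom_component d p \<in> poly_carrier n"
  using supp_hom_component by (fastforce simp: poly_carrier_def)

lemma hom_component_forms: "p \<in> poly_carrier n \<Longrightarrow> hom_component d p \<in> forms n d"
  by (simp add: forms_def hom_component_carrier homogeneous_hom_component)

lemma homogeneous_mult:
  assumes "homogeneous_poly d p" "homogeneous_poly e q"
  shows "homogeneous_poly (d + e) (p * q)"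
  unfolding homogeneous_poly_def
proof
  fix m assume "m \<in> supp (p * q)"
  then obtain a b where "a \<in> supp p" "b \<in> supp q" "m = a + b"
    using keys_mult[of p q] by blast
  then show "mdeg m = d + e" using assms by (simp add: homogeneous_poly_def mdeg_add)
qed

lemma homogeneous_add:
  "homogeneous_poly d p \<Longrightarrow> homogeneous_poly d q \<Longrightarrow> homogeneous_poly d (p + q)"
  using Poly_Mapping.keys_add[of p q] by (auto simp: homogeneous_poly_def)

lemma homogeneous_0 [simp]: "homogeneous_poly d 0"
  by (simp add: homogeneous_poly_def)

lemma homogeneous_uminus: "homogeneous_poly d p \<Longrightarrow> homogeneous_poly d (- p)"
  by (simp add: homogeneous_coef)

lemma ex_degree_bound: "\<exists>N. \<forall>d\<ge>N. hom_component d p = 0"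
proof (intro exI allI impI)
  fix d assume d: "Suc (Max (insert 0 (mdeg ` supp p))) \<le> d"
  show "hom_component d p = 0"
  proof (rule poly_mapping_eqI)
    fix m
    have "mdeg m \<noteq> d" if "m \<in> supp p"
    proof -
      have "mdeg m \<le> Max (insert 0 (mdeg ` supp p))" using that by (intro Max_ge) auto
      then show ?thesis using d by linarith
    qed
    then show "coef (hom_component d p) m = coef 0 m"
      by (auto simp: coef_hom_component in_keys_iff)
  qed
qed

lemma sum_hom_components:
  assumes "\<forall>d\<ge>N. hom_component d p = 0"
  shows "p = (\<Sum>d<N. hom_component d p)"
proof (rule poly_mapping_eqI)
  fix m
  have "coef p m = 0" if "mdeg m \<ge> N"
    using assms that coef_hom_component[of "mdeg m" p m] by auto
  then show "coef p m = coef (\<Sum>d<N. hom_component d p) m"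
    by (auto simp: lookup_sum coef_hom_component)
qed

lemma hom_component_mult:
  assumes q: "homogeneous_poly e q"
  shows "hom_component d (p * q) = (if e \<le> d then hom_component (d - e) p * q else 0)"
proof -
  obtain N where N: "\<forall>d\<ge>N. hom_component d p = 0" using ex_degree_bound by blast
  have "p * q = (\<Sum>c<N. hom_component c p * q)"
    using sum_hom_components[OF N] by (metis sum_distrib_right)
  then have "hom_component d (p * q) = (\<Sum>c<N. hom_component d (hom_component c p * q))"
    by (simp add: hom_component_sum)
  also have "\<dots> = (\<Sum>c<N. if d = c + e then hom_component c p * q else 0)"
    by (intro sum.cong refl)
       (simp add: hom_component_homogeneous[OF homogeneous_mult[OF homogeneous_hom_component q]])
  also have "\<dots> = (if e \<le> d then hom_component (d - e) p * q else 0)"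
  proof (cases "e \<le> d")
    case True
    then have "(\<Sum>c<N. if d = c + e then hom_component c p * q else 0)
        = (\<Sum>c<N. if c = d - e then hom_component c p * q else 0)"
      by (intro sum.cong refl) auto
    also have "\<dots> = hom_component (d - e) p * q" using N by (auto simp: not_less)
    finally show ?thesis using True by simp
  next
    case False
    then show ?thesis by (auto intro!: sum.neutral)
  qed
  finally show ?thesis .
qed

lemma carrier_diff: "p \<in> poly_carrier n \<Longrightarrow> q \<in> poly_carrier n \<Longrightarrow> p - q \<in> poly_carrier n"
  using poly_carrier_add[of p n "- q"] by simp

lemma carrier_sum: "(\<And>i. i \<in> A \<Longrightarrow> f i \<in> poly_carrier n) \<Longrightarrow> (\<Sum>i\<in>A. f i) \<in> poly_carrier n"
  by (induction A rule: infinite_finite_induct) (simp_all add: poly_carrier_add)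

lemma carrier_power: "p \<in> poly_carrier n \<Longrightarrow> p ^ k \<in> poly_carrier n"
  by (induction k) (simp_all add: poly_carrier_mult)

lemma carrier_const [simp]: "const c \<in> poly_carrier n"
  by (auto simp: poly_carrier_def)

lemma carrier_var [simp]: "j \<le> n \<Longrightarrow> var j \<in> poly_carrier n"
  by (auto simp: poly_carrier_def var_def)

lemma forms_carrier: "f \<in> forms n d \<Longrightarrow> f \<in> poly_carrier n"
  by (simp add: forms_def)

lemma forms_0 [simp]: "0 \<in> forms n d" by (simp add: forms_def)

lemma forms_add: "f \<in> forms n d \<Longrightarrow> g \<in> forms n d \<Longrightarrow> f + g \<in> forms n d"
  by (simp add: forms_def poly_carrier_add homogeneous_add)

lemma forms_uminus: "f \<in> forms n d \<Longrightarrow> - f \<in> forms n d"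
  by (simp add: forms_def homogeneous_uminus)

lemma forms_diff: "f \<in> forms n d \<Longrightarrow> g \<in> forms n d \<Longrightarrow> f - g \<in> forms n d"
  using forms_add[of f n d "- g"] forms_uminus by auto

lemma forms_mult: "f \<in> forms n d \<Longrightarrow> g \<in> forms n e \<Longrightarrow> f * g \<in> forms n (d + e)"
  by (simp add: forms_def poly_carrier_mult homogeneous_mult)

lemma forms_const [simp]: "const c \<in> forms n 0"
  by (auto simp: forms_def homogeneous_poly_def)

lemma forms_const_mult: "f \<in> forms n d \<Longrightarrow> const c * f \<in> forms n d"
  using forms_mult[of "const c" n 0 f d] by simp

lemma forms_var: "j \<le> n \<Longrightarrow> var j \<in> forms n 1"
  by (auto simp: forms_def homogeneous_poly_def var_def poly_carrier_def)

lemma forms_var_mult: "j \<le> n \<Longrightarrow> f \<in> forms n d \<Longrightarrow> var j * f \<in> forms n (Suc d)"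
  using forms_mult[of "var j" n 1 f d] forms_var[of j n] by simp

lemma forms_sum: "(\<And>i. i \<in> A \<Longrightarrow> f i \<in> forms n d) \<Longrightarrow> (\<Sum>i\<in>A. f i) \<in> forms n d"
  by (induction A rule: infinite_finite_induct) (simp_all add: forms_add)

lemma forms_power: "f \<in> forms n 1 \<Longrightarrow> f ^ k \<in> forms n k"
proof (induction k)
  case 0 show ?case using forms_const[of 1 n] by simp
next
  case (Suc k)
  then show ?case using forms_mult[of f n 1 "f ^ k" k] by simp
qed

lemma hom_component_mult_left:
  "f \<in> forms n e \<Longrightarrow> hom_component d (f * p) = (if e \<le> d then f * hom_component (d - e) p else 0)"
  using hom_component_mult[of e f d p] by (simp add: forms_def mult.commute[of f])

lemma hom_component_form: "f \<in> forms n e \<Longrightarrow> hom_component d f = (if d = e then f else 0)"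
  by (simp add: forms_def hom_component_homogeneous)

lemma forms_single: "supp m \<subseteq> {..n} \<Longrightarrow> single m c \<in> forms n (mdeg m)"
  by (auto simp: forms_def poly_carrier_def homogeneous_poly_def)

lemma forms_supp: "f \<in> forms n d \<Longrightarrow> m \<in> supp f \<Longrightarrow> mdeg m = d \<and> supp m \<subseteq> {..n}"
  by (auto simp: forms_def poly_carrier_def homogeneous_poly_def)

lemma monomial_split:
  assumes "j \<in> supp m"
  obtains m' where "m = single j 1 + m'" "supp m' \<subseteq> supp m" "mdeg m = Suc (mdeg m')"
proof -
  define m' where "m' = m - single j 1"
  have "coef m j \<ge> 1" using assms by (simp add: in_keys_iff)
  then have m: "m = single j 1 + m'"
    by (intro poly_mapping_eqI) (auto simp: m'_def lookup_add lookup_minus lookup_single when_def)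
  moreover have "supp m' \<subseteq> supp m" by (auto simp: m'_def in_keys_iff lookup_minus)
  ultimately show ?thesis using that by (auto simp: mdeg_add)
qed

lemma supp_nonempty: "m \<noteq> (0 :: nat \<Rightarrow>\<^sub>0 nat) \<Longrightarrow> \<exists>j. j \<in> supp m"
  using poly_mapping_eqI[of m 0] unfolding in_keys_iff lookup_zero by blast

lemma forms_induct [consumes 1, case_names zero add single]:
  assumes "f \<in> forms n d" "P 0"
    and "\<And>f g. f \<in> forms n d \<Longrightarrow> g \<in> forms n d \<Longrightarrow> P f \<Longrightarrow> P g \<Longrightarrow> P (f + g)"
    and "\<And>m c. supp m \<subseteq> {..n} \<Longrightarrow> mdeg m = d \<Longrightarrow> P (single m c)"
  shows "P f"
proof -
  have "P (\<Sum>m\<in>A. single m (coef f m)) \<and>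
      (\<Sum>m\<in>A. single m (coef f m)) \<in> forms n d" if "A \<subseteq> supp f" for A
  proof -
    have "finite A" using finite_subset[OF that] by simp
    then show ?thesis using that
    proof (induction A rule: finite_induct)
      case (insert m A)
      have m: "mdeg m = d" "supp m \<subseteq> {..n}" using insert.prems forms_supp[OF assms(1)] by auto
      then have "single m (coef f m) \<in> forms n d" using forms_single by blast
      then show ?case using insert assms(3,4) m by (simp add: forms_add)
    qed (simp add: assms)
  qed
  from this[OF subset_refl] show ?thesis
    using poly_mapping_sum_single[OF finite_keys subset_refl, of f] by metis
qed

lemma forms_decompose:
  assumes "f \<in> forms n (Suc d)"
  shows "\<exists>A. (\<forall>j\<le>n. A j \<in> forms n d) \<and> f = (\<Sum>j\<le>n. var j * A j)"
  using assms
proof (induction rule: forms_induct)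
  case zero
  show ?case by (rule exI[of _ "\<lambda>_. 0"]) simp
next
  case (add f g)
  then obtain A B where "\<forall>j\<le>n. A j \<in> forms n d" "f = (\<Sum>j\<le>n. var j * A j)"
    "\<forall>j\<le>n. B j \<in> forms n d" "g = (\<Sum>j\<le>n. var j * B j)" by blast
  then show ?case
    by (intro exI[of _ "\<lambda>j. A j + B j"]) (simp add: forms_add distrib_left sum.distrib)
next
  case (single m c)
  then have "m \<noteq> 0" by auto
  then obtain j where "j \<in> supp m" using supp_nonempty by blast
  then obtain m' where "m = single j 1 + m'" "supp m' \<subseteq> supp m" "mdeg m = Suc (mdeg m')"
    by (rule monomial_split)
  then have j: "j \<le> n" "m = single j 1 + m'" "supp m' \<subseteq> {..n}" "mdeg m = Suc (mdeg m')"
    using single \<open>j \<in> supp m\<close> by auto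
  have "single m c = var j * single m' c"
    by (simp add: var_def mult_single j)
  also have "\<dots> = (\<Sum>i\<le>n. var i * (if i = j then single m' c else 0))"
    using j by (simp add: if_distrib cong: if_cong)
  finally show ?case
    using j single forms_single[of m' n c]
    by (intro exI[of _ "\<lambda>i. if i = j then single m' c else 0"]) auto
qed

text \<open>
  The target ring is arbitrary because substitutions of forms, restrictions to parametrised lines,
  their affine cones and values at points are all instances.
\<close>

definition monom_at :: "(nat \<Rightarrow> 'b::comm_ring_1) \<Rightarrow> (nat \<Rightarrow>\<^sub>0 nat) \<Rightarrow> 'b" where
  "monom_at \<sigma> m = (\<Prod>i\<in>supp m. \<sigma> i ^ coef m i)"

definition ev :: "('k::field \<Rightarrow> 'b::comm_ring_1) \<Rightarrow> (nat \<Rightarrow> 'b) \<Rightarrow> 'k mpoly \<Rightarrow> 'b" where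
  "ev c \<sigma> p = (\<Sum>m\<in>supp p. c (coef p m) * monom_at \<sigma> m)"

lemma monom_at_superset:
  "finite A \<Longrightarrow> supp m \<subseteq> A \<Longrightarrow> monom_at \<sigma> m = (\<Prod>i\<in>A. \<sigma> i ^ coef m i)"
  unfolding monom_at_def by (intro prod.mono_neutral_left) (auto simp: in_keys_iff)

lemma monom_at_add: "monom_at \<sigma> (m + m') = monom_at \<sigma> m * monom_at \<sigma> m'"
proof -
  let ?A = "supp m \<union> supp m'"
  have "monom_at \<sigma> (m + m') = (\<Prod>i\<in>?A. \<sigma> i ^ coef (m + m') i)"
    by (rule monom_at_superset) (use Poly_Mapping.keys_add[of m m'] in auto)
  then show ?thesis
    using monom_at_superset[of ?A m \<sigma>] monom_at_superset[of ?A m' \<sigma>]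
    by (simp add: lookup_add power_add prod.distrib)
qed

lemma monom_at_0 [simp]: "monom_at \<sigma> 0 = 1" by (simp add: monom_at_def)

lemma monom_at_single [simp]: "monom_at \<sigma> (single i e) = \<sigma> i ^ e"
  by (simp add: monom_at_def)

locale coeff_hom =
  fixes c :: "'k::field \<Rightarrow> 'b::comm_ring_1"
  assumes c_add: "c (x + y) = c x + c y" and c_mult: "c (x * y) = c x * c y" and c_1: "c 1 = 1"
begin

lemma c_0: "c 0 = 0" using c_add[of 0 0] by simp

lemma ev_superset:
  "finite A \<Longrightarrow> supp p \<subseteq> A \<Longrightarrow> ev c \<sigma> p = (\<Sum>m\<in>A. c (coef p m) * monom_at \<sigma> m)"
  unfolding ev_def by (intro sum.mono_neutral_left) (auto simp: in_keys_iff c_0)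

lemma ev_0 [simp]: "ev c \<sigma> 0 = 0" by (simp add: ev_def)

lemma ev_add [simp]: "ev c \<sigma> (p + q) = ev c \<sigma> p + ev c \<sigma> q"
proof -
  let ?A = "supp p \<union> supp q"
  have "ev c \<sigma> (p + q) = (\<Sum>m\<in>?A. c (coef (p + q) m) * monom_at \<sigma> m)"
    by (rule ev_superset) (use Poly_Mapping.keys_add[of p q] in auto)
  then show ?thesis
    using ev_superset[of ?A p] ev_superset[of ?A q]
    by (simp add: lookup_add c_add distrib_right sum.distrib)
qed

lemma ev_uminus [simp]: "ev c \<sigma> (- p) = - ev c \<sigma> p"
  using ev_add[of \<sigma> p "- p"] by (simp add: eq_neg_iff_add_eq_0 add.commute)

lemma ev_diff [simp]: "ev c \<sigma> (p - q) = ev c \<sigma> p - ev c \<sigma> q"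
  using ev_add[of \<sigma> p "- q"] by simp

lemma ev_sum: "ev c \<sigma> (\<Sum>i\<in>A. f i) = (\<Sum>i\<in>A. ev c \<sigma> (f i))"
  by (induction A rule: infinite_finite_induct) simp_all

lemma ev_single: "ev c \<sigma> (single m x) = c x * monom_at \<sigma> m"
  by (cases "x = 0") (simp_all add: ev_def c_0)

lemma ev_const [simp]: "ev c \<sigma> (const x) = c x"
  by (simp add: ev_single)

lemma ev_var [simp]: "ev c \<sigma> (var j) = \<sigma> j"
  by (simp add: var_def ev_single c_1)

lemma ev_1 [simp]: "ev c \<sigma> 1 = 1"
  using ev_const[of \<sigma> 1] by (simp add: c_1)

lemma ev_mult [simp]: "ev c \<sigma> (p * q) = ev c \<sigma> p * ev c \<sigma> q"
proof -
  have "p * q = (\<Sum>m\<in>supp p. \<Sum>m'\<in>supp q. single (m + m') (coef p m * coef q m'))"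
  proof -
    have "p * q = (\<Sum>m\<in>supp p. single m (coef p m)) *
        (\<Sum>m\<in>supp q. single m (coef q m))"
      using poly_mapping_sum_single[OF finite_keys subset_refl] by metis
    then show ?thesis by (simp add: sum_product mult_single)
  qed
  then have "ev c \<sigma> (p * q)
      = (\<Sum>m\<in>supp p. \<Sum>m'\<in>supp q. c (coef p m * coef q m') * monom_at \<sigma> (m + m'))"
    by (simp only: ev_sum ev_single)
  then show ?thesis
    by (simp add: ev_def sum_product monom_at_add c_mult mult_ac)
qed

lemma ev_power [simp]: "ev c \<sigma> (p ^ k) = ev c \<sigma> p ^ k"
  by (induction k) simp_all

lemma ev_prod: "ev c \<sigma> (\<Prod>i\<in>A. f i) = (\<Prod>i\<in>A. ev c \<sigma> (f i))"
  by (induction A rule: infinite_finite_induct) simp_all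

end

interpretation pc: coeff_hom "\<lambda>x::'k::field. [:x:]"
  by unfold_locales (simp_all add: one_pCons)

interpretation ppc: coeff_hom "\<lambda>x::'k::field. [:[:x:]:]"
  by unfold_locales (simp_all add: one_pCons)

interpretation idc: coeff_hom "\<lambda>x::'k::field. x"
  by unfold_locales simp_all

interpretation sc: coeff_hom "const :: 'k::field \<Rightarrow> 'k mpoly"
  by unfold_locales (simp_all add: single_add mult_single)

lemma forms_0_const: "f \<in> forms n 0 \<Longrightarrow> f = const (coef f 0)"
proof (rule poly_mapping_eqI)
  fix m assume f: "f \<in> forms n 0"
  show "coef f m = coef (const (coef f 0)) m"
  proof (cases "m = 0")
    case False
    then have "m \<notin> supp f" using forms_supp[OF f, of m] mdeg_eq_0_iff[of m] by blast
    then show ?thesis using False by (simp add: in_keys_iff lookup_single)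
  qed simp
qed

lemma carrier_induct [consumes 1, case_names const var add mult]:
  assumes f: "f \<in> poly_carrier n"
    and const: "\<And>c. P (const c)" and var: "\<And>j. j \<le> n \<Longrightarrow> P (var j)"
    and add: "\<And>f g. f \<in> poly_carrier n \<Longrightarrow> g \<in> poly_carrier n \<Longrightarrow> P f \<Longrightarrow> P g \<Longrightarrow> P (f + g)"
    and mult: "\<And>f g. f \<in> poly_carrier n \<Longrightarrow> g \<in> poly_carrier n \<Longrightarrow> P f \<Longrightarrow> P g \<Longrightarrow> P (f * g)"
  shows "P f"
proof -
  have form: "P f" if "f \<in> forms n d" for f d
    using that
  proof (induction d arbitrary: f)
    case 0
    from forms_0_const[OF 0] show ?case using const by metis
  next
    case (Suc d)
    obtain A where A: "\<forall>j\<le>n. A j \<in> forms n d" "f = (\<Sum>j\<le>n. var j * A j)"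
      using forms_decompose[OF Suc.prems] by blast
    have "P (\<Sum>j\<in>B. var j * A j) \<and> (\<Sum>j\<in>B. var j * A j) \<in> poly_carrier n" if "B \<subseteq> {..n}" for B
    proof -
      have "finite B" using finite_subset[OF that] by simp
      then show ?thesis using that
      proof (induction B rule: finite_induct)
        case empty
        then show ?case using const[of 0] by simp
      next
        case (insert j B)
        then show ?case using A Suc.IH var
          by (auto intro!: add mult poly_carrier_add poly_carrier_mult simp: forms_carrier)
      qed
    qed
    then show ?case using A by auto
  qed
  obtain N where N: "\<forall>d\<ge>N. hom_component d f = 0" using ex_degree_bound by blast
  have "P (\<Sum>d<M. hom_component d f) \<and> (\<Sum>d<M. hom_component d f) \<in> poly_carrier n" for M
  proof (induction M)
    case 0
    then show ?case using const[of 0] by simp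
  next
    case (Suc M)
    then show ?case using form[OF hom_component_forms[OF f]]
      by (auto intro!: add poly_carrier_add hom_component_carrier f)
  qed
  then show ?thesis using sum_hom_components[OF N] by metis
qed

section \<open>Graded submodules of free modules\<close>

lemma smul_simps [simp]:
  "smul (0::'b::comm_ring_1) v = 0" "smul f (0 :: 'a \<Rightarrow>\<^sub>0 'b) = 0" "smul 1 v = v"
  by (rule poly_mapping_eqI; simp)+

lemma smul_add_right: "smul (f::'b::comm_ring_1) (v + w) = smul f v + smul f w"
  by (rule poly_mapping_eqI) (simp add: lookup_add distrib_left)

lemma smul_add_left: "smul (f + g::'b::comm_ring_1) v = smul f v + smul g v"
  by (rule poly_mapping_eqI) (simp add: lookup_add distrib_right)

lemma smul_diff_right: "smul (f::'b::comm_ring_1) (v - w) = smul f v - smul f w"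
  by (rule poly_mapping_eqI) (simp add: lookup_minus right_diff_distrib)

lemma smul_smul: "smul (f::'b::comm_ring_1) (smul g v) = smul (f * g) v"
  by (rule poly_mapping_eqI) (simp add: mult.assoc)

lemma smul_minus_one: "smul (- 1 ::'b::comm_ring_1) v = - v"
  by (rule poly_mapping_eqI) simp

lemma smul_sum_right: "smul (f::'b::comm_ring_1) (\<Sum>i\<in>A. v i) = (\<Sum>i\<in>A. smul f (v i))"
  by (induction A rule: infinite_finite_induct) (simp_all add: smul_add_right)

definition vec :: "nat \<Rightarrow> (nat \<Rightarrow> 'k::field mpoly) \<Rightarrow> 'k mvec" where
  "vec k f = (\<Sum>j<k. single j (f j))"

lemma coef_vec [simp]: "coef (vec k f) j = (if j < k then f j else 0)"
  by (simp add: vec_def lookup_sum lookup_single when_def cong: if_cong)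

lemma free_module_iff:
  "v \<in> free_module n k \<longleftrightarrow> (\<forall>j\<ge>k. coef v j = 0) \<and> (\<forall>j. coef v j \<in> poly_carrier n)"
proof -
  have "supp v \<subseteq> {..<k} \<longleftrightarrow> (\<forall>j\<ge>k. coef v j = 0)"
    unfolding subset_iff in_keys_iff lessThan_iff by (meson not_le)
  then show ?thesis by (simp add: free_module_def)
qed

lemma submodule_free_module: "is_submodule n (free_module n k)"
  by (auto simp: is_submodule_def free_module_iff lookup_add poly_carrier_add poly_carrier_mult)

lemma vec_free_module: "(\<And>j. j < k \<Longrightarrow> f j \<in> poly_carrier n) \<Longrightarrow> vec k f \<in> free_module n k"
  by (auto simp: free_module_iff)

lemma submoduleD:
  assumes "is_submodule n M"
  shows "0 \<in> M" "\<And>v w. v \<in> M \<Longrightarrow> w \<in> M \<Longrightarrow> v + w \<in> M"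
    "\<And>f v. f \<in> poly_carrier n \<Longrightarrow> v \<in> M \<Longrightarrow> smul f v \<in> M"
  using assms by (auto simp: is_submodule_def)

lemma submodule_uminus: "is_submodule n M \<Longrightarrow> v \<in> M \<Longrightarrow> - v \<in> M"
  using submoduleD(3)[of n M "- 1" v] by (simp add: smul_minus_one)

lemma submodule_diff: "is_submodule n M \<Longrightarrow> v \<in> M \<Longrightarrow> w \<in> M \<Longrightarrow> v - w \<in> M"
  using submoduleD(2)[of n M v "- w"] submodule_uminus[of n M w] by simp

lemma submodule_sum:
  "is_submodule n M \<Longrightarrow> (\<And>i. i \<in> A \<Longrightarrow> v i \<in> M) \<Longrightarrow> (\<Sum>i\<in>A. v i) \<in> M"
  by (induction A rule: infinite_finite_induct) (auto intro: submoduleD)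

lemma submodule_hull: "is_submodule n (is_submodule n hull A)"
  by (rule hull_in) (auto simp: is_submodule_def)

lemma hull_subset_submodule: "is_submodule n M \<Longrightarrow> A \<subseteq> M \<Longrightarrow> is_submodule n hull A \<subseteq> M"
  by (rule hull_minimal)

definition vcomp :: "int list \<Rightarrow> int \<Rightarrow> 'k::field mvec \<Rightarrow> 'k mvec" where
  "vcomp a D v = vec (length a)
     (\<lambda>j. if a ! j \<le> D then hom_component (nat (D - a ! j)) (coef v j) else 0)"

lemma coef_vcomp: "coef (vcomp a D v) j =
    (if j < length a \<and> a ! j \<le> D then hom_component (nat (D - a ! j)) (coef v j) else 0)"
  by (simp add: vcomp_def)

lemma vcomp_add: "vcomp a D (v + w) = vcomp a D v + vcomp a D w"
  by (rule poly_mapping_eqI) (simp add: coef_vcomp lookup_add hom_component_add)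

lemma vcomp_diff: "vcomp a D (v - w) = vcomp a D v - vcomp a D w"
  by (rule poly_mapping_eqI) (simp add: coef_vcomp lookup_minus hom_component_diff)

lemma vcomp_0 [simp]: "vcomp a D 0 = 0"
  by (rule poly_mapping_eqI) (simp add: coef_vcomp)

lemma vcomp_sum: "vcomp a D (\<Sum>i\<in>A. v i) = (\<Sum>i\<in>A. vcomp a D (v i))"
  by (induction A rule: infinite_finite_induct) (simp_all add: vcomp_add)

lemma homogeneous_vec_iff:
  "homogeneous_vec a D v \<longleftrightarrow>
    (\<forall>j<length a. if a ! j \<le> D then homogeneous_poly (nat (D - a ! j)) (coef v j) else coef v j = 0)"
proof -
  have "(\<forall>m\<in>supp p. int (mdeg m) + e = D) \<longleftrightarrow>
      (if e \<le> D then homogeneous_poly (nat (D - e)) p else p = 0)" for e and p :: "'a mpoly"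
  proof (cases "e \<le> D")
    case True
    then show ?thesis by (auto simp: homogeneous_poly_def)
  next
    case False
    have "p = 0 \<longleftrightarrow> supp p = {}" using poly_mapping_eqI[of p 0] by (auto simp: in_keys_iff)
    then show ?thesis using False by auto
  qed
  then show ?thesis unfolding homogeneous_vec_def by simp
qed

lemma homogeneous_vcomp: "homogeneous_vec a D (vcomp a D v)"
  by (simp add: homogeneous_vec_iff coef_vcomp homogeneous_hom_component)

lemma vcomp_homogeneous:
  assumes "homogeneous_vec a D v" "v \<in> free_module n (length a)"
  shows "vcomp a D v = v"
proof (rule poly_mapping_eqI)
  fix j
  show "coef (vcomp a D v) j = coef v j"
    using assms hom_component_homogeneous[of "nat (D - a ! j)" "coef v j" "nat (D - a ! j)"]
    by (cases "j < length a"; cases "a ! j \<le> D")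
       (auto simp: coef_vcomp homogeneous_vec_iff free_module_iff)
qed

lemma vcomp_free_module: "v \<in> free_module n k \<Longrightarrow> vcomp a D v \<in> free_module n (length a)"
  by (auto simp: free_module_iff coef_vcomp hom_component_carrier)

lemma homogeneous_vec_add:
  "homogeneous_vec a D v \<Longrightarrow> homogeneous_vec a D w \<Longrightarrow> homogeneous_vec a D (v + w)"
  by (auto simp: homogeneous_vec_iff lookup_add homogeneous_add split: if_splits)

lemma homogeneous_vec_0 [simp]: "homogeneous_vec a D 0"
  by (simp add: homogeneous_vec_iff)

lemma vcomp_smul_form:
  assumes f: "f \<in> forms n e"
  shows "vcomp a D (smul f v) = smul f (vcomp a (D - int e) v)"
proof (rule poly_mapping_eqI)
  fix j
  show "coef (vcomp a D (smul f v)) j = coef (smul f (vcomp a (D - int e) v)) j"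
    using hom_component_mult_left[OF f, of "nat (D - a ! j)" "coef v j"]
    by (auto simp: coef_vcomp nat_diff_distrib le_nat_iff nat_le_eq_zle
        intro!: arg_cong2[of _ _ _ _ hom_component])
qed

lemma vcomp_smul_homogeneous:
  assumes v: "homogeneous_vec a e v" "v \<in> free_module n (length a)"
  shows "vcomp a D (smul f v) = smul (if e \<le> D then hom_component (nat (D - e)) f else 0) v"
proof (rule poly_mapping_eqI)
  fix j
  consider "j \<ge> length a \<or> coef v j = 0" | "j < length a" "a ! j \<le> e" "coef v j \<noteq> 0"
    using v(1) unfolding homogeneous_vec_iff by (meson not_le)
  then show "coef (vcomp a D (smul f v)) j
      = coef (smul (if e \<le> D then hom_component (nat (D - e)) f else 0) v) j"
  proof cases
    case 1
    then show ?thesis using v(2) by (auto simp: coef_vcomp free_module_iff)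
  next
    case 2
    then have "homogeneous_poly (nat (e - a ! j)) (coef v j)"
      using v(1) by (auto simp: homogeneous_vec_iff split: if_splits)
    from hom_component_mult[OF this, of "nat (D - a ! j)" f] 2
    show ?thesis
      by (cases "e \<le> D") (auto simp: coef_vcomp nat_diff_distrib[symmetric] algebra_simps)
  qed
qed

lemma sum_vcomp:
  assumes "v \<in> free_module n (length a)"
  obtains A where "finite A" "v = (\<Sum>D\<in>A. vcomp a D v)"
proof -
  have "\<exists>N. \<forall>d\<ge>N. hom_component d (coef v j) = 0" for j using ex_degree_bound by blast
  then obtain N where N: "\<And>j d. d \<ge> N j \<Longrightarrow> hom_component d (coef v j) = 0" by metis
  define A where "A = (\<Union>j<length a. (\<lambda>d. int d + a ! j) ` {..<N j})"
  have "coef v j = coef (\<Sum>D\<in>A. vcomp a D v) j" for j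
  proof (cases "j < length a")
    case True
    let ?g = "\<lambda>D. if a ! j \<le> D then hom_component (nat (D - a ! j)) (coef v j) else 0"
    have "coef (\<Sum>D\<in>A. vcomp a D v) j = (\<Sum>D\<in>A. ?g D)"
      using True by (simp add: lookup_sum coef_vcomp)
    also have "\<dots> = (\<Sum>D\<in>(\<lambda>d. int d + a ! j) ` {..<N j}. ?g D)"
    proof (rule sum.mono_neutral_right)
      show "finite A" by (simp add: A_def)
      show "(\<lambda>d. int d + a ! j) ` {..<N j} \<subseteq> A" using True by (auto simp: A_def)
      show "\<forall>D\<in>A - (\<lambda>d. int d + a ! j) ` {..<N j}. ?g D = 0"
      proof
        fix D assume D: "D \<in> A - (\<lambda>d. int d + a ! j) ` {..<N j}"
        show "?g D = 0"
        proof (cases "a ! j \<le> D")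
          case True
          then have "D = int (nat (D - a ! j)) + a ! j" by simp
          then have "\<not> nat (D - a ! j) < N j" using D by blast
          then show ?thesis using N by simp
        qed simp
      qed
    qed
    also have "\<dots> = (\<Sum>d<N j. hom_component d (coef v j))"
      by (subst sum.reindex) (auto simp: inj_on_def)
    also have "\<dots> = coef v j" using sum_hom_components[of "N j" "coef v j"] N by simp
    finally show ?thesis by simp
  next
    case False
    then show ?thesis using assms by (simp add: lookup_sum coef_vcomp free_module_iff)
  qed
  then have "v = (\<Sum>D\<in>A. vcomp a D v)" by (rule poly_mapping_eqI)
  moreover have "finite A" by (simp add: A_def)
  ultimately show ?thesis using that by blast
qed

definition graded :: "nat \<Rightarrow> int list \<Rightarrow> 'k::field mvec set \<Rightarrow> bool" where
  "graded n a Z \<longleftrightarrow> is_submodule n Z \<and> Z \<subseteq> free_module n (length a) \<and>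
     (\<forall>v\<in>Z. \<forall>D. vcomp a D v \<in> Z)"

lemma graded_free_module: "graded n a (free_module n (length a))"
  by (auto simp: graded_def submodule_free_module vcomp_free_module)

section \<open>Filter-regular sequences bound regularity\<close>

text \<open>This is \<open>(h\<^sub>0, \<dots>, h\<^bsub>i-1\<^esub>) M\<close>, written without ideals so that \<open>M\<close> may be any set of vectors.\<close>

definition multiples :: "(nat \<Rightarrow> 'k::field mpoly) \<Rightarrow> nat \<Rightarrow> 'k mvec set \<Rightarrow> 'k mvec set" where
  "multiples h i M = {v. \<exists>s. (\<forall>j<i. s j \<in> M) \<and> v = (\<Sum>j<i. smul (h j) (s j))}"

lemma multiples_mono: "M \<subseteq> N \<Longrightarrow> multiples h i M \<subseteq> multiples h i N"
  by (fastforce simp: multiples_def)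

lemma multiples_0 [simp]: "multiples h 0 M = {0}"
  by (auto simp: multiples_def)

lemma multiples_Suc_iff:
  "v \<in> multiples h (Suc i) M \<longleftrightarrow> (\<exists>s\<in>M. v - smul (h i) s \<in> multiples h i M)"
proof
  assume "v \<in> multiples h (Suc i) M"
  then obtain s where s: "\<forall>j<Suc i. s j \<in> M" "v = (\<Sum>j<Suc i. smul (h j) (s j))"
    by (auto simp: multiples_def)
  then show "\<exists>s\<in>M. v - smul (h i) s \<in> multiples h i M"
    by (intro bexI[of _ "s i"]) (auto simp: multiples_def intro!: exI[of _ s])
next
  assume "\<exists>s\<in>M. v - smul (h i) s \<in> multiples h i M"
  then obtain t s where t: "t \<in> M" and s: "\<forall>j<i. s j \<in> M" "v - smul (h i) t = (\<Sum>j<i. smul (h j) (s j))"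
    by (auto simp: multiples_def)
  have "v = (\<Sum>j<Suc i. smul (h j) ((s(i := t)) j))"
    using s(2) by (simp add: diff_eq_eq)
  then show "v \<in> multiples h (Suc i) M"
    using t s(1) unfolding multiples_def by (intro CollectI exI[of _ "s(i := t)"]) auto
qed

lemma submodule_multiples:
  fixes h :: "nat \<Rightarrow> 'k::field mpoly"
  assumes "is_submodule n M"
  shows "is_submodule n (multiples h i M)"
  unfolding is_submodule_def
proof (intro conjI ballI)
  show "0 \<in> multiples h i M"
    using submoduleD(1)[OF assms] by (auto simp: multiples_def intro!: exI[of _ "\<lambda>_. 0"])
next
  fix v w assume "v \<in> multiples h i M" "w \<in> multiples h i M"
  then obtain s t where "\<forall>j<i. s j \<in> M" "v = (\<Sum>j<i. smul (h j) (s j))"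
    "\<forall>j<i. t j \<in> M" "w = (\<Sum>j<i. smul (h j) (t j))" by (auto simp: multiples_def)
  then show "v + w \<in> multiples h i M"
    using submoduleD(2)[OF assms] unfolding multiples_def
    by (intro CollectI exI[of _ "\<lambda>j. s j + t j"]) (simp add: smul_add_right sum.distrib)
next
  fix f :: "'k mpoly" and v assume "f \<in> poly_carrier n" "v \<in> multiples h i M"
  then obtain s where "\<forall>j<i. s j \<in> M" "v = (\<Sum>j<i. smul (h j) (s j))" "f \<in> poly_carrier n"
    by (auto simp: multiples_def)
  then show "smul f v \<in> multiples h i M"
    using submoduleD(3)[OF assms] unfolding multiples_def
    by (intro CollectI exI[of _ "\<lambda>j. smul f (s j)"])
       (simp add: smul_sum_right smul_smul mult.commute)
qed

text \<open>
  Coordinates adapted to a general hyperplane are the intended example. The first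
  coordinate can then be chosen as a nonzerodivisor modulo a given saturated ideal.
\<close>

locale linear_coordinates =
  fixes n :: nat and h :: "nat \<Rightarrow> 'k::field mpoly"
  assumes h_form: "j \<le> n \<Longrightarrow> h j \<in> forms n 1"
    and h_regular: "\<lbrakk>i \<le> n; f \<in> poly_carrier n; \<forall>j<i. s j \<in> poly_carrier n;
        h i * f = (\<Sum>j<i. h j * s j)\<rbrakk>
      \<Longrightarrow> \<exists>t. (\<forall>j<i. t j \<in> poly_carrier n) \<and> f = (\<Sum>j<i. h j * t j)"
    and h_generate: "f \<in> forms n (Suc d)
      \<Longrightarrow> \<exists>t. (\<forall>j\<le>n. t j \<in> poly_carrier n) \<and> f = (\<Sum>j\<le>n. h j * t j)"
begin

lemma h_carrier: "j \<le> n \<Longrightarrow> h j \<in> poly_carrier n"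
  using h_form forms_carrier by blast

lemma multiples_free_iff:
  "v \<in> multiples h i (free_module n k) \<longleftrightarrow> (\<forall>l\<ge>k. coef v l = 0) \<and>
     (\<forall>l<k. \<exists>t. (\<forall>j<i. t j \<in> poly_carrier n) \<and> coef v l = (\<Sum>j<i. h j * t j))"
proof
  assume "v \<in> multiples h i (free_module n k)"
  then obtain s where s: "\<forall>j<i. s j \<in> free_module n k" "v = (\<Sum>j<i. smul (h j) (s j))"
    by (auto simp: multiples_def)
  have "\<exists>t. (\<forall>j<i. t j \<in> poly_carrier n) \<and> coef v l = (\<Sum>j<i. h j * t j)" for l
    using s by (intro exI[of _ "\<lambda>j. coef (s j) l"]) (simp add: lookup_sum free_module_iff)
  moreover have "\<forall>l\<ge>k. coef v l = 0"
    using s by (simp add: lookup_sum free_module_iff)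
  ultimately show "(\<forall>l\<ge>k. coef v l = 0) \<and>
     (\<forall>l<k. \<exists>t. (\<forall>j<i. t j \<in> poly_carrier n) \<and> coef v l = (\<Sum>j<i. h j * t j))"
    by blast
next
  assume v: "(\<forall>l\<ge>k. coef v l = 0) \<and>
     (\<forall>l<k. \<exists>t. (\<forall>j<i. t j \<in> poly_carrier n) \<and> coef v l = (\<Sum>j<i. h j * t j))"
  then have "\<forall>l. \<exists>t. l < k \<longrightarrow> (\<forall>j<i. t j \<in> poly_carrier n) \<and> coef v l = (\<Sum>j<i. h j * t j)"
    by blast
  then obtain t where t: "\<And>l. l < k \<Longrightarrow> (\<forall>j<i. t l j \<in> poly_carrier n) \<and>
      coef v l = (\<Sum>j<i. h j * t l j)" by metis
  have "v = (\<Sum>j<i. smul (h j) (vec k (\<lambda>l. t l j)))"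
  proof (rule poly_mapping_eqI)
    fix l
    show "coef v l = coef (\<Sum>j<i. smul (h j) (vec k (\<lambda>l. t l j))) l"
      using t[of l] v by (cases "l < k") (simp_all add: lookup_sum)
  qed
  moreover have "\<forall>j<i. vec k (\<lambda>l. t l j) \<in> free_module n k"
    using t by (auto intro!: vec_free_module)
  ultimately show "v \<in> multiples h i (free_module n k)"
    unfolding multiples_def by (intro CollectI exI[of _ "\<lambda>j. vec k (\<lambda>l. t l j)"]) auto
qed

lemma free_module_regular:
  assumes "i \<le> n" "v \<in> free_module n k" "smul (h i) v \<in> multiples h i (free_module n k)"
  shows "v \<in> multiples h i (free_module n k)"
  unfolding multiples_free_iff
proof (intro conjI allI impI)
  fix l assume l: "l < k"
  then obtain s where "\<forall>j<i. s j \<in> poly_carrier n" "h i * coef v l = (\<Sum>j<i. h j * s j)"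
    using assms(3) by (auto simp: multiples_free_iff)
  then show "\<exists>t. (\<forall>j<i. t j \<in> poly_carrier n) \<and> coef v l = (\<Sum>j<i. h j * t j)"
    using h_regular[OF assms(1)] assms(2) by (auto simp: free_module_iff)
qed (use assms(2) in \<open>simp add: free_module_iff\<close>)

lemma free_module_generate:
  assumes "\<forall>j<length a. a ! j < D" "v \<in> free_module n (length a)" "homogeneous_vec a D v"
  shows "v \<in> multiples h (Suc n) (free_module n (length a))"
  unfolding multiples_free_iff
proof (intro conjI allI impI)
  fix l assume l: "l < length a"
  then have "a ! l < D" using assms(1) by auto
  then obtain d where d: "nat (D - a ! l) = Suc d"
    by (metis diff_gt_0_iff_gt gr0_implies_Suc zero_less_nat_eq)
  then have "coef v l \<in> forms n (Suc d)"
    using l \<open>a ! l < D\<close> assms(2,3) by (auto simp: homogeneous_vec_iff forms_def free_module_iff)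
  then show "\<exists>t. (\<forall>j<Suc n. t j \<in> poly_carrier n) \<and> coef v l = (\<Sum>j<Suc n. h j * t j)"
    using h_generate by (simp add: less_Suc_eq_le lessThan_Suc_atMost)
qed (use assms(2) in \<open>simp add: free_module_iff\<close>)

text \<open>
  The invariant passed down a resolution: in degrees \<open>\<ge> r\<close> each \<open>h\<^sub>i\<close> is injective on
  \<open>F / (Z + (h\<^sub>0, \<dots>, h\<^bsub>i-1\<^esub>) F)\<close>, where \<open>F\<close> has its generators in degrees \<open>< r\<close>.
\<close>

definition filter_regular :: "int \<Rightarrow> int list \<Rightarrow> 'k mvec set \<Rightarrow> bool" where
  "filter_regular r a Z \<longleftrightarrow> graded n a Z \<and> (\<forall>j<length a. a ! j < r) \<and>
     (\<forall>i\<le>n. \<forall>D\<ge>r. \<forall>v\<in>free_module n (length a). homogeneous_vec a D v \<longrightarrow>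
        (\<exists>z\<in>Z. smul (h i) v - z \<in> multiples h i (free_module n (length a))) \<longrightarrow>
        (\<exists>z\<in>Z. v - z \<in> multiples h i (free_module n (length a))))"

lemma filter_regularD:
  assumes "filter_regular r a Z" "i \<le> n" "D \<ge> r" "v \<in> free_module n (length a)"
    "homogeneous_vec a D v" "z \<in> Z"
    "smul (h i) v - z \<in> multiples h i (free_module n (length a))"
  shows "\<exists>z\<in>Z. v - z \<in> multiples h i (free_module n (length a))"
  using assms unfolding filter_regular_def by blast

lemma vcomp_multiples:
  assumes "i \<le> Suc n" "graded n a M" "v \<in> multiples h i M"
  obtains s where "\<forall>j<i. s j \<in> M \<and> homogeneous_vec a (D - 1) (s j)"
    "vcomp a D v = (\<Sum>j<i. smul (h j) (s j))"
proof -
  obtain s where s: "\<forall>j<i. s j \<in> M" "v = (\<Sum>j<i. smul (h j) (s j))"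
    using assms(3) by (auto simp: multiples_def)
  have "vcomp a D v = (\<Sum>j<i. smul (h j) (vcomp a (D - 1) (s j)))"
    unfolding s(2) vcomp_sum
  proof (rule sum.cong)
    fix j assume "j \<in> {..<i}"
    then have "h j \<in> forms n 1" using h_form assms(1) by simp
    from vcomp_smul_form[OF this, of a D "s j"]
    show "vcomp a D (smul (h j) (s j)) = smul (h j) (vcomp a (D - 1) (s j))" by simp
  qed simp
  then show ?thesis
    using that[of "\<lambda>j. vcomp a (D - 1) (s j)"] s assms(2)
    by (auto simp: graded_def homogeneous_vcomp)
qed

text \<open>
  Vanishing of \<open>Tor\<^sub>1(S/(h\<^sub>0, \<dots>, h\<^bsub>i-1\<^esub>), F/Z)\<close> in degrees \<open>> r\<close>: the coefficient of the last
  \<open>h\<close> in a relation lies in \<open>Z\<close> modulo the others by filter-regularity, and can be peeled off.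
\<close>

lemma filter_regular_multiples:
  assumes Z: "filter_regular r a Z" and D: "D \<ge> r + 1"
  shows "\<lbrakk>i \<le> Suc n; v \<in> Z; homogeneous_vec a D v; v \<in> multiples h i (free_module n (length a))\<rbrakk>
    \<Longrightarrow> v \<in> multiples h i Z"
proof (induction i arbitrary: v)
  case (Suc i)
  let ?F = "free_module n (length a)"
  have gr: "graded n a Z" and sub: "is_submodule n Z" and ZF: "Z \<subseteq> ?F"
    using Z by (auto simp: filter_regular_def graded_def)
  have "i \<le> n" using Suc.prems by simp
  obtain s where s: "\<forall>j<Suc i. s j \<in> ?F \<and> homogeneous_vec a (D - 1) (s j)"
    "vcomp a D v = (\<Sum>j<Suc i. smul (h j) (s j))"
    by (rule vcomp_multiples[OF Suc.prems(1) graded_free_module Suc.prems(4), of D])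
  have v: "v = (\<Sum>j<Suc i. smul (h j) (s j))"
    using s(2) vcomp_homogeneous[of a D v n] Suc.prems ZF by auto
  have lower: "(\<Sum>j<i. smul (h j) (s j)) \<in> multiples h i ?F"
    using s(1) by (auto simp: multiples_def intro!: exI[of _ s])
  have "smul (h i) (s i) - v = - (\<Sum>j<i. smul (h j) (s j))" using v by simp
  then have "smul (h i) (s i) - v \<in> multiples h i ?F"
    using submodule_uminus[OF submodule_multiples[OF submodule_free_module] lower] by simp
  then obtain z where z: "z \<in> Z" "s i - z \<in> multiples h i ?F"
    using filter_regularD[OF Z \<open>i \<le> n\<close>, of "D - 1" "s i" v] D s(1) Suc.prems by auto
  define z' where "z' = vcomp a (D - 1) z"
  have z'Z: "z' \<in> Z" using z(1) gr by (auto simp: graded_def z'_def)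
  have "s i - z' = vcomp a (D - 1) (s i - z)"
    using s(1) vcomp_homogeneous[of a "D - 1" "s i" n] by (auto simp: vcomp_diff z'_def)
  also have "\<dots> \<in> multiples h i ?F"
    by (rule vcomp_multiples[OF _ graded_free_module z(2), of "D - 1"])
       (use \<open>i \<le> n\<close> in \<open>auto simp: multiples_def\<close>)
  finally have z'2: "s i - z' \<in> multiples h i ?F" .
  have hi: "h i \<in> poly_carrier n" "homogeneous_poly 1 (h i)"
    using h_form[OF \<open>i \<le> n\<close>] by (auto simp: forms_def)
  define w where "w = v - smul (h i) z'"
  have wZ: "w \<in> Z" using Suc.prems z'Z hi sub by (auto simp: w_def intro: submodule_diff submoduleD)
  have "w = (\<Sum>j<i. smul (h j) (s j)) + smul (h i) (s i - z')"
    by (simp add: w_def v smul_diff_right)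
  then have wF: "w \<in> multiples h i ?F"
    using submoduleD(2,3)[OF submodule_multiples[OF submodule_free_module[of n "length a"],
        where h = h and i = i]] lower z'2 hi(1) by simp
  have "vcomp a D w = w"
  proof -
    have "vcomp a D w = v - smul (h i) (vcomp a (D - 1) z')"
      using vcomp_homogeneous[of a D v n] Suc.prems ZF vcomp_smul_form[OF h_form[OF \<open>i \<le> n\<close>], of a D z']
      by (auto simp: w_def vcomp_diff)
    moreover have "vcomp a (D - 1) z' = z'"
      using vcomp_homogeneous[of a "D - 1" z' n] z'Z ZF by (auto simp: z'_def homogeneous_vcomp)
    ultimately show ?thesis by (simp add: w_def)
  qed
  then have "homogeneous_vec a D w" using homogeneous_vcomp by metis
  then have "w \<in> multiples h i Z" using Suc.IH wZ wF \<open>i \<le> n\<close> by simp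
  then show ?case using z'Z by (auto simp: multiples_Suc_iff w_def)
qed (auto simp: multiples_def)

text \<open>
  Elements of degree \<open>> r\<close> lie in \<open>(h\<^sub>0, \<dots>, h\<^sub>n) F\<close> because \<open>F\<close> is generated in degrees \<open>< r\<close>, hence in
  \<open>(h\<^sub>0, \<dots>, h\<^sub>n) Z\<close>; by induction they are generated in degrees \<open>\<le> r\<close>.
\<close>

lemma filter_regular_generated:
  assumes Z: "filter_regular r a Z"
  shows "is_submodule n hull {v \<in> Z. \<exists>D\<le>r. homogeneous_vec a D v} = Z" (is "?H = Z")
proof
  have sub: "is_submodule n Z" and gr: "graded n a Z" and ZF: "Z \<subseteq> free_module n (length a)"
    using Z by (auto simp: filter_regular_def graded_def)
  then show "?H \<subseteq> Z" by (intro hull_subset_submodule) auto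
  have hom: "v \<in> ?H" if "v \<in> Z" "homogeneous_vec a (r + int e) v" for v e
    using that
  proof (induction e arbitrary: v)
    case 0
    then show ?case using hull_subset[of "{v \<in> Z. \<exists>D\<le>r. homogeneous_vec a D v}" "is_submodule n"]
      by auto
  next
    case (Suc e)
    let ?D = "r + int (Suc e)"
    have "v \<in> multiples h (Suc n) (free_module n (length a))"
      using free_module_generate[of a ?D v] Z Suc.prems ZF by (fastforce simp: filter_regular_def)
    then have "v \<in> multiples h (Suc n) Z"
      using filter_regular_multiples[OF Z, of ?D "Suc n" v] Suc.prems by simp
    then obtain s where s: "\<forall>j<Suc n. s j \<in> Z \<and> homogeneous_vec a (?D - 1) (s j)"
      "vcomp a ?D v = (\<Sum>j<Suc n. smul (h j) (s j))"
      by (rule vcomp_multiples[OF order_refl gr, of v ?D])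
    have "v = (\<Sum>j<Suc n. smul (h j) (s j))"
      using s(2) vcomp_homogeneous[of a ?D v n] Suc.prems ZF by auto
    moreover have "s j \<in> ?H" if "j < Suc n" for j using Suc.IH[of "s j"] s(1) that by simp
    moreover have "(\<Sum>j<Suc n. smul (h j) (s j)) \<in> ?H"
      using calculation(2) h_carrier
      by (intro submodule_sum[OF submodule_hull] submoduleD(3)[OF submodule_hull]) auto
    ultimately show ?case by simp
  qed
  show "Z \<subseteq> ?H"
  proof
    fix v assume v: "v \<in> Z"
    then obtain A where A: "finite A" "v = (\<Sum>D\<in>A. vcomp a D v)" using sum_vcomp ZF by blast
    have "vcomp a D v \<in> ?H" for D
    proof (cases "D \<le> r")
      case True
      then have "vcomp a D v \<in> {v \<in> Z. \<exists>D\<le>r. homogeneous_vec a D v}"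
        using gr v homogeneous_vcomp by (auto simp: graded_def)
      then show ?thesis by (rule hull_inc)
    next
      case False
      then show ?thesis using hom[of "vcomp a D v" "nat (D - r)"] gr v
        by (simp add: graded_def homogeneous_vcomp)
    qed
    then have "(\<Sum>D\<in>A. vcomp a D v) \<in> ?H" by (intro submodule_sum[OF submodule_hull])
    then show "v \<in> ?H" using A by simp
  qed
qed

end


section \<open>Minimal free resolutions\<close>

lemma finite_monomials: "finite {m. supp m \<subseteq> {..n} \<and> mdeg m \<le> N}"
proof (induction N)
  case 0
  have "{m. supp m \<subseteq> {..n} \<and> mdeg m \<le> 0} \<subseteq> {0}" by (auto simp: mdeg_eq_0_iff)
  then show ?case by (rule finite_subset) simp
next
  case (Suc N)
  let ?M = "{m. supp m \<subseteq> {..n} \<and> mdeg m \<le> N}"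
  have "{m. supp m \<subseteq> {..n} \<and> mdeg m \<le> Suc N}
      \<subseteq> insert 0 ((\<lambda>(j, m). single j 1 + m) ` ({..n} \<times> ?M))"
  proof
    fix m assume m: "m \<in> {m. supp m \<subseteq> {..n} \<and> mdeg m \<le> Suc N}"
    show "m \<in> insert 0 ((\<lambda>(j, m). single j 1 + m) ` ({..n} \<times> ?M))"
    proof (cases "m = 0")
      case False
      then obtain j where j: "j \<in> supp m" using supp_nonempty by blast
      then obtain m' where "m = single j 1 + m'" "supp m' \<subseteq> supp m"
        "mdeg m = Suc (mdeg m')" by (rule monomial_split)
      then show ?thesis using m j by (intro insertI2 image_eqI[of _ _ "(j, m')"]) auto
    qed simp
  qed
  then show ?case by (rule finite_subset) (use Suc in simp)
qed

definition vscale :: "'k::field \<Rightarrow> 'k mvec \<Rightarrow> 'k mvec" where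
  "vscale c v = smul (const c) v"

lemma vector_space_vscale: "vector_space (vscale :: 'k::field \<Rightarrow> 'k mvec \<Rightarrow> 'k mvec)"
  by unfold_locales
     (simp_all add: vscale_def smul_add_right smul_smul mult_single single_add smul_add_left)

text \<open>
  A module generated in bounded degree is finitely generated by linear algebra alone, because its
  low-degree part lies in the span of finitely many monomial vectors.
\<close>

lemma bounded_degree_span:
  fixes k n N :: nat
  obtains B :: "'k::field mvec set" where "finite B"
    "\<And>v. v \<in> free_module n k \<Longrightarrow> \<forall>j. \<forall>m\<in>supp (coef v j). mdeg m \<le> N
      \<Longrightarrow> v \<in> module.span vscale B"
proof -
  interpret V: vector_space "vscale :: 'k \<Rightarrow> 'k mvec \<Rightarrow> 'k mvec" by (rule vector_space_vscale)
  let ?M = "{m. supp m \<subseteq> {..n} \<and> mdeg m \<le> N}"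
  let ?e = "\<lambda>(j, m). single j (single m (1::'k))"
  define B where "B = ?e ` ({..<k} \<times> ?M)"
  have "v \<in> V.span B" if v: "v \<in> free_module n k" "\<forall>j. \<forall>m\<in>supp (coef v j). mdeg m \<le> N" for v
  proof -
    have "v = (\<Sum>j<k. single j (coef v j))"
      using v(1) by (intro poly_mapping_sum_single) (auto simp: free_module_def)
    also have "\<dots> = (\<Sum>j<k. \<Sum>m\<in>supp (coef v j). vscale (coef (coef v j) m) (?e (j, m)))"
    proof (rule sum.cong[OF refl])
      fix j
      have "single j (coef v j)
          = single j (\<Sum>m\<in>supp (coef v j). single m (coef (coef v j) m))"
        using poly_mapping_sum_single[OF finite_keys subset_refl, of "coef v j"] by metis
      also have "\<dots> = (\<Sum>m\<in>supp (coef v j). vscale (coef (coef v j) m) (?e (j, m)))"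
        by (rule poly_mapping_eqI)
           (simp add: vscale_def lookup_sum lookup_single when_def mult_single)
      finally show "single j (coef v j)
          = (\<Sum>m\<in>supp (coef v j). vscale (coef (coef v j) m) (?e (j, m)))" .
    qed
    also have "\<dots> \<in> V.span B"
    proof (intro V.span_sum V.span_scale V.span_base)
      fix j m assume "j \<in> {..<k}" "m \<in> supp (coef v j)"
      then have "(j, m) \<in> {..<k} \<times> ?M" using v by (auto simp: free_module_iff poly_carrier_def)
      then show "?e (j, m) \<in> B" unfolding B_def by (rule imageI)
    qed
    finally show ?thesis .
  qed
  moreover have "finite B" using finite_monomials by (simp add: B_def)
  ultimately show ?thesis using that by blast
qed

lemma finite_generators:
  assumes Z: "graded n a Z" and gen: "is_submodule n hull {v \<in> Z. \<exists>D\<le>r. homogeneous_vec a D v} = Z"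
  obtains gs :: "'k::field mvec list" where "set gs \<subseteq> {v \<in> Z. \<exists>D\<le>r. homogeneous_vec a D v}"
    "is_submodule n hull set gs = Z"
proof -
  interpret V: vector_space "vscale :: 'k \<Rightarrow> 'k mvec \<Rightarrow> 'k mvec" by (rule vector_space_vscale)
  let ?G = "{v \<in> Z. \<exists>D\<le>r. homogeneous_vec a D v}"
  define N where "N = nat (r - Min (insert 0 (set a)))"
  obtain B :: "'k mvec set" where B: "finite B"
    "\<And>v. v \<in> free_module n (length a) \<Longrightarrow> \<forall>j. \<forall>m\<in>supp (coef v j). mdeg m \<le> N \<Longrightarrow> v \<in> V.span B"
    using bounded_degree_span[of n "length a" N] by blast
  have GB: "?G \<subseteq> V.span B"
  proof
    fix v assume "v \<in> ?G"
    then obtain D where D: "v \<in> free_module n (length a)" "D \<le> r" "homogeneous_vec a D v"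
      using Z by (auto simp: graded_def)
    have "mdeg m \<le> N" if m: "m \<in> supp (coef v j)" for j m
    proof -
      have j: "j < length a" using m D(1) by (cases "j < length a") (auto simp: free_module_iff)
      then have "Min (insert 0 (set a)) \<le> a ! j" by simp
      moreover have "int (mdeg m) + a ! j = D" using D(3) j m by (auto simp: homogeneous_vec_def)
      ultimately show ?thesis using D(2) unfolding N_def by linarith
    qed
    then show "v \<in> V.span B" using B(2) D(1) by blast
  qed
  obtain S where S: "S \<subseteq> ?G" "V.independent S" "?G \<subseteq> V.span S"
    by (rule V.maximal_independent_subset[of ?G])
  have "finite S" using V.independent_span_bound[OF B(1) S(2)] S(1) GB by blast
  then obtain gs where gs: "set gs = S" using finite_list by blast
  let ?H = "is_submodule n hull S"
  have "V.span S \<subseteq> ?H"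
    using submodule_hull[of n S] hull_subset[of S "is_submodule n"]
    by (intro V.span_minimal) (auto simp: V.subspace_def vscale_def intro: submoduleD)
  then have "is_submodule n hull ?G \<subseteq> ?H"
    using S(3) by (intro hull_subset_submodule submodule_hull) auto
  moreover have "?H \<subseteq> Z" using S(1) Z by (intro hull_subset_submodule) (auto simp: graded_def)
  ultimately show ?thesis using that[of gs] gs S(1) gen by auto
qed

definition syz_map :: "'k::field mvec list \<Rightarrow> 'k mvec \<Rightarrow> 'k mvec" where
  "syz_map gs c = (\<Sum>j<length gs. smul (coef c j) (gs ! j))"

lemma syz_iff: "c \<in> syz n gs \<longleftrightarrow> c \<in> free_module n (length gs) \<and> syz_map gs c = 0"
  by (simp add: syz_def syz_map_def)

lemma syz_map_add: "syz_map gs (c + c') = syz_map gs c + syz_map gs c'"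
  by (simp add: syz_map_def lookup_add smul_add_left sum.distrib)

lemma syz_map_smul: "syz_map gs (smul f c) = smul f (syz_map gs c)"
  by (simp add: syz_map_def smul_smul smul_sum_right)

lemma syz_map_0 [simp]: "syz_map gs 0 = 0"
  by (simp add: syz_map_def)

lemma syz_map_diff: "syz_map gs (c - c') = syz_map gs c - syz_map gs c'"
  using syz_map_add[of gs "c - c'" c'] by simp

lemma syz_map_sum: "syz_map gs (\<Sum>i\<in>A. c i) = (\<Sum>i\<in>A. syz_map gs (c i))"
  by (induction A rule: infinite_finite_induct) (simp_all add: syz_map_add)

lemma syz_map_image:
  fixes gs :: "'a::field mvec list"
  shows "syz_map gs ` free_module n (length gs) = is_submodule n hull (set gs)"
proof
  show "syz_map gs ` free_module n (length gs) \<subseteq> is_submodule n hull (set gs)"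
    unfolding syz_map_def using hull_subset[of "set gs" "is_submodule n"]
    by (auto simp: free_module_iff intro!: submodule_sum[OF submodule_hull] submoduleD(3)[OF submodule_hull])
  show "is_submodule n hull (set gs) \<subseteq> syz_map gs ` free_module n (length gs)"
  proof (rule hull_subset_submodule)
    let ?F = "free_module n (length gs)"
    note F = submoduleD[OF submodule_free_module]
    show "is_submodule n (syz_map gs ` ?F)"
      unfolding is_submodule_def
    proof (intro conjI ballI)
      show "0 \<in> syz_map gs ` ?F" by (rule image_eqI[of _ _ 0]) (auto intro: F)
    next
      fix v w assume "v \<in> syz_map gs ` ?F" "w \<in> syz_map gs ` ?F"
      then obtain c d where "c \<in> ?F" "v = syz_map gs c" "d \<in> ?F" "w = syz_map gs d" by blast
      then show "v + w \<in> syz_map gs ` ?F"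
        by (intro image_eqI[of _ _ "c + d"]) (auto simp: syz_map_add intro: F)
    next
      fix f :: "'a mpoly" and v assume "f \<in> poly_carrier n" "v \<in> syz_map gs ` ?F"
      then obtain c where "c \<in> ?F" "v = syz_map gs c" "f \<in> poly_carrier n" by blast
      then show "smul f v \<in> syz_map gs ` ?F"
        by (intro image_eqI[of _ _ "smul f c"]) (auto simp: syz_map_smul intro: F)
    qed
    show "set gs \<subseteq> syz_map gs ` ?F"
    proof
      fix g assume "g \<in> set gs"
      then obtain i where i: "i < length gs" "g = gs ! i" by (metis in_set_conv_nth)
      have "syz_map gs (single i 1) = (\<Sum>j<length gs. if j = i then gs ! j else 0)"
        unfolding syz_map_def by (intro sum.cong) (auto simp: lookup_single)
      then have "g = syz_map gs (single i 1)" using i by simp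
      moreover have "single i 1 \<in> ?F"
        using i by (auto simp: free_module_iff lookup_single when_def)
      ultimately show "g \<in> syz_map gs ` ?F" by blast
    qed
  qed
qed

lemma vcomp_syz_map:
  assumes "length a' = length gs" "set gs \<subseteq> free_module n (length a)"
    "\<forall>j<length gs. homogeneous_vec a (a' ! j) (gs ! j)"
  shows "vcomp a D (syz_map gs c) = syz_map gs (vcomp a' D c)"
  unfolding syz_map_def vcomp_sum
proof (rule sum.cong[OF refl])
  fix j assume j: "j \<in> {..<length gs}"
  then have "gs ! j \<in> free_module n (length a)" using assms(2) by auto
  then show "vcomp a D (smul (coef c j) (gs ! j)) = smul (coef (vcomp a' D c) j) (gs ! j)"
    using j assms(1,3) vcomp_smul_homogeneous[of a "a' ! j" "gs ! j" n D "coef c j"]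
    by (auto simp: coef_vcomp)
qed

lemma graded_syz:
  assumes "length a' = length gs" "set gs \<subseteq> free_module n (length a)"
    "\<forall>j<length gs. homogeneous_vec a (a' ! j) (gs ! j)"
  shows "graded n a' (syz n gs)"
  unfolding graded_def
proof (intro conjI ballI allI)
  note F = submoduleD[OF submodule_free_module]
  show "is_submodule n (syz n gs)"
    by (auto simp: is_submodule_def syz_iff syz_map_add syz_map_smul intro: F)
  show "syz n gs \<subseteq> free_module n (length a')" using assms(1) by (auto simp: syz_iff)
  fix v D assume "v \<in> syz n gs"
  then show "vcomp a' D v \<in> syz n gs"
    using vcomp_syz_map[OF assms, of D v] vcomp_free_module[of v n "length gs" a' D] assms(1)
    by (auto simp: syz_iff)
qed

text \<open>
  A shortest list of homogeneous generators has no syzygy with a constant coefficient: the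
  homogeneous part of such a syzygy would express one generator through the others.
\<close>

lemma minimal_generators:
  assumes Z: "graded n a Z" and gen: "is_submodule n hull {v \<in> Z. \<exists>D\<le>r. homogeneous_vec a D v} = Z"
  obtains gs :: "'k::field mvec list" and a' where "length a' = length gs"
    "set gs \<subseteq> Z" "\<forall>j<length gs. homogeneous_vec a (a' ! j) (gs ! j) \<and> a' ! j \<le> r"
    "is_submodule n hull set gs = Z" "\<forall>c\<in>syz n gs. \<forall>j. coef (coef c j) 0 = 0"
proof -
  define P where "P = (\<lambda>gs :: 'k mvec list. set gs \<subseteq> {v \<in> Z. \<exists>D\<le>r. homogeneous_vec a D v} \<and>
    is_submodule n hull set gs = Z)"
  obtain gs0 where "P gs0" by (rule finite_generators[OF assms]) (simp add: P_def)
  then obtain gs where gs: "P gs" "\<And>gs'. P gs' \<Longrightarrow> length gs \<le> length gs'"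
    using ex_has_least_nat[of P gs0 length] by blast
  have "\<forall>j<length gs. \<exists>D\<le>r. homogeneous_vec a D (gs ! j)"
    using gs(1) nth_mem unfolding P_def by blast
  then obtain f where f: "\<And>j. j < length gs \<Longrightarrow> f j \<le> r \<and> homogeneous_vec a (f j) (gs ! j)"
    by metis
  define a' where "a' = map f [0..<length gs]"
  have a': "length a' = length gs" "\<forall>j<length gs. homogeneous_vec a (a' ! j) (gs ! j) \<and> a' ! j \<le> r"
    using f by (auto simp: a'_def)
  have sZ: "set gs \<subseteq> Z" and hull: "is_submodule n hull set gs = Z" using gs(1) by (auto simp: P_def)
  have sF: "set gs \<subseteq> free_module n (length a)" using sZ Z by (auto simp: graded_def)
  have hom: "\<forall>j<length gs. homogeneous_vec a (a' ! j) (gs ! j)" using a'(2) by blast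
  have "coef (coef c i) 0 = 0" if c: "c \<in> syz n gs" for c i
  proof (rule ccontr)
    assume ne: "coef (coef c i) 0 \<noteq> 0"
    then have i: "i < length gs" using c by (cases "i < length gs") (auto simp: syz_iff free_module_iff)
    define x where "x = coef (coef c i) 0"
    define c' where "c' = vcomp a' (a' ! i) c"
    have c'syz: "c' \<in> syz n gs"
      using graded_syz[OF a'(1) sF hom] c by (auto simp: graded_def c'_def)
    have "coef (coef c' i) m = coef (const x) m" for m
      using i a'(1) mdeg_eq_0_iff[of m]
      by (auto simp: c'_def coef_vcomp coef_hom_component lookup_single when_def x_def)
    then have ci: "coef c' i = const x" by (rule poly_mapping_eqI)
    \<comment> \<open>The coefficient of \<open>gs ! i\<close> in \<open>c'\<close> is the unit \<open>x\<close>, so this generator can be dropped.\<close>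
    define gs' where "gs' = take i gs @ drop (Suc i) gs"
    have mem: "gs ! j \<in> set gs'" if "j < length gs" "j \<noteq> i" for j
    proof (cases "j < i")
      case True
      then show ?thesis using that i unfolding gs'_def
        by (auto simp: in_set_conv_nth intro!: disjI1 exI[of _ j])
    next
      case False
      then show ?thesis using that i unfolding gs'_def
        by (auto simp: in_set_conv_nth intro!: disjI2 exI[of _ "j - Suc i"])
    qed
    let ?H = "is_submodule n hull set gs'"
    have H: "set gs' \<subseteq> ?H" by (rule hull_subset)
    have "0 = syz_map gs c'" using c'syz by (simp add: syz_iff)
    also have "\<dots> = smul (const x) (gs ! i) + (\<Sum>j\<in>{..<length gs} - {i}. smul (coef c' j) (gs ! j))"
      unfolding syz_map_def using i ci by (subst sum.remove[of _ i]) auto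
    finally have "smul (const x) (gs ! i) = - (\<Sum>j\<in>{..<length gs} - {i}. smul (coef c' j) (gs ! j))"
      by (simp add: eq_neg_iff_add_eq_0)
    moreover have "- (\<Sum>j\<in>{..<length gs} - {i}. smul (coef c' j) (gs ! j)) \<in> ?H"
      using c'syz mem H
      by (intro submodule_uminus[OF submodule_hull] submodule_sum[OF submodule_hull]
            submoduleD(3)[OF submodule_hull]) (auto simp: syz_iff free_module_iff)
    ultimately have "smul (const x) (gs ! i) \<in> ?H" by simp
    then have "smul (const (inverse x)) (smul (const x) (gs ! i)) \<in> ?H"
      by (rule submoduleD(3)[OF submodule_hull, rotated]) simp
    then have "gs ! i \<in> ?H" using ne by (simp add: smul_smul mult_single x_def)
    then have "gs ! j \<in> ?H" if "j < length gs" for j using that mem H by (cases "j = i") auto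
    then have "set gs \<subseteq> ?H" by (auto simp: in_set_conv_nth)
    then have "Z \<subseteq> ?H" using hull_subset_submodule[OF submodule_hull, of "set gs" n] hull by simp
    moreover have sub: "set gs' \<subseteq> set gs" by (auto simp: gs'_def dest: in_set_takeD in_set_dropD)
    then have "?H \<subseteq> Z" using sZ Z by (intro hull_subset_submodule) (auto simp: graded_def)
    ultimately have "P gs'" using gs(1) sub by (auto simp: P_def)
    then show False using gs(2)[of gs'] i by (simp add: gs'_def)
  qed
  then show ?thesis using that[OF a'(1) sZ a'(2) hull] by blast
qed

context linear_coordinates
begin

text \<open>
  Filter-regularity passes to the first syzygies, one degree up: a relation among the images of
  the generators can be lifted because it already holds with coefficients in \<open>Z\<close>.
\<close>

lemma filter_regular_syz:
  assumes Z: "filter_regular r a Z" and len: "length a' = length gs" and gsZ: "set gs \<subseteq> Z"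
    and hom: "\<forall>j<length gs. homogeneous_vec a (a' ! j) (gs ! j) \<and> a' ! j \<le> r"
    and hull: "is_submodule n hull set gs = Z"
  shows "filter_regular (r + 1) a' (syz n gs)"
  unfolding filter_regular_def
proof (intro conjI allI impI ballI)
  have ZF: "Z \<subseteq> free_module n (length a)" and sub: "is_submodule n Z"
    using Z by (auto simp: filter_regular_def graded_def)
  have sF: "set gs \<subseteq> free_module n (length a)" using gsZ ZF by blast
  have hom1: "\<forall>j<length gs. homogeneous_vec a (a' ! j) (gs ! j)" using hom by blast
  show "graded n a' (syz n gs)" using graded_syz[OF len sF hom1] .
  show "a' ! j < r + 1" if "j < length a'" for j using hom len that by auto
  let ?G = "free_module n (length a')" and ?F = "free_module n (length a)"
  have onto: "\<exists>c\<in>?G. z = syz_map gs c" if "z \<in> Z" for z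
    using syz_map_image[of gs n] that hull len by auto
  have into: "syz_map gs c \<in> Z" if "c \<in> ?G" for c
    using syz_map_image[of gs n] that hull len by auto
  fix i D v
  assume i: "i \<le> n" and D: "r + 1 \<le> D" and v: "v \<in> ?G" "homogeneous_vec a' D v"
    and "\<exists>z\<in>syz n gs. smul (h i) v - z \<in> multiples h i ?G"
  then obtain z s where z: "z \<in> syz n gs" and s: "\<forall>j<i. s j \<in> ?G"
    "smul (h i) v - z = (\<Sum>j<i. smul (h j) (s j))" by (auto simp: multiples_def)
  define x where "x = syz_map gs v"
  have "smul (h i) x = syz_map gs (smul (h i) v - z)"
    using z by (simp add: x_def syz_map_diff syz_map_smul syz_iff)
  also have "\<dots> = (\<Sum>j<i. smul (h j) (syz_map gs (s j)))"
    by (simp add: s(2) syz_map_sum syz_map_smul)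
  finally have "smul (h i) x \<in> multiples h i Z"
    using s(1) into unfolding multiples_def by (intro CollectI exI[of _ "\<lambda>j. syz_map gs (s j)"]) auto
  then have "smul (h i) x \<in> multiples h i ?F" using multiples_mono[OF ZF] by blast
  moreover have xZ: "x \<in> Z" using into v by (simp add: x_def)
  ultimately have "x \<in> multiples h i ?F" using free_module_regular[OF i] ZF by blast
  moreover have "vcomp a D x = x"
    using vcomp_syz_map[OF len sF hom1, of D v] vcomp_homogeneous[OF v(2,1)] by (simp add: x_def)
  then have "homogeneous_vec a D x" using homogeneous_vcomp by metis
  ultimately have "x \<in> multiples h i Z" using filter_regular_multiples[OF Z D] i xZ by simp
  then obtain t where t: "\<forall>j<i. t j \<in> Z" "x = (\<Sum>j<i. smul (h j) (t j))"
    by (auto simp: multiples_def)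
  have "\<forall>j. \<exists>c. j < i \<longrightarrow> c \<in> ?G \<and> t j = syz_map gs c" using onto t(1) by blast
  then obtain c where c: "\<And>j. j < i \<Longrightarrow> c j \<in> ?G \<and> t j = syz_map gs (c j)" by metis
  define w where "w = (\<Sum>j<i. smul (h j) (c j))"
  have "syz_map gs w = x" using c by (simp add: w_def syz_map_sum syz_map_smul t(2))
  moreover have "w \<in> ?G"
    using c i h_carrier unfolding w_def
    by (intro submodule_sum[OF submodule_free_module] submoduleD(3)[OF submodule_free_module]) auto
  ultimately have "v - w \<in> syz n gs"
    using v len by (simp add: syz_iff syz_map_diff x_def submodule_diff[OF submodule_free_module])
  moreover have "v - (v - w) \<in> multiples h i ?G" using c by (auto simp: w_def multiples_def intro!: exI[of _ c])
  ultimately show "\<exists>z\<in>syz n gs. v - z \<in> multiples h i ?G" by blast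
qed

theorem filter_regular_imp_regular:
  assumes "filter_regular r a Z"
  shows "regular n a Z r"
proof -
  let ?st = "\<lambda>(a, Z, gs, a'). length a' = length gs \<and> set gs \<subseteq> Z \<and>
      (\<forall>j<length gs. homogeneous_vec a (a' ! j) (gs ! j)) \<and>
      is_submodule n hull set gs = Z \<and> (\<forall>c\<in>syz n gs. \<forall>j. coef (coef c j) 0 = 0)"
  let ?P = "\<lambda>i x. filter_regular (r + int i) (fst x) (fst (snd x)) \<and>
      filter_regular (r + int (Suc i)) (snd (snd (snd x))) (syz n (fst (snd (snd x)))) \<and> ?st x"
  have step: "\<exists>gs a'. ?P i (a, Z, gs, a')" if fr: "filter_regular (r + int i) a Z" for i a Z
  proof -
    have gr: "graded n a Z" using fr by (simp add: filter_regular_def)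
    obtain gs a' where g: "length a' = length gs" "set gs \<subseteq> Z"
      "\<forall>j<length gs. homogeneous_vec a (a' ! j) (gs ! j) \<and> a' ! j \<le> r + int i"
      "is_submodule n hull set gs = Z" "\<forall>c\<in>syz n gs. \<forall>j. coef (coef c j) 0 = 0"
      by (rule minimal_generators[OF gr filter_regular_generated[OF fr]])
    from filter_regular_syz[OF fr g(1-4)] g fr show ?thesis
      by (intro exI[of _ gs] exI[of _ a']) (simp add: add.assoc add.commute[of 1])
  qed
  have "\<exists>f. \<forall>i. (?P i (f i) \<and> (i = 0 \<longrightarrow> fst (f i) = a \<and> fst (snd (f i)) = Z)) \<and>
      (fst (f (Suc i)) = snd (snd (snd (f i))) \<and> fst (snd (f (Suc i))) = syz n (fst (snd (snd (f i)))))"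
  proof (rule dependent_nat_choice)
    show "\<exists>x. ?P 0 x \<and> (0 = (0::nat) \<longrightarrow> fst x = a \<and> fst (snd x) = Z)"
    proof -
      have "\<exists>gs a'. ?P 0 (a, Z, gs, a')" by (rule step) (simp add: assms)
      then obtain gs a' where "?P 0 (a, Z, gs, a')" by blast
      then show ?thesis by (intro exI[of _ "(a, Z, gs, a')"]) simp
    qed
  next
    fix x i
    assume "?P i x \<and> (i = 0 \<longrightarrow> fst x = a \<and> fst (snd x) = Z)"
    then obtain gs a' where "?P (Suc i) (snd (snd (snd x)), syz n (fst (snd (snd x))), gs, a')"
      using step[of "Suc i" "snd (snd (snd x))" "syz n (fst (snd (snd x)))"] by blast
    then show "\<exists>y. (?P (Suc i) y \<and> (Suc i = 0 \<longrightarrow> fst y = a \<and> fst (snd y) = Z)) \<and>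
        fst y = snd (snd (snd x)) \<and> fst (snd y) = syz n (fst (snd (snd x)))"
      by (intro exI[of _ "(snd (snd (snd x)), syz n (fst (snd (snd x))), gs, a')"]) simp
  qed
  then obtain f where F: "\<forall>i. (?P i (f i) \<and> (i = 0 \<longrightarrow> fst (f i) = a \<and> fst (snd (f i)) = Z)) \<and>
      (fst (f (Suc i)) = snd (snd (snd (f i))) \<and> fst (snd (f (Suc i))) = syz n (fst (snd (snd (f i)))))"
    by (rule exE)
  have f1: "?P i (f i)" for i by (rule F[THEN spec, THEN conjunct1, THEN conjunct1])
  have f0: "fst (f 0) = a" "fst (snd (f 0)) = Z"
    using F[THEN spec, THEN conjunct1, THEN conjunct2, of 0] by simp_all
  have fS: "fst (f (Suc i)) = snd (snd (snd (f i)))"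
    "fst (snd (f (Suc i))) = syz n (fst (snd (snd (f i))))" for i
    using F[THEN spec, THEN conjunct2, of i] by simp_all
  define as where "as = (\<lambda>i. fst (f i))"
  define gs where "gs = (\<lambda>i. fst (snd (snd (f i))))"
  have Zi: "syzygy_module n Z gs i = fst (snd (f i))" for i
    by (cases i) (simp_all add: f0 fS gs_def)
  have fr: "filter_regular (r + int i) (as i) (syzygy_module n Z gs i)" for i
    using f1[of i] by (simp add: Zi as_def)
  have st: "length (as (Suc i)) = length (gs i) \<and> set (gs i) \<subseteq> syzygy_module n Z gs i \<and>
      (\<forall>j<length (gs i). homogeneous_vec (as i) (as (Suc i) ! j) (gs i ! j)) \<and>
      is_submodule n hull set (gs i) = syzygy_module n Z gs i \<and>
      (\<forall>c\<in>syz n (gs i). \<forall>j. coef (coef c j) 0 = 0)" for i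
    using f1[of i] fS(1)[of i] unfolding Zi by (simp add: as_def gs_def case_prod_beta)
  have "as 0 = a" by (simp add: as_def f0)
  moreover have "minimal_free_resolution n Z as gs"
    unfolding minimal_free_resolution_def
    using st assms \<open>as 0 = a\<close> by (auto simp: filter_regular_def graded_def)
  moreover have "generated_in_degrees_le n (as i) (syzygy_module n Z gs i) (r + int i)" for i
    using filter_regular_generated[OF fr] by (simp add: generated_in_degrees_le_def)
  ultimately show ?thesis unfolding regular_def by blast
qed

end

section \<open>Homogeneous ideals\<close>

lemma ideal_iff:
  "ideal I (poly_ring n :: 'k::field mpoly ring) \<longleftrightarrow> I \<subseteq> poly_carrier n \<and> 0 \<in> I \<and>
     (\<forall>f\<in>I. \<forall>g\<in>I. f + g \<in> I) \<and> (\<forall>f\<in>poly_carrier n. \<forall>g\<in>I. f * g \<in> I)" (is "_ \<longleftrightarrow> ?R")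
proof
  assume "ideal I (poly_ring n)"
  then interpret I: ideal I "poly_ring n :: 'k mpoly ring" .
  have A: "additive_subgroup I (poly_ring n :: 'k mpoly ring)" by unfold_locales
  show ?R
    using I.a_subset additive_subgroup.zero_closed[OF A] additive_subgroup.a_closed[OF A] I.I_l_closed
    by (auto simp: poly_ring_def)
next
  assume R: ?R
  interpret R: cring "poly_ring n :: 'k mpoly ring" by (rule cring_poly_ring)
  have "a * x \<in> I" if "a \<in> I" "x \<in> poly_carrier n" for a x
    using that R by (subst mult.commute) blast
  note R = R this
  show "ideal I (poly_ring n)"
  proof (rule idealI[OF R.ring_axioms])
    show "subgroup I (add_monoid (poly_ring n :: 'k mpoly ring))"
    proof (rule subgroup.intro)
      fix x assume x: "x \<in> I"
      have "\<forall>f\<in>poly_carrier n. \<forall>g\<in>I. f * g \<in> I" using R(1) by (elim conjE)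
      from bspec[OF bspec[OF this, of "- 1"] x] have "- x \<in> I" by simp
      moreover have "inv\<^bsub>add_monoid (poly_ring n)\<^esub> x = - x"
      proof -
        have "- x \<in> carrier (poly_ring n)" "x \<in> carrier (poly_ring n)"
          using x R by (auto simp: poly_ring_def)
        then show ?thesis using R.add.inv_equality[of "- x" x]
          by (simp add: poly_ring_def a_inv_def)
      qed
      ultimately show "inv\<^bsub>add_monoid (poly_ring n)\<^esub> x \<in> I" by simp
    qed (use R in \<open>auto simp: poly_ring_def\<close>)
  qed (use R in \<open>auto simp: poly_ring_def mult.commute\<close>)
qed

lemma homogeneous_idealD:
  assumes "homogeneous_ideal n I"
  shows "f \<in> I \<Longrightarrow> f \<in> poly_carrier n" "0 \<in> I" "f \<in> I \<Longrightarrow> g \<in> I \<Longrightarrow> f + g \<in> I"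
    "f \<in> poly_carrier n \<Longrightarrow> g \<in> I \<Longrightarrow> f * g \<in> I" "f \<in> I \<Longrightarrow> hom_component d f \<in> I"
  using assms unfolding homogeneous_ideal_def ideal_iff by auto

lemma homogeneous_ideal_diff:
  assumes "homogeneous_ideal n I" "f \<in> I" "g \<in> I"
  shows "f - g \<in> I"
  using homogeneous_idealD(3)[OF assms(1,2), of "- 1 * g"]
    homogeneous_idealD(4)[OF assms(1) _ assms(3), of "- 1"] by simp

context linear_coordinates
begin

lemma graded_ideal:
  fixes I :: "'k mpoly set"
  assumes "homogeneous_ideal n I"
  shows "graded n [0] (single 0 ` I)"
  unfolding graded_def
proof (intro conjI ballI allI)
  note I = homogeneous_idealD[OF assms]
  show "is_submodule n (single 0 ` I :: 'k mvec set)"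
    unfolding is_submodule_def
  proof (intro conjI ballI)
    show "0 \<in> (single 0 ` I :: 'k mvec set)"
      using I(2) by (metis image_eqI single_zero)
    show "v + w \<in> single 0 ` I"
      if "v \<in> single 0 ` I" "w \<in> single 0 ` I" for v w :: "'k mvec"
      using that I(3) by (auto simp: single_add[symmetric])
    have "smul f (single 0 g :: 'k mvec) = single 0 (f * g)" for f g :: "'k mpoly"
      by (rule poly_mapping_eqI) (simp add: lookup_single when_def)
    then show "smul f v \<in> single 0 ` I"
      if "f \<in> poly_carrier n" "v \<in> single 0 ` I" for f and v :: "'k mvec"
      using that I(4) by auto
  qed
  show "(single 0 ` I :: 'k mvec set) \<subseteq> free_module n (length [0::int])"
    using I(1) by (auto simp: free_module_iff lookup_single when_def)
  fix v :: "'k mvec" and D assume "v \<in> single 0 ` I"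
  then obtain f where f: "f \<in> I" "v = single 0 f" by blast
  have "vcomp [0] D v = single 0 (if 0 \<le> D then hom_component (nat D) f else 0)"
    by (rule poly_mapping_eqI) (auto simp: coef_vcomp f lookup_single when_def)
  then show "vcomp [0] D v \<in> single 0 ` I" using I(2,5) f(1) by auto
qed

lemma filter_regular_ideal:
  fixes I :: "'k mpoly set"
  assumes I: "homogeneous_ideal n I" and r: "r \<ge> 1"
    and cond: "\<And>i d f s. \<lbrakk>i \<le> n; d \<ge> r; f \<in> forms n d; \<forall>j<i. s j \<in> poly_carrier n;
        h i * f - (\<Sum>j<i. h j * s j) \<in> I\<rbrakk>
      \<Longrightarrow> \<exists>t. (\<forall>j<i. t j \<in> poly_carrier n) \<and> f - (\<Sum>j<i. h j * t j) \<in> I"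
  shows "filter_regular (int r) [0] (single 0 ` I)"
  unfolding filter_regular_def
proof (intro conjI allI impI ballI)
  show "graded n [0] (single 0 ` I)" using graded_ideal[OF I] .
  show "[0] ! j < int r" if "j < length [0::int]" for j using that r by simp
  let ?F = "free_module n (length [0::int]) :: 'k mvec set"
  fix i D and v :: "'k mvec"
  assume i: "i \<le> n" and D: "int r \<le> D" and v: "v \<in> ?F" "homogeneous_vec [0] D v"
    and "\<exists>z\<in>single 0 ` I. smul (h i) v - z \<in> multiples h i ?F"
  then obtain g s where g: "g \<in> I" and s: "\<forall>j<i. s j \<in> ?F"
    "smul (h i) v - single 0 g = (\<Sum>j<i. smul (h j) (s j))"
    by (auto simp: multiples_def)
  have "h i * coef v 0 - g = (\<Sum>j<i. h j * coef (s j) 0)"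
    using arg_cong[OF s(2), of "\<lambda>v. coef v 0"] by (simp add: lookup_minus lookup_sum)
  then have "h i * coef v 0 - (\<Sum>j<i. h j * coef (s j) 0) \<in> I" using g by (simp add: algebra_simps)
  moreover have "coef v 0 \<in> forms n (nat D)"
    using v D r by (auto simp: forms_def free_module_iff homogeneous_vec_iff)
  moreover have "nat D \<ge> r" using D by simp
  ultimately obtain t where t: "\<forall>j<i. t j \<in> poly_carrier n" "coef v 0 - (\<Sum>j<i. h j * t j) \<in> I"
    using cond[OF i, of "nat D" "coef v 0" "\<lambda>j. coef (s j) 0"] s(1) by (auto simp: free_module_iff)
  define z :: "'k mvec" where "z = single 0 (coef v 0 - (\<Sum>j<i. h j * t j))"
  have "v - z = (\<Sum>j<i. smul (h j) (single 0 (t j)))"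
    using v(1) by (intro poly_mapping_eqI)
      (auto simp: z_def lookup_minus lookup_sum lookup_single when_def free_module_iff)
  moreover have "\<forall>j<i. single 0 (t j) \<in> ?F"
    using t(1) by (auto simp: free_module_iff lookup_single when_def)
  ultimately have "v - z \<in> multiples h i ?F"
    unfolding multiples_def by (intro CollectI exI[of _ "\<lambda>j. single 0 (t j)"]) auto
  moreover have "z \<in> single 0 ` I" using t(2) by (simp add: z_def)
  ultimately show "\<exists>z\<in>single 0 ` I. v - z \<in> multiples h i ?F" by blast
qed

end

section \<open>Linear coordinates starting with a given form\<close>

lemma sum_atMost_split: "(\<Sum>j\<le>n. g j) = g 0 + (\<Sum>j=1..n. g j)" for g :: "nat \<Rightarrow> 'a::comm_monoid_add"
proof -
  have "{..n} = insert 0 {1..n}" by auto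
  then show ?thesis by simp
qed

definition coord_seq :: "nat \<Rightarrow> (nat \<Rightarrow> 'k::field) \<Rightarrow> nat \<Rightarrow> 'k mpoly" where
  "coord_seq n c j = (if j = 0 then var 0 + (\<Sum>l=1..n. const (c l) * var l) else var j)"

lemma coord_seq_form: "j \<le> n \<Longrightarrow> coord_seq n c j \<in> forms n 1"
  unfolding coord_seq_def
  by (auto intro!: forms_add forms_sum forms_const_mult forms_var[simplified])

definition in_span :: "nat \<Rightarrow> (nat \<Rightarrow> 'k::field mpoly) \<Rightarrow> nat \<Rightarrow> 'k mpoly \<Rightarrow> bool" where
  "in_span n h i f \<longleftrightarrow> (\<exists>t. (\<forall>j<i. t j \<in> poly_carrier n) \<and> f = (\<Sum>j<i. h j * t j))"

lemma in_span_add: "in_span n h i f \<Longrightarrow> in_span n h i g \<Longrightarrow> in_span n h i (f + g)"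
proof -
  assume "in_span n h i f" "in_span n h i g"
  then obtain s t where "\<forall>j<i. s j \<in> poly_carrier n" "f = (\<Sum>j<i. h j * s j)"
    "\<forall>j<i. t j \<in> poly_carrier n" "g = (\<Sum>j<i. h j * t j)" by (auto simp: in_span_def)
  then show ?thesis unfolding in_span_def
    by (intro exI[of _ "\<lambda>j. s j + t j"]) (auto simp: distrib_left sum.distrib intro: poly_carrier_add)
qed

lemma in_span_mult: "g \<in> poly_carrier n \<Longrightarrow> in_span n h i f \<Longrightarrow> in_span n h i (g * f)"
proof -
  assume "g \<in> poly_carrier n" "in_span n h i f"
  then obtain s where "\<forall>j<i. s j \<in> poly_carrier n" "f = (\<Sum>j<i. h j * s j)" "g \<in> poly_carrier n"
    by (auto simp: in_span_def)
  then show ?thesis unfolding in_span_def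
    by (intro exI[of _ "\<lambda>j. g * s j"])
       (auto simp: sum_distrib_left mult.left_commute intro: poly_carrier_mult)
qed

lemma in_span_0 [simp]: "in_span n h i 0"
  unfolding in_span_def by (intro exI[of _ "\<lambda>_. 0"]) auto

lemma in_span_sum: "(\<And>l. l \<in> A \<Longrightarrow> in_span n h i (f l)) \<Longrightarrow> in_span n h i (\<Sum>l\<in>A. f l)"
  by (induction A rule: infinite_finite_induct) (auto intro: in_span_add)

lemma in_span_base: "j < i \<Longrightarrow> in_span n h i (h j)"
  unfolding in_span_def
  by (intro exI[of _ "\<lambda>l. if l = j then 1 else 0"]) (auto simp: if_distrib cong: if_cong)

text \<open>
  Eliminating \<open>x\<^sub>0, \<dots>, x\<^bsub>i-1\<^esub>\<close> by means of the first \<open>i\<close> coordinates is a retraction whose kernel is the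
  ideal they generate, so regularity reduces to the absence of zero divisors.
\<close>

definition eliminate :: "nat \<Rightarrow> (nat \<Rightarrow> 'k::field) \<Rightarrow> nat \<Rightarrow> nat \<Rightarrow> 'k mpoly" where
  "eliminate n c i j = (if j = 0 then - (\<Sum>l=i..n. const (c l) * var l)
     else if j < i then 0 else var j)"

lemma linear_coordinates_coord_seq: "linear_coordinates n (coord_seq n c)"
proof
  let ?h = "coord_seq n c"
  show "?h j \<in> forms n 1" if "j \<le> n" for j using coord_seq_form that .
  show "\<exists>t. (\<forall>j\<le>n. t j \<in> poly_carrier n) \<and> f = (\<Sum>j\<le>n. ?h j * t j)"
    if "f \<in> forms n (Suc d)" for f d
  proof -
    obtain A where A: "\<forall>j\<le>n. A j \<in> forms n d" "f = (\<Sum>j\<le>n. var j * A j)"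
      using forms_decompose \<open>f \<in> forms n (Suc d)\<close> by blast
    define t where "t = (\<lambda>j. if j = 0 then A 0 else A j - const (c j) * A 0)"
    have t: "\<forall>j\<le>n. t j \<in> poly_carrier n"
      using A(1) by (auto simp: t_def intro!: carrier_diff poly_carrier_mult intro: forms_carrier)
    have "(\<Sum>j\<le>n. ?h j * t j) = (var 0 + (\<Sum>l=1..n. const (c l) * var l)) * A 0
        + (\<Sum>j=1..n. var j * (A j - const (c j) * A 0))"
      unfolding sum_atMost_split by (auto simp: coord_seq_def t_def intro!: sum.cong)
    also have "\<dots> = var 0 * A 0 + (\<Sum>j=1..n. var j * A j)"
      by (simp add: algebra_simps sum.distrib sum_subtractf sum_distrib_left sum_distrib_right)
    also have "\<dots> = f"
      unfolding A(2) sum_atMost_split ..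
    finally show ?thesis using t by (intro exI[of _ t]) simp
  qed
  fix i f s
  assume i: "i \<le> n" and f: "f \<in> poly_carrier n" and s: "\<forall>j<i. s j \<in> poly_carrier n"
    and eq: "?h i * f = (\<Sum>j<i. ?h j * s j)"
  have "in_span n ?h i f"
  proof (cases "i = 0")
    case True
    have "coef (?h 0) (single 0 1) = 1"
    proof -
      have "coef (const (c l) * var l) (single 0 1) = 0" if "l \<ge> 1" for l
      proof -
        have "single l (1::nat) \<noteq> single 0 1"
        proof
          assume "single l (1::nat) = single 0 1"
          from arg_cong[OF this, of "\<lambda>m. coef m l"] show False using that by (simp add: lookup_single)
        qed
        then show ?thesis by (simp add: var_def mult_single lookup_single)
      qed
      then show ?thesis by (simp add: coord_seq_def lookup_add lookup_sum var_def)
    qed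
    then have "?h 0 \<noteq> 0" by auto
    then show ?thesis using eq True by simp
  next
    case False
    let ?\<theta> = "ev const (eliminate n c i)"
    have el: "eliminate n c i j \<in> poly_carrier n" if "j \<le> n" for j
      using that by (auto simp: eliminate_def intro!: carrier_sum poly_carrier_mult poly_carrier_closed(3))
    have th: "?\<theta> g \<in> poly_carrier n \<and> in_span n ?h i (g - ?\<theta> g)" if "g \<in> poly_carrier n" for g
      using that
    proof (induction rule: carrier_induct)
      case (const x)
      then show ?case by simp
    next
      case (var j)
      consider "j = 0" | "0 < j" "j < i" | "i \<le> j" "0 < j" using False by linarith
      then have "in_span n ?h i (var j - eliminate n c i j)"
      proof cases
        case 1
        have "{1..n} = {1..<i} \<union> {i..n}" using False i by auto
        then have "(\<Sum>l=1..n. const (c l) * var l :: 'a mpoly)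
            = (\<Sum>l=1..<i. const (c l) * var l) + (\<Sum>l=i..n. const (c l) * var l)"
          by (simp only:) (rule sum.union_disjoint, auto)
        then have "var j - eliminate n c i j = ?h 0 + (\<Sum>l=1..<i. const (- c l) * ?h l)"
          using 1 by (simp add: eliminate_def coord_seq_def single_uminus sum_negf)
        also have "in_span n ?h i \<dots>"
          using False by (intro in_span_add in_span_sum in_span_mult in_span_base) auto
        finally show ?thesis .
      next
        case 2
        then show ?thesis using in_span_base[of j i n ?h] by (simp add: eliminate_def coord_seq_def)
      next
        case 3
        then show ?thesis by (simp add: eliminate_def)
      qed
      then show ?case using el var by simp
    next
      case (add f g)
      then show ?case using in_span_add[of n ?h i "f - ?\<theta> f" "g - ?\<theta> g"]
        by (simp add: poly_carrier_add algebra_simps)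
    next
      case (mult f g)
      have "f * g - ?\<theta> f * ?\<theta> g = g * (f - ?\<theta> f) + ?\<theta> f * (g - ?\<theta> g)" by (simp add: algebra_simps)
      also have "in_span n ?h i \<dots>" using mult by (intro in_span_add in_span_mult) auto
      finally show ?case using mult by (simp add: poly_carrier_mult)
    qed
    have th0: "?\<theta> (?h j) = 0" if "j < i" for j
    proof (cases "j = 0")
      case True
      have "(\<Sum>l=1..n. const (c l) * eliminate n c i l) = (\<Sum>l=i..n. const (c l) * var l)"
        by (rule sum.mono_neutral_cong_right) (use False in \<open>auto simp: eliminate_def\<close>)
      then show ?thesis using True by (simp add: coord_seq_def sc.ev_sum) (simp add: eliminate_def)
    next
      case False
      then show ?thesis using that by (simp add: coord_seq_def eliminate_def)
    qed
    have "var i * ?\<theta> f = ?\<theta> (?h i * f)" using False by (simp add: coord_seq_def eliminate_def)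
    also have "\<dots> = 0" using th0 by (simp add: eq sc.ev_sum)
    finally have "?\<theta> f = 0"
      by (metis mult_eq_0_iff var_def single_zero lookup_single_eq lookup_zero zero_neq_one)
    then show ?thesis using th[OF f] by simp
  qed
  then show "\<exists>t. (\<forall>j<i. t j \<in> poly_carrier n) \<and> f = (\<Sum>j<i. ?h j * t j)"
    by (simp add: in_span_def)
qed

text \<open>
  Once \<open>I\<close> and the first two coordinates contain all forms of degree \<open>\<ge> r\<close>, the conditions on the
  later coordinates hold trivially; this is the case of a scheme of dimension at most one.
\<close>

lemma regular_criterion:
  assumes I: "homogeneous_ideal n I" and r: "r \<ge> 1" and n: "n \<ge> 1"
    and c0: "\<And>d f. d \<ge> r \<Longrightarrow> f \<in> forms n d \<Longrightarrow> coord_seq n c 0 * f \<in> I \<Longrightarrow> f \<in> I"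
    and c1: "\<And>d f s. \<lbrakk>d \<ge> r; f \<in> forms n d; s \<in> forms n d; var 1 * f - coord_seq n c 0 * s \<in> I\<rbrakk>
      \<Longrightarrow> \<exists>t\<in>poly_carrier n. f - coord_seq n c 0 * t \<in> I"
    and c2: "\<And>d f. d \<ge> r \<Longrightarrow> f \<in> forms n d
      \<Longrightarrow> \<exists>s\<in>poly_carrier n. \<exists>t\<in>poly_carrier n. f - (coord_seq n c 0 * s + var 1 * t) \<in> I"
  shows "regular n [0] (single 0 ` I) (int r)"
proof -
  let ?h = "coord_seq n c"
  interpret linear_coordinates n ?h by (rule linear_coordinates_coord_seq)
  have h1: "?h 1 = var 1" by (simp add: coord_seq_def)
  have "filter_regular (int r) [0] (single 0 ` I)"
  proof (rule filter_regular_ideal[OF I r])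
    fix i d f s
    assume i: "i \<le> n" and d: "d \<ge> r" and f: "f \<in> forms n d"
      and s: "\<forall>j<i. s j \<in> poly_carrier n" and m: "?h i * f - (\<Sum>j<i. ?h j * s j) \<in> I"
    consider "i = 0" | "i = 1" | "i \<ge> 2" by linarith
    then show "\<exists>t. (\<forall>j<i. t j \<in> poly_carrier n) \<and> f - (\<Sum>j<i. ?h j * t j) \<in> I"
    proof cases
      case 1
      then show ?thesis using c0[OF d f] m by simp
    next
      case 2
      then have s0: "s 0 \<in> poly_carrier n" and m': "var 1 * f - ?h 0 * s 0 \<in> I"
        using s m h1 by auto
      have "hom_component (Suc d) (var 1 * f - ?h 0 * s 0) = var 1 * f - ?h 0 * hom_component d (s 0)"
        using hom_component_form[OF forms_var_mult[OF n f]]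
          hom_component_mult_left[OF coord_seq_form, of 0 n "Suc d" c "s 0"]
        by (simp add: hom_component_diff)
      then have "var 1 * f - ?h 0 * hom_component d (s 0) \<in> I"
        using homogeneous_idealD(5)[OF I m'] by metis
      then obtain t where "t \<in> poly_carrier n" "f - ?h 0 * t \<in> I"
        using c1[OF d f hom_component_forms[OF s0]] by blast
      then show ?thesis using 2 by (intro exI[of _ "\<lambda>_. t"]) simp
    next
      case 3
      obtain s t where st: "s \<in> poly_carrier n" "t \<in> poly_carrier n" "f - (?h 0 * s + var 1 * t) \<in> I"
        using c2[OF d f] by blast
      define u where "u = (\<lambda>j::nat. if j = 0 then s else if j = 1 then t else 0)"
      have "(\<Sum>j<i. ?h j * u j) = (\<Sum>j\<in>{0, 1}. ?h j * u j)"
        using 3 by (intro sum.mono_neutral_right) (auto simp: u_def)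
      then show ?thesis using st h1 by (intro exI[of _ u]) (auto simp: u_def)
    qed
  qed
  then show ?thesis by (rule filter_regular_imp_regular)
qed

section \<open>Parametrised lines and their ideals\<close>

abbreviation pev :: "(nat \<Rightarrow> 'k::field poly) \<Rightarrow> 'k mpoly \<Rightarrow> 'k poly" where
  "pev \<equiv> ev (\<lambda>x. [:x:])"

lemma monom_at_monom: "monom_at (\<lambda>j. monom (\<sigma> j) 1) m = monom (monom_at \<sigma> m) (mdeg m)"
proof -
  have "monom_at (\<lambda>j. monom (\<sigma> j) 1) m = (\<Prod>i\<in>supp m. monom (\<sigma> i ^ coef m i) (coef m i))"
    by (simp add: monom_at_def monom_power)
  also have "\<dots> = monom (\<Prod>i\<in>A. \<sigma> i ^ coef m i) (\<Sum>i\<in>A. coef m i)"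
    if "A = supp m" for A
  proof -
    have "finite A" using that by simp
    then have "(\<Prod>i\<in>A. monom (\<sigma> i ^ coef m i) (coef m i))
        = monom (\<Prod>i\<in>A. \<sigma> i ^ coef m i) (\<Sum>i\<in>A. coef m i)"
      by (induction A rule: finite_induct) (simp_all add: mult_monom)
    then show ?thesis using that by simp
  qed
  finally show ?thesis by (simp add: monom_at_def mdeg_def)
qed

text \<open>
  \<open>cone \<sigma>\<close> evaluates on the affine cone over the curve with parametrisation \<open>\<sigma>\<close>; the extra
  variable records degrees, so that its kernel is a homogeneous prime ideal.
\<close>

definition cone :: "(nat \<Rightarrow> 'k::field poly) \<Rightarrow> 'k mpoly \<Rightarrow> 'k poly poly" where
  "cone \<sigma> = ev (\<lambda>x. [:[:x:]:]) (\<lambda>j. monom (\<sigma> j) 1)"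

lemma cone_hom [simp]:
  "cone \<sigma> 0 = 0" "cone \<sigma> 1 = 1" "cone \<sigma> (f + g) = cone \<sigma> f + cone \<sigma> g"
  "cone \<sigma> (f * g) = cone \<sigma> f * cone \<sigma> g" "cone \<sigma> (f ^ k) = cone \<sigma> f ^ k"
  "cone \<sigma> (var j) = monom (\<sigma> j) 1"
  by (simp_all add: cone_def)

lemma cone_form: "f \<in> forms n d \<Longrightarrow> cone \<sigma> f = monom (pev \<sigma> f) d"
proof (induction rule: forms_induct)
  case (single m c)
  then show ?case
    using monom_at_monom[of \<sigma> m]
    by (simp add: cone_def ppc.ev_single pc.ev_single smult_monom)
qed (simp_all add: add_monom)

lemma coeff_cone: "f \<in> poly_carrier n \<Longrightarrow> coeff (cone \<sigma> f) d = pev \<sigma> (hom_component d f)"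
proof -
  assume f: "f \<in> poly_carrier n"
  obtain N where N: "\<forall>d\<ge>N. hom_component d f = 0" using ex_degree_bound by blast
  have "cone \<sigma> f = cone \<sigma> (\<Sum>d<N. hom_component d f)" using sum_hom_components[OF N] by simp
  also have "\<dots> = (\<Sum>d<N. monom (pev \<sigma> (hom_component d f)) d)"
    using cone_form[OF hom_component_forms[OF f]] by (simp add: cone_def ppc.ev_sum)
  finally have "coeff (cone \<sigma> f) d = (\<Sum>e<N. if e = d then pev \<sigma> (hom_component e f) else 0)"
    by (simp add: coeff_sum)
  then show ?thesis using N by (cases "d < N") auto
qed

definition vanishing :: "nat \<Rightarrow> (nat \<Rightarrow> 'k::field poly) \<Rightarrow> 'k mpoly set" where
  "vanishing n \<sigma> = {f \<in> poly_carrier n. cone \<sigma> f = 0}"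

lemma vanishing_form: "f \<in> forms n d \<Longrightarrow> f \<in> vanishing n \<sigma> \<longleftrightarrow> pev \<sigma> f = 0"
  by (simp add: vanishing_def forms_carrier cone_form)

lemma vanishing_iff:
  "f \<in> vanishing n \<sigma> \<longleftrightarrow> f \<in> poly_carrier n \<and> (\<forall>d. pev \<sigma> (hom_component d f) = 0)"
  by (auto simp: vanishing_def coeff_cone[symmetric] poly_eq_iff)

lemma homogeneous_ideal_vanishing: "homogeneous_ideal n (vanishing n \<sigma>)"
  unfolding homogeneous_ideal_def
proof (intro conjI ballI allI)
  show "ideal (vanishing n \<sigma>) (poly_ring n)"
    by (auto simp: ideal_iff vanishing_def poly_carrier_add poly_carrier_mult)
  show "hom_component d f \<in> vanishing n \<sigma>" if "f \<in> vanishing n \<sigma>" for f d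
    using that vanishing_form[OF hom_component_forms, of f n d \<sigma>] by (simp add: vanishing_iff)
qed

lemma vanishing_prime:
  assumes "f \<in> poly_carrier n" "g \<in> poly_carrier n" "f * g \<in> vanishing n \<sigma>"
  shows "f \<in> vanishing n \<sigma> \<or> g \<in> vanishing n \<sigma>"
  using assms by (auto simp: vanishing_def)

lemma vanishing_power:
  assumes "f \<in> poly_carrier n" "f ^ k \<in> vanishing n \<sigma>"
  shows "f \<in> vanishing n \<sigma>"
  using assms by (auto simp: vanishing_def)

lemma one_notin_vanishing: "1 \<notin> vanishing n \<sigma>"
  by (simp add: vanishing_def)

lemma var_vanishing_iff: "j \<le> n \<Longrightarrow> var j \<in> vanishing n \<sigma> \<longleftrightarrow> \<sigma> j = 0"
  by (simp add: vanishing_def)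

lemma pev_eval: "poly (pev \<sigma> f) b = ev (\<lambda>x. x) (\<lambda>j. poly (\<sigma> j) b) f"
  by (simp add: ev_def poly_sum poly_mult monom_at_def poly_prod)

lemma degree_pev:
  assumes "\<And>j. degree (\<sigma> j) \<le> 1" "f \<in> forms n d"
  shows "degree (pev \<sigma> f) \<le> d"
  using assms(2)
proof (induction rule: forms_induct)
  case (add f g)
  then show ?case by (simp add: degree_add_le)
next
  case (single m c)
  have "degree (monom_at \<sigma> m) \<le> (\<Sum>i\<in>supp m. degree (\<sigma> i ^ coef m i))"
    unfolding monom_at_def using degree_prod_sum_le[OF finite_keys] by (simp add: o_def)
  also have "\<dots> \<le> (\<Sum>i\<in>supp m. coef m i)"
  proof (rule sum_mono)
    fix i
    have "degree (\<sigma> i ^ coef m i) \<le> degree (\<sigma> i) * coef m i" by (rule degree_power_le)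
    also have "\<dots> \<le> coef m i" using mult_le_mono1[OF assms(1)[of i]] by simp
    finally show "degree (\<sigma> i ^ coef m i) \<le> coef m i" .
  qed
  finally show ?case using single by (simp add: pc.ev_single mdeg_def)
qed simp

text \<open>Homogenisation of a univariate polynomial to a binary form in \<open>x\<^sub>0, x\<^sub>b\<close>.\<close>

definition bform :: "nat \<Rightarrow> nat \<Rightarrow> 'k::field poly \<Rightarrow> 'k mpoly" where
  "bform b d p = (\<Sum>j\<le>d. const (coeff p j) * (var 0 ^ (d - j) * var b ^ j))"

lemma bform_form: "b \<le> n \<Longrightarrow> bform b d p \<in> forms n d"
  unfolding bform_def
proof (intro forms_sum forms_const_mult)
  fix j assume b: "b \<le> n" and j: "j \<in> {..d}"
  have "var 0 ^ (d - j) * var b ^ j \<in> forms n ((d - j) + j)"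
    using b by (intro forms_mult forms_power forms_var) auto
  then show "var 0 ^ (d - j) * var b ^ j \<in> forms n d" using j by simp
qed

lemma pev_bform:
  assumes "\<sigma> 0 = 1" "\<sigma> b = [:0, 1:]" "degree p \<le> d"
  shows "pev \<sigma> (bform b d p) = p"
proof -
  have "pev \<sigma> (bform b d p) = (\<Sum>j\<le>d. monom (coeff p j) j)"
    by (simp add: bform_def pc.ev_sum assms monom_altdef)
  then show ?thesis using poly_as_sum_of_monoms'[OF assms(3)] by simp
qed

lemma pev_bform_0:
  assumes "\<sigma> 0 = 1" "\<sigma> b = 0"
  shows "pev \<sigma> (bform b d p) = [:coeff p 0:]"
proof -
  have "pev \<sigma> (bform b d p) = (\<Sum>j\<le>d. if j = 0 then [:coeff p 0:] else 0)"
    unfolding bform_def pc.ev_sum by (intro sum.cong) (auto simp: assms)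
  then show ?thesis by simp
qed

section \<open>A line with lines tangent to a quadric along it\<close>

text \<open>
  The spine is the line \<open>x\<^sub>2 = x\<^sub>3 = \<dots> = 0\<close> and \<open>tline b\<close> joins its point \<open>(1 : b : 0 : 0)\<close> to
  \<open>(0 : b\<^sup>3 : 1 : b)\<close>; both are written in the chart \<open>x\<^sub>0 = 1\<close>, and the remaining coordinates vanish.
  Every \<open>tline b\<close> lies in the tangent plane \<open>x\<^sub>3 = b x\<^sub>2\<close> of the quadric \<open>x\<^sub>0 x\<^sub>3 = x\<^sub>1 x\<^sub>2\<close> at its
  point on the spine. The term \<open>b\<^sup>3\<close> moves the lines off that quadric: a line disjoint
  from the spine and meeting \<open>tline b\<close> for four values of \<open>b\<close> would make \<open>b\<^sup>3\<close> agree there with a quadratic polynomial.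
\<close>

definition spine :: "nat \<Rightarrow> 'k::field poly" where
  "spine j = (if j = 0 then 1 else if j = 1 then [:0, 1:] else 0)"

definition tline :: "'k::field \<Rightarrow> nat \<Rightarrow> 'k poly" where
  "tline b j = (if j = 0 then 1 else if j = 1 then [:b, b ^ 3:] else if j = 2 then [:0, 1:]
     else if j = 3 then [:0, b:] else 0)"

lemma spine_simps [simp]: "spine 0 = 1" "spine (Suc 0) = [:0, 1:]" "spine 2 = 0" "spine 3 = 0"
  by (simp_all add: spine_def)

lemma tline_simps [simp]:
  "tline b 0 = 1" "tline b (Suc 0) = [:b, b ^ 3:]" "tline b 2 = [:0, 1:]" "tline b 3 = [:0, b:]"
  by (simp_all add: tline_def)

lemma degree_spine: "degree (spine j) \<le> 1" by (simp add: spine_def)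

lemma degree_tline: "degree (tline b j) \<le> 1" by (simp add: tline_def)

lemma tline_meets_spine: "poly (pev (tline b) f) 0 = poly (pev spine f) b"
proof -
  have "(\<lambda>j. poly (tline b j) 0) = (\<lambda>j. poly (spine j) b)"
    by (auto simp: fun_eq_iff tline_def spine_def)
  then show ?thesis by (simp add: pev_eval)
qed

text \<open>Together these cut out \<open>tline b\<close> in the three-space \<open>x\<^sub>4 = \<dots> = x\<^sub>n = 0\<close>; the second also vanishes on the spine.\<close>

definition lam :: "'k::field \<Rightarrow> 'k mpoly" where
  "lam b = var 1 - const b * var 0 - const (b ^ 3) * var 2"

definition mu :: "'k::field \<Rightarrow> 'k mpoly" where
  "mu b = var 3 - const b * var 2"

lemma lam_mu_forms: "n \<ge> 3 \<Longrightarrow> lam b \<in> forms n 1" "n \<ge> 3 \<Longrightarrow> mu b \<in> forms n 1"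
  unfolding lam_def mu_def by (intro forms_diff forms_const_mult forms_var; simp)+

lemma lam_mu_eval:
  "pev (tline b) (lam c) = [:b - c, b ^ 3 - c ^ 3:]" "pev (tline b) (mu c) = [:0, b - c:]"
  "pev spine (mu c) = 0" "pev spine (lam c) = [:- c, 1:]"
  by (simp_all add: lam_def mu_def)

text \<open>
  The quadric containing the spine and three of the lines: on \<open>tline b\<close> the form
  \<open>x\<^sub>1 x\<^sub>2 - x\<^sub>0 x\<^sub>3\<close> is \<open>b\<^sup>3 u\<^sup>2\<close>, from which the quadratic interpolation of \<open>b\<^sup>3\<close> is subtracted.
\<close>

definition quadric :: "'k::field \<Rightarrow> 'k \<Rightarrow> 'k \<Rightarrow> 'k mpoly" where
  "quadric p q r = var 1 * var 2 - var 0 * var 3 - const (p + q + r) * (var 3 * var 3)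
     + const (p * q + p * r + q * r) * (var 2 * var 3) - const (p * q * r) * (var 2 * var 2)"

lemma quadric_form: "n \<ge> 3 \<Longrightarrow> quadric p q r \<in> forms n 2"
proof -
  assume n: "n \<ge> 3"
  have "var i * var j \<in> forms n 2" if "i \<le> 3" "j \<le> 3" for i j
    using forms_mult[OF forms_var[of i n] forms_var[of j n]] that n by (simp add: numeral_2_eq_2)
  then show ?thesis unfolding quadric_def by (intro forms_add forms_diff forms_const_mult) auto
qed

lemma quadric_eval:
  "pev (tline b) (quadric p q r) = [:0, 0, (b - p) * (b - q) * (b - r):]"
  "pev spine (quadric p q r) = 0"
  by (simp_all add: quadric_def algebra_simps power3_eq_cube)

locale tangent_lines =
  fixes n k :: nat and a :: "nat \<Rightarrow> 'k::alg_closed_field"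
  assumes n: "n \<ge> 3" and k: "k \<ge> 4" and inj: "inj_on a {..<k}" and nz: "i < k \<Longrightarrow> a i \<noteq> 0"
begin

definition comps :: "nat option set" where "comps = insert None (Some ` {..<k})"

definition param :: "nat option \<Rightarrow> nat \<Rightarrow> 'k poly" where
  "param M = (case M of None \<Rightarrow> spine | Some i \<Rightarrow> tline (a i))"

abbreviation line_ideal :: "nat option \<Rightarrow> 'k mpoly set" where
  "line_ideal M \<equiv> vanishing n (param M)"

definition res :: "nat option \<Rightarrow> 'k mpoly \<Rightarrow> 'k poly" where
  "res M = pev (param M)"

definition C :: "'k mpoly set" where
  "C = {f \<in> poly_carrier n. \<forall>M\<in>comps. f \<in> line_ideal M}"

text \<open>These are the sections of \<open>\<O>(d)\<close> on the curve: polynomials on the lines, glued at the nodes.\<close>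

definition tuples :: "nat \<Rightarrow> (nat option \<Rightarrow> 'k poly) set" where
  "tuples d = {F. (\<forall>M\<in>comps. degree (F M) \<le> d) \<and>
     (\<forall>i<k. poly (F (Some i)) 0 = poly (F None) (a i))}"

lemma comps_iff [simp]: "None \<in> comps" "Some i \<in> comps \<longleftrightarrow> i < k"
  by (auto simp: comps_def)

lemma ball_comps: "(\<forall>M\<in>comps. P M) \<longleftrightarrow> P None \<and> (\<forall>i<k. P (Some i))"
  by (auto simp: comps_def)

lemma finite_comps: "finite comps" by (simp add: comps_def)

lemma a_eq_iff: "i < k \<Longrightarrow> j < k \<Longrightarrow> a i = a j \<longleftrightarrow> i = j"
  using inj by (auto dest: inj_onD)

lemma param_simps [simp]: "param None = spine" "param (Some i) = tline (a i)"
  by (simp_all add: param_def)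

lemma degree_param: "degree (param M j) \<le> 1"
  by (cases M) (simp_all only: param_simps degree_spine degree_tline)

lemma param_0 [simp]: "param M 0 = 1" by (cases M) simp_all

lemma res_hom [simp]:
  "res M 0 = 0" "res M 1 = 1" "res M (f + g) = res M f + res M g" "res M (f - g) = res M f - res M g"
  "res M (f * g) = res M f * res M g" "res M (const c) = [:c:]" "res M (var j) = param M j"
  "res M (- f) = - res M f"
  by (simp_all add: res_def)

lemma res_sum: "res M (\<Sum>i\<in>A. f i) = (\<Sum>i\<in>A. res M (f i))"
  by (simp add: res_def pc.ev_sum)

lemma res_prod: "res M (\<Prod>i\<in>A. f i) = (\<Prod>i\<in>A. res M (f i))"
  by (simp add: res_def pc.ev_prod)

lemma degree_res: "f \<in> forms n d \<Longrightarrow> degree (res M f) \<le> d"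
  unfolding res_def using degree_pev degree_param by blast

lemma res_glue: "poly (res (Some i) f) 0 = poly (res None f) (a i)"
  by (simp add: res_def tline_meets_spine)

lemma res_tuples: "f \<in> forms n d \<Longrightarrow> (\<lambda>M. res M f) \<in> tuples d"
  by (simp add: tuples_def degree_res res_glue)

lemma C_form: "f \<in> forms n d \<Longrightarrow> f \<in> C \<longleftrightarrow> (\<forall>M\<in>comps. res M f = 0)"
  by (simp add: C_def res_def forms_carrier vanishing_form[of f n d])

lemma homogeneous_ideal_C: "homogeneous_ideal n C"
proof -
  note V = homogeneous_idealD[OF homogeneous_ideal_vanishing]
  show ?thesis
    unfolding homogeneous_ideal_def ideal_iff
    by (auto simp: C_def poly_carrier_add poly_carrier_mult hom_component_carrier intro: V)
qed

text \<open>
  By induction on the set \<open>E\<close> of lines to be avoided: the forms \<open>lam\<close>, \<open>mu\<close> of the next line of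
  \<open>E\<close> restrict to a basis of the linear forms on line \<open>i\<close>, so they absorb one degree. The first is
  needed only for the value at the node, and the second vanishes on the spine.
\<close>

lemma interpolate_line:
  assumes "finite E" "E \<subseteq> {..<k}" "i < k" "i \<notin> E" "degree v \<le> card E + e"
  shows "\<exists>f\<in>forms n (card E + e). (\<forall>l\<in>E. res (Some l) f = 0) \<and> res (Some i) f = v \<and>
    (poly v 0 = 0 \<longrightarrow> res None f = 0)"
  using assms
proof (induction E arbitrary: v rule: finite_induct)
  case empty
  have "res None (bform 2 e v) = [:coeff v 0:]"
    using pev_bform_0[of spine 2 e v] by (simp add: res_def)
  moreover have "res (Some i) (bform 2 e v) = v"
    using pev_bform[of "tline (a i)" 2 v e] empty by (simp add: res_def)
  ultimately show ?case using n
    by (intro bexI[of _ "bform 2 e v"]) (simp_all add: bform_form poly_0_coeff_0)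
next
  case (insert l E)
  obtain c v' where v: "v = pCons c v'" by (cases v)
  define A where "A = a i - a l"
  define B where "B = a i ^ 3 - a l ^ 3"
  have A: "A \<noteq> 0" using insert.prems insert.hyps a_eq_iff[of i l] by (auto simp: A_def)
  \<comment> \<open>Solve \<open>(A + B u) v1 + A u v2 = v\<close> with \<open>v1\<close> constant.\<close>
  define v1 where "v1 = [:c / A:]"
  define v2 where "v2 = smult (1 / A) (v' - [:B * c / A:])"
  have "degree v' \<le> card E + e" using insert.prems insert.hyps v by (cases "v' = 0") auto
  then have d2: "degree v2 \<le> card E + e"
    unfolding v2_def using degree_smult_le[of "1 / A" "v' - [:B * c / A:]"]
      degree_diff_le[of v' "card E + e" "[:B * c / A:]"] by simp
  obtain f1 where f1: "f1 \<in> forms n (card E + e)" "\<forall>l\<in>E. res (Some l) f1 = 0" "res (Some i) f1 = v1"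
    "poly v1 0 = 0 \<longrightarrow> res None f1 = 0"
    using insert.IH[of v1] insert.prems by (auto simp: v1_def)
  obtain f2 where f2: "f2 \<in> forms n (card E + e)" "\<forall>l\<in>E. res (Some l) f2 = 0" "res (Some i) f2 = v2"
    using insert.IH[of v2] insert.prems d2 by auto
  define f where "f = lam (a l) * f1 + mu (a l) * f2"
  have "f \<in> forms n (1 + (card E + e))"
    unfolding f_def using f1(1) f2(1) n by (intro forms_add forms_mult lam_mu_forms)
  moreover have "\<forall>j\<in>insert l E. res (Some j) f = 0"
    using f1(2) f2(2) by (auto simp: f_def) (simp add: res_def lam_mu_eval)
  moreover have "res (Some i) f = v"
  proof -
    have "res (Some i) f = [:A, B:] * v1 + [:0, A:] * v2"
      using f1(3) f2(3) by (simp add: f_def) (simp add: res_def lam_mu_eval A_def B_def)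
    also have "\<dots> = v" using A by (simp add: v v1_def v2_def)
    finally show ?thesis .
  qed
  moreover have "poly v 0 = 0 \<longrightarrow> res None f = 0"
    using f1(4) by (simp add: f_def v v1_def) (simp add: res_def lam_mu_eval)
  ultimately show ?case using insert.hyps by (intro bexI[of _ f]) auto
qed

text \<open>
  The node conditions let the value on the spine be lifted first; the error on each line then
  vanishes at its node, where interpolation does not disturb the spine.
\<close>

lemma lift_lines:
  assumes I: "I \<subseteq> {..<k}" and d: "Suc d \<ge> card I" and F: "F \<in> tuples d"
  shows "\<exists>f\<in>forms n d. \<forall>M\<in>insert None (Some ` I). res M f = F M"
proof -
  have fin: "finite I" using I finite_subset by blast
  define f0 where "f0 = bform 1 d (F None)"
  have f0: "f0 \<in> forms n d" using n by (simp add: f0_def bform_form)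
  have f0N: "res None f0 = F None"
    using pev_bform[of spine 1 "F None" d] F by (simp add: f0_def res_def tuples_def)
  have "\<exists>f\<in>forms n d. (\<forall>l\<in>I - {i}. res (Some l) f = 0) \<and>
      res (Some i) f = F (Some i) - res (Some i) f0 \<and> res None f = 0" if i: "i \<in> I" for i
  proof -
    let ?v = "F (Some i) - res (Some i) f0"
    have "card I \<noteq> 0" using i fin by auto
    then have c: "card (I - {i}) + (Suc d - card I) = d" using i d by simp
    have "degree ?v \<le> d" using F I i degree_res[OF f0] by (auto simp: tuples_def intro!: degree_diff_le)
    moreover have "poly ?v 0 = 0" using F I i f0N by (auto simp: tuples_def res_glue)
    ultimately show ?thesis
      using interpolate_line[of "I - {i}" i ?v "Suc d - card I"] I i fin unfolding c by auto
  qed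
  then obtain g where g: "\<And>i. i \<in> I \<Longrightarrow> g i \<in> forms n d \<and> (\<forall>l\<in>I - {i}. res (Some l) (g i) = 0) \<and>
      res (Some i) (g i) = F (Some i) - res (Some i) f0 \<and> res None (g i) = 0" by metis
  define f where "f = f0 + (\<Sum>i\<in>I. g i)"
  have "f \<in> forms n d" using f0 g by (auto simp: f_def intro!: forms_add forms_sum)
  moreover have "res None f = F None" using g f0N by (simp add: f_def res_sum)
  moreover have "res (Some j) f = F (Some j)" if "j \<in> I" for j
  proof -
    have "(\<Sum>i\<in>I. res (Some j) (g i)) = (\<Sum>i\<in>I. if i = j then F (Some j) - res (Some j) f0 else 0)"
      using g that by (intro sum.cong) auto
    then show ?thesis using that fin by (simp add: f_def res_sum)
  qed
  ultimately show ?thesis by auto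
qed

text \<open>In terms of sheaves: \<open>H\<^sup>1\<close> of the ideal sheaf vanishes in degrees \<open>\<ge> k - 1\<close>.\<close>

lemma lift_tuples:
  assumes "Suc d \<ge> k" "F \<in> tuples d"
  shows "\<exists>f\<in>forms n d. \<forall>M\<in>comps. res M f = F M"
  using lift_lines[of "{..<k}" d F] assms by (simp add: comps_def)

lemma linear_combination:
  fixes p q r s :: 'k
  assumes "degree F \<le> Suc d" "p * s - q * r \<noteq> 0"
  shows "\<exists>X Y. degree X \<le> d \<and> degree Y \<le> d \<and> F = [:p, q:] * X + [:r, s:] * Y"
proof -
  obtain c F' where F: "F = pCons c F'" by (cases F)
  define D where "D = p * s - q * r"
  have D: "D \<noteq> 0" using assms(2) by (simp add: D_def)
  have F': "degree F' \<le> d" using assms(1) F by (cases "F' = 0") auto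
  define U where "U = smult (- r) F' + [:s * c:]"
  define V where "V = smult p F' + [:- q * c:]"
  define X where "X = smult (1 / D) U"
  define Y where "Y = smult (1 / D) V"
  have "[:p, q:] * X + [:r, s:] * Y = smult (1 / D) ([:p, q:] * U + [:r, s:] * V)"
    by (simp only: X_def Y_def mult_smult_right smult_add_right)
  also have "[:p, q:] * U + [:r, s:] * V = smult D F"
    by (simp add: F D_def U_def V_def algebra_simps smult_add_left smult_diff_left)
  finally have "F = [:p, q:] * X + [:r, s:] * Y" using D by simp
  moreover have "degree X \<le> d" "degree Y \<le> d"
    unfolding X_def Y_def U_def V_def using F'
    by (auto intro!: order.trans[OF degree_smult_le] degree_add_le degree_diff_le)
  ultimately show ?thesis by blast
qed

definition independent :: "(nat option \<Rightarrow> 'k poly) \<Rightarrow> (nat option \<Rightarrow> 'k poly) \<Rightarrow> bool" where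
  "independent W L \<longleftrightarrow> (\<forall>M\<in>comps. coeff (W M) 0 * coeff (L M) 1 - coeff (W M) 1 * coeff (L M) 0 \<noteq> 0)"

lemma degree_1_pCons: "degree p \<le> 1 \<Longrightarrow> p = [:coeff p 0, coeff p 1:]"
  for p :: "'k poly"
  by (rule poly_eqI) (auto simp: coeff_pCons coeff_eq_0 split: nat.split)

text \<open>
  The equation is solved on the spine first. This prescribes the values at the nodes, and on each
  line the rest is divisible by the parameter, whose multiples can be chosen freely.
\<close>

lemma tuples_combination:
  assumes W: "W \<in> tuples 1" and L: "L \<in> tuples 1" and ind: "independent W L"
    and d: "d \<ge> 1" and F: "F \<in> tuples (Suc d)"
  shows "\<exists>X\<in>tuples d. \<exists>Y\<in>tuples d. \<forall>M\<in>comps. F M = W M * X M + L M * Y M"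
proof -
  have WL: "W M = [:coeff (W M) 0, coeff (W M) 1:]" "L M = [:coeff (L M) 0, coeff (L M) 1:]"
    if "M \<in> comps" for M
    using W L that degree_1_pCons[of "W M"] degree_1_pCons[of "L M"] by (auto simp: tuples_def)
  have comb: "\<exists>X Y. degree X \<le> e \<and> degree Y \<le> e \<and> G = W M * X + L M * Y"
    if "M \<in> comps" "degree G \<le> Suc e" for M G e
  proof -
    have "coeff (W M) 0 * coeff (L M) 1 - coeff (W M) 1 * coeff (L M) 0 \<noteq> 0"
      using ind that(1) unfolding independent_def by blast
    from linear_combination[OF that(2) this] show ?thesis using WL[OF that(1)] by metis
  qed
  obtain X0 Y0 where 0: "degree X0 \<le> d" "degree Y0 \<le> d" "F None = W None * X0 + L None * Y0"
    using comb[of None "F None" d] F by (auto simp: tuples_def)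
  have "\<exists>X Y. degree X \<le> d \<and> degree Y \<le> d \<and> F (Some i) = W (Some i) * X + L (Some i) * Y \<and>
      poly X 0 = poly X0 (a i) \<and> poly Y 0 = poly Y0 (a i)" if i: "i < k" for i
  proof -
    let ?W = "W (Some i)" and ?L = "L (Some i)" and ?x = "[:poly X0 (a i):]" and ?y = "[:poly Y0 (a i):]"
    define R where "R = F (Some i) - ?W * ?x - ?L * ?y"
    have "poly R 0 = 0" using F W L i 0(3) by (simp add: R_def tuples_def)
    then obtain G where G: "R = pCons 0 G" by (cases R) auto
    have "degree (?W * ?x) \<le> 1" "degree (?L * ?y) \<le> 1"
      using W L i degree_mult_le[of ?W ?x] degree_mult_le[of ?L ?y] by (auto simp: tuples_def)
    then have "degree R \<le> Suc d"
      unfolding R_def using F i by (intro degree_diff_le) (auto simp: tuples_def)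
    then have "degree G \<le> Suc (d - 1)" using d G by (cases "G = 0") auto
    then obtain X Y where XY: "degree X \<le> d - 1" "degree Y \<le> d - 1" "G = ?W * X + ?L * Y"
      using comb[of "Some i" G "d - 1"] i by auto
    have "F (Some i) = R + ?W * ?x + ?L * ?y" by (simp add: R_def)
    also have "R = ?W * pCons 0 X + ?L * pCons 0 Y" using G XY(3) by simp
    finally have "F (Some i) = ?W * (?x + pCons 0 X) + ?L * (?y + pCons 0 Y)"
      by (simp add: algebra_simps)
    moreover have "degree (?x + pCons 0 X) \<le> d" "degree (?y + pCons 0 Y) \<le> d"
      using XY d by (auto intro!: degree_add_le)
    moreover have "poly (?x + pCons 0 X) 0 = poly X0 (a i)" "poly (?y + pCons 0 Y) 0 = poly Y0 (a i)"
      by simp_all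
    ultimately show ?thesis by blast
  qed
  then obtain X Y where XY: "\<And>i. i < k \<Longrightarrow> degree (X i) \<le> d \<and> degree (Y i) \<le> d \<and>
      F (Some i) = W (Some i) * X i + L (Some i) * Y i \<and>
      poly (X i) 0 = poly X0 (a i) \<and> poly (Y i) 0 = poly Y0 (a i)" by metis
  define X' where "X' = (\<lambda>M. case M of None \<Rightarrow> X0 | Some i \<Rightarrow> X i)"
  define Y' where "Y' = (\<lambda>M. case M of None \<Rightarrow> Y0 | Some i \<Rightarrow> Y i)"
  have "X' \<in> tuples d" "Y' \<in> tuples d"
    using XY 0 by (auto simp: tuples_def X'_def Y'_def ball_comps)
  moreover have "\<forall>M\<in>comps. F M = W M * X' M + L M * Y' M"
    using XY 0 by (auto simp: X'_def Y'_def ball_comps)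
  ultimately show ?thesis by blast
qed

lemma tuples_mult: "F \<in> tuples d \<Longrightarrow> G \<in> tuples e \<Longrightarrow> (\<lambda>M. F M * G M) \<in> tuples (d + e)"
  by (auto simp: tuples_def intro!: order.trans[OF degree_mult_le] add_mono)

lemma tuples_add: "F \<in> tuples d \<Longrightarrow> G \<in> tuples d \<Longrightarrow> (\<lambda>M. F M + G M) \<in> tuples d"
  by (auto simp: tuples_def intro!: degree_add_le)

end

section \<open>Points of projective space\<close>

lemma infinite_alg_closed: "infinite (UNIV :: 'k::alg_closed_field set)"
proof
  assume fin: "finite (UNIV :: 'k set)"
  define p :: "'k poly" where "p = (\<Prod>x\<in>UNIV. [:- x, 1:])"
  have "p \<noteq> 0" using fin by (simp add: p_def)
  have root: "poly p x = 0" for x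
    using fin unfolding p_def poly_prod by (intro prod_zero) auto
  have "degree p > 0"
  proof (rule ccontr)
    assume "\<not> degree p > 0"
    then obtain c where "p = [:c:]" using degree_eq_zeroE by blast
    then show False using \<open>p \<noteq> 0\<close> root[of 0] by simp
  qed
  then have "degree (p + 1) > 0" by (subst degree_add_eq_left) auto
  then obtain x where "poly (p + 1) x = 0" using alg_closed_imp_poly_has_root by blast
  then show False using root by simp
qed

lemma vanishing_Proj:
  assumes "i \<le> n" "\<sigma> i \<noteq> 0"
  shows "vanishing n \<sigma> \<in> Proj n"
  unfolding Proj_def
proof (intro CollectI conjI)
  show "primeideal (vanishing n \<sigma>) (poly_ring n)"
  proof (rule primeidealI)
    show "ideal (vanishing n \<sigma>) (poly_ring n)"
      using homogeneous_ideal_vanishing[of n \<sigma>] by (simp add: homogeneous_ideal_def)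
    show "cring (poly_ring n :: 'a mpoly ring)" by (rule cring_poly_ring)
    show "carrier (poly_ring n) \<noteq> vanishing n \<sigma>"
    proof
      assume eq: "carrier (poly_ring n) = vanishing n \<sigma>"
      have "1 \<in> carrier (poly_ring n :: 'a mpoly ring)" by (simp add: poly_ring_def)
      then show False unfolding eq using one_notin_vanishing[of n \<sigma>] by contradiction
    qed
    show "f \<in> vanishing n \<sigma> \<or> g \<in> vanishing n \<sigma>"
      if "f \<in> carrier (poly_ring n)" "g \<in> carrier (poly_ring n)"
        "f \<otimes>\<^bsub>poly_ring n\<^esub> g \<in> vanishing n \<sigma>" for f g
      using that vanishing_prime[of f n g \<sigma>] by (simp add: poly_ring_def)
  qed
  show "homogeneous_ideal n (vanishing n \<sigma>)" by (rule homogeneous_ideal_vanishing)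
  show "\<exists>i\<le>n. var i \<notin> vanishing n \<sigma>" using assms var_vanishing_iff by blast
qed

lemma topspace_zariski: "topspace (zariski n) = Proj n"
proof -
  have "1 \<notin> P" if "P \<in> Proj n" for P :: "'a mpoly set"
  proof -
    have "primeideal P (poly_ring n)" using that by (simp add: Proj_def)
    then interpret primeideal P "poly_ring n :: 'a mpoly ring" .
    show ?thesis using one_imp_carrier I_notcarr by (auto simp: poly_ring_def)
  qed
  then have "{P \<in> Proj n. (1 :: 'a mpoly) \<notin> P} = Proj n" by blast
  moreover have "(1 :: 'a mpoly) \<in> forms n 0" using forms_const[of 1 n] by simp
  ultimately have "Proj n \<in> {{P \<in> Proj n. f \<notin> P} | f. \<exists>d. (f :: 'a mpoly) \<in> forms n d}" by blast
  then show ?thesis unfolding zariski_def topology_generated_by_topspace by blast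
qed

lemma topspace_underlying: "topspace (underlying_space n X) = {P \<in> Proj n. X \<subseteq> P}"
  by (auto simp: underlying_space_def topspace_zariski)

lemma pev_point: "pev (\<lambda>j. [:poly (\<sigma> j) b:]) f = [:poly (pev \<sigma> f) b:]"
proof -
  have c: "[:x:] * [:y:] = [:x * y:]" for x y :: 'a by simp
  have "(\<Sum>m\<in>A. [:h m:]) = [:\<Sum>m\<in>A. h m:]" for h :: "_ \<Rightarrow> 'a" and A :: "(nat \<Rightarrow>\<^sub>0 nat) set"
    by (induction A rule: infinite_finite_induct) auto
  moreover have "[:x:] ^ e = [:x ^ e:]" for x :: 'a and e
    by (induction e) (auto simp: one_pCons)
  moreover have "(\<Prod>m\<in>A. [:h m:]) = [:\<Prod>m\<in>A. h m:]" for h :: "_ \<Rightarrow> 'a" and A :: "nat set"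
    by (induction A rule: infinite_finite_induct) (auto simp: one_pCons)
  ultimately show ?thesis
    by (simp add: ev_def monom_at_def poly_sum poly_prod mult.commute)
qed

lemma vanishing_subset_point: "vanishing n \<sigma> \<subseteq> vanishing n (\<lambda>j. [:poly (\<sigma> j) b:])"
  by (auto simp: vanishing_iff pev_point)

lemma infinite_line_points:
  fixes \<sigma> :: "nat \<Rightarrow> 'k::alg_closed_field poly"
  assumes "\<sigma> 0 = 1" "\<sigma> b = [:0, 1:]" "b \<le> n"
  shows "infinite {P \<in> Proj n. vanishing n \<sigma> \<subseteq> P}"
proof -
  define closed_point where "closed_point = (\<lambda>x. vanishing n (\<lambda>j. [:poly (\<sigma> j) x:]))"
  have form: "var b - const x * var 0 \<in> forms n 1" for x
    using assms(3) by (intro forms_diff forms_const_mult forms_var) auto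
  have "var b - const x * var 0 \<in> closed_point y \<longleftrightarrow> x = y" for x y
    unfolding closed_point_def vanishing_form[OF form] by (auto simp: assms)
  then have "inj closed_point" by (metis injI)
  then have "infinite (range closed_point)" using infinite_alg_closed finite_imageD by blast
  moreover have "range closed_point \<subseteq> {P \<in> Proj n. vanishing n \<sigma> \<subseteq> P}"
  proof
    fix P assume "P \<in> range closed_point"
    then obtain x where x: "P = vanishing n (\<lambda>j. [:poly (\<sigma> j) x:])" by (auto simp: closed_point_def)
    show "P \<in> {P \<in> Proj n. vanishing n \<sigma> \<subseteq> P}"
      using vanishing_subset_point[of n \<sigma> x] vanishing_Proj[of 0 n "\<lambda>j. [:poly (\<sigma> j) x:]"] assms(1)
      by (simp add: x)
  qed
  ultimately show ?thesis using finite_subset by blast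
qed

section \<open>The regularity of the curve\<close>

text \<open>The coefficients \<open>A 2\<close>, \<open>A 3\<close> restricted to the spine are the normal derivatives of \<open>f\<close> along it.\<close>

lemma spine_decomposition:
  assumes "n \<ge> 1" "f \<in> forms n d"
  shows "\<exists>A. (\<forall>j. A j \<in> poly_carrier n \<and> degree (pev spine (A j)) \<le> d - 1) \<and>
    f = bform 1 d (pev spine f) + (\<Sum>j=2..n. var j * A j)"
  using assms(2)
proof (induction rule: forms_induct)
  case zero
  show ?case by (rule exI[of _ "\<lambda>_. 0"]) (simp add: bform_def)
next
  case (add f g)
  then obtain A B where A: "\<forall>j. A j \<in> poly_carrier n \<and> degree (pev spine (A j)) \<le> d - 1"
      "f = bform 1 d (pev spine f) + (\<Sum>j=2..n. var j * A j)"
    and B: "\<forall>j. B j \<in> poly_carrier n \<and> degree (pev spine (B j)) \<le> d - 1"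
      "g = bform 1 d (pev spine g) + (\<Sum>j=2..n. var j * B j)" by blast
  have "bform 1 d (p + q) = bform 1 d p + bform 1 d q" for p q :: "'a poly"
    by (simp add: bform_def single_add distrib_right sum.distrib)
  then have eq: "f + g = bform 1 d (pev spine (f + g)) + (\<Sum>j=2..n. var j * (A j + B j))"
    by (subst A(2), subst B(2)) (simp add: distrib_left sum.distrib)
  have "\<forall>j. A j + B j \<in> poly_carrier n \<and> degree (pev spine (A j + B j)) \<le> d - 1"
    using A(1) B(1) by (auto simp: poly_carrier_add intro: degree_add_le)
  with eq show ?case by (intro exI[of _ "\<lambda>j. A j + B j"] conjI)
next
  case (single m c)
  show ?case
  proof (cases "\<exists>j\<in>supp m. j \<ge> 2")
    case True
    then obtain j where j: "j \<in> supp m" "j \<ge> 2" by blast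
    obtain m' where m: "m = single j 1 + m'" "supp m' \<subseteq> supp m" "mdeg m = Suc (mdeg m')"
      using j(1) by (rule monomial_split)
    then have sm: "supp m' \<subseteq> {..n}" and md: "mdeg m' = d - 1" using single by auto
    let ?A = "\<lambda>i. if i = j then single m' c else 0"
    have s: "single m c = var j * single m' c"
      by (simp add: var_def mult_single m(1))
    also have "\<dots> = (\<Sum>i=2..n. var i * ?A i)"
      using j single(1) by (auto simp: if_distrib cong: if_cong)
    finally have sA: "single m c = (\<Sum>i=2..n. var i * ?A i)" .
    have "spine j = (0 :: 'a poly)" using j by (simp add: spine_def)
    then have "pev spine (single m c) = 0" by (simp add: s)
    then have "bform 1 d (pev spine (single m c)) = 0" by (simp add: bform_def)
    moreover have "single m' c \<in> forms n (d - 1)" using forms_single[OF sm] md by simp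
    ultimately show ?thesis using sA degree_pev[OF degree_spine, of "single m' c" n "d - 1"]
      by (intro exI[of _ ?A]) (auto simp: forms_carrier)
  next
    case False
    define x where "x = coef m 0"
    define y where "y = coef m 1"
    have sm: "supp m \<subseteq> {0, 1}" using False by force
    have m: "m = single 0 x + single 1 y"
    proof (rule poly_mapping_eqI)
      fix j
      have "coef m j = 0" if "j \<noteq> 0" "j \<noteq> 1" using sm that by (auto simp: in_keys_iff)
      then show "coef m j = coef (single 0 x + single 1 y) j"
        by (auto simp: lookup_add lookup_single when_def x_def y_def)
    qed
    have vp: "var i ^ e = single (single i e) (1::'a)" for i e
      by (induction e) (simp_all add: var_def mult_single single_add[symmetric])
    have s: "single m c = const c * (var 0 ^ x * var 1 ^ y)"
      by (simp add: vp mult_single m)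
    have xy: "x + y = d" using single(2) m by (simp add: mdeg_add)
    have "pev spine (single m c) = monom c y"
      by (simp add: s monom_altdef)
    moreover have "bform 1 d (monom c y) = (\<Sum>j\<le>d. if j = y then const c * (var 0 ^ (d - j) * var 1 ^ j) else 0)"
      unfolding bform_def by (intro sum.cong) auto
    ultimately have "single m c = bform 1 d (pev spine (single m c))"
      using s xy by auto
    then show ?thesis by (intro exI[of _ "\<lambda>_. 0"]) simp
  qed
qed

context tangent_lines
begin

lemma tuples_const_1: "(\<lambda>M. 1) \<in> tuples d" by (simp add: tuples_def)

lemma coord_seq_zero: "coord_seq n (\<lambda>_. 0) 0 = (var 0 :: 'k mpoly)"
  by (simp add: coord_seq_def)

text \<open>
  For the coordinates \<open>x\<^sub>0, x\<^sub>1, \<dots>\<close>: if \<open>x\<^sub>1 f \<equiv> x\<^sub>0 s\<close> on the curve, then \<open>x\<^sub>0\<close> divides \<open>f\<close> on every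
  component, and the quotient section lifts to a form.
\<close>

lemma regular_C: "regular n [0] (single 0 ` C) (int k)"
proof (rule regular_criterion[OF homogeneous_ideal_C, where c = "\<lambda>_. 0"], goal_cases)
  case (3 d f)
  then have "M \<in> comps \<Longrightarrow> var 0 * f \<in> line_ideal M" for M
    by (auto simp: C_def coord_seq_zero)
  moreover have "var 0 \<notin> line_ideal M" for M by (simp add: var_vanishing_iff)
  ultimately show ?case
    using 3(2) vanishing_prime[of "var 0" n f] by (auto simp: C_def forms_carrier)
next
  case (4 d f s)
  obtain e where d: "d = Suc e" using 4(1) k by (cases d) auto
  have eq: "param M 1 * res M f = res M s" if "M \<in> comps" for M
  proof -
    have "var 1 * f - var 0 * s \<in> forms n (Suc d)"
      using 4 n by (intro forms_diff forms_var_mult) auto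
    then show ?thesis using C_form 4(4) that by (auto simp: coord_seq_zero)
  qed
  have deg: "degree (res M f) \<le> e" if "M \<in> comps" for M
  proof (cases "res M f = 0")
    case False
    have "degree (param M 1) = 1" using that nz by (cases M) auto
    then have "degree (param M 1 * res M f) = Suc (degree (res M f))"
      using False by (subst degree_mult_eq) auto
    then show ?thesis using eq[OF that] degree_res[OF 4(3), of M] d by simp
  qed simp
  then have "(\<lambda>M. res M f) \<in> tuples e" by (simp add: tuples_def res_glue)
  then obtain t where t: "t \<in> forms n e" "\<forall>M\<in>comps. res M t = res M f"
    using lift_tuples[of e "\<lambda>M. res M f"] 4(1) d by auto
  have "f - var 0 * t \<in> forms n d"
    using 4(2) t(1) d by (auto intro!: forms_diff forms_var_mult)
  then have "f - var 0 * t \<in> C" using t(2) C_form by auto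
  then show ?case using t(1) forms_carrier by (auto simp: coord_seq_zero)
next
  case (5 d f)
  obtain e where d: "d = Suc e" using 5(1) k by (cases d) auto
  have L: "(\<lambda>M. res M (var 1)) \<in> tuples 1"
    using res_tuples[of "var 1" 1] n forms_var[of 1 n] by simp
  have ind: "independent (\<lambda>M. 1) (\<lambda>M. res M (var 1))"
    using nz by (simp add: independent_def ball_comps)
  have "(\<lambda>M. res M f) \<in> tuples (Suc e)" using res_tuples 5(2) d by simp
  then have "\<exists>X\<in>tuples e. \<exists>Y\<in>tuples e. \<forall>M\<in>comps. res M f = 1 * X M + res M (var 1) * Y M"
    using 5(1) k d by (intro tuples_combination[OF tuples_const_1 L ind]) auto
  then obtain X Y where XY: "X \<in> tuples e" "Y \<in> tuples e"
    "\<forall>M\<in>comps. res M f = 1 * X M + res M (var 1) * Y M" by blast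
  have e: "Suc e \<ge> k" using 5(1) d by simp
  obtain s t where st: "s \<in> forms n e" "\<forall>M\<in>comps. res M s = X M"
    "t \<in> forms n e" "\<forall>M\<in>comps. res M t = Y M"
    using lift_tuples[OF e XY(1)] lift_tuples[OF e XY(2)] by blast
  have "f - (var 0 * s + var 1 * t) \<in> forms n d"
    using 5(2) st n d by (auto intro!: forms_diff forms_add forms_var_mult)
  then have "f - (var 0 * s + var 1 * t) \<in> C" using XY(3) st C_form by auto
  then show ?case unfolding coord_seq_zero using forms_carrier[OF st(1)] forms_carrier[OF st(3)] by blast
qed (use n k in auto)

text \<open>
  The derivative of \<open>f\<close> at the point of the spine with parameter \<open>c\<close>, in the direction of
  \<open>tline c\<close>, is a polynomial in \<open>c\<close> of degree \<open>< k\<close> with the \<open>k\<close> roots \<open>a i\<close>; so it vanishes also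
  for the parameters \<open>b\<close> of lines outside the curve.
\<close>

lemma low_degree_tangent:
  assumes f: "f \<in> forms n d" "f \<in> C" and d: "d < k"
  shows "[:0, 0, 1:] dvd pev (tline b) f"
proof -
  obtain A where A: "\<And>j. A j \<in> poly_carrier n \<and> degree (pev spine (A j)) \<le> d - 1"
    "f = bform 1 d (pev spine f) + (\<Sum>j=2..n. var j * A j)"
    using spine_decomposition[OF _ f(1)] n by auto
  have "res None f = 0" using C_form[OF f(1)] f(2) by simp
  then have fA: "f = (\<Sum>j=2..n. var j * A j)" using A(2) by (simp add: res_def bform_def)
  have tl: "pev (tline c) f = pCons 0 (pev (tline c) (A 2) + smult c (pev (tline c) (A 3)))" for c
  proof -
    have "pev (tline c) f = (\<Sum>j=2..n. tline c j * pev (tline c) (A j))"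
      by (simp add: fA pc.ev_sum)
    also have "\<dots> = (\<Sum>j\<in>{2, 3}. tline c j * pev (tline c) (A j))"
      by (rule sum.mono_neutral_right) (use n in \<open>auto simp: tline_def\<close>)
    finally show ?thesis by simp
  qed
  define q where "q = pev spine (A 2) + [:0, 1:] * pev spine (A 3)"
  have q: "poly (pev (tline c) (A 2) + smult c (pev (tline c) (A 3))) 0 = poly q c" for c
    by (simp add: q_def tline_meets_spine)
  have roots: "a ` {..<k} \<subseteq> {x. poly q x = 0}"
  proof clarify
    fix i assume "i < k"
    then have "res (Some i) f = 0" using C_form[OF f(1)] f(2) by simp
    then have "pev (tline (a i)) f = 0" by (simp add: res_def)
    then show "poly q (a i) = 0" using tl[of "a i"] q[of "a i"] by simp
  qed
  have "q = 0"
  proof (rule ccontr)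
    assume "q \<noteq> 0"
    have "card (a ` {..<k}) \<le> card {x. poly q x = 0}"
      using roots poly_roots_finite[OF \<open>q \<noteq> 0\<close>] by (intro card_mono)
    also have "\<dots> \<le> degree q" using card_poly_roots_bound[OF \<open>q \<noteq> 0\<close>] .
    finally have "k \<le> degree q" using card_image[OF inj] by simp
    moreover have "degree q \<le> max 1 d"
      unfolding q_def using A(1)[of 2] A(1)[of 3]
      by (intro degree_add_le) (auto intro: order.trans)
    ultimately show False using d k by linarith
  qed
  then have "poly (pev (tline b) (A 2) + smult b (pev (tline b) (A 3))) 0 = 0" using q by simp
  then obtain p where "pev (tline b) (A 2) + smult b (pev (tline b) (A 3)) = pCons 0 p"
    by (cases "pev (tline b) (A 2) + smult b (pev (tline b) (A 3))") simp
  then have "pev (tline b) f = [:0, 0, 1:] * p" using tl[of b] by simp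
  then show ?thesis by (rule dvdI)
qed

text \<open>
  Forms of lower degree in the ideal have a double zero on a further line \<open>tline b\<close>, but the product
  of \<open>mu\<close> for one line with \<open>lam\<close> for the others has only a simple zero there. Hence the ideal needs a
  generator of degree \<open>k\<close>.
\<close>

lemma not_regular_C:
  assumes "regular n [0] (single 0 ` C) r"
  shows "int k \<le> r"
proof (rule ccontr)
  assume r: "\<not> int k \<le> r"
  let ?M = "single 0 ` C :: 'k mvec set"
  let ?G = "{v \<in> ?M. \<exists>D\<le>r. homogeneous_vec [0] D v}"
  from assms obtain as gs where as: "as 0 = [0]"
    and res: "\<forall>i. generated_in_degrees_le n (as i) (syzygy_module n ?M gs i) (r + int i)"
    unfolding regular_def by (elim exE conjE)
  have gen: "is_submodule n hull ?G = ?M"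
    using res[THEN spec, of 0] as by (simp add: generated_in_degrees_le_def)
  have "finite (a ` {..<k})" by simp
  then obtain b where b: "b \<notin> a ` {..<k}" using infinite_alg_closed ex_new_if_finite by blast
  define U :: "'k mvec set" where "U = {v. [:0, 0, 1:] dvd pev (tline b) (coef v 0)}"
  have U: "is_submodule n U"
    by (auto simp: is_submodule_def U_def lookup_add)
  have "?G \<subseteq> U"
  proof
    fix v assume "v \<in> ?G"
    then obtain f D where f: "f \<in> C" "v = single 0 f" "D \<le> r" "homogeneous_vec [0] D v"
      by blast
    show "v \<in> U"
    proof (cases "0 \<le> D")
      case True
      then have "homogeneous_poly (nat D) f" using f(2,4) by (auto simp: homogeneous_vec_iff)
      then have "f \<in> forms n (nat D)" using f(1) by (simp add: forms_def C_def)
      moreover have "nat D < k" using f(3) r True by linarith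
      ultimately show ?thesis using low_degree_tangent f(1,2) by (simp add: U_def)
    next
      case False
      then have "f = 0" using f(2,4) by (auto simp: homogeneous_vec_iff)
      then show ?thesis using f(2) by (simp add: U_def)
    qed
  qed
  then have MU: "?M \<subseteq> U" using hull_subset_submodule[OF U] gen by blast
  define g where "g = mu (a 0) * (\<Prod>i\<in>{1..<k}. lam (a i))"
  have prod_form: "(\<Prod>i\<in>A. lam (a i)) \<in> forms n (card A)" if "finite A" for A
    using that
  proof (induction A rule: finite_induct)
    case empty
    show ?case using forms_const[of 1 n] by simp
  next
    case (insert x A)
    then show ?case using forms_mult[OF lam_mu_forms(1)[OF n]] by fastforce
  qed
  have gform: "g \<in> forms n (1 + card {1..<k})"
    unfolding g_def by (intro forms_mult lam_mu_forms n prod_form) simp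
  have "res M g = 0" if "M \<in> comps" for M
  proof (cases M)
    case None
    then show ?thesis by (simp add: g_def) (simp add: res_def lam_mu_eval)
  next
    case (Some i)
    show ?thesis
    proof (cases "i = 0")
      case True
      then show ?thesis using Some by (simp add: g_def) (simp add: res_def lam_mu_eval)
    next
      case False
      then have "(\<Prod>j\<in>{1..<k}. res M (lam (a j))) = 0"
        using that Some by (intro prod_zero) (auto simp: res_def lam_mu_eval intro!: bexI[of _ i])
      then show ?thesis by (simp add: g_def res_prod)
    qed
  qed
  then have "g \<in> C" using C_form[OF gform] by blast
  then have "single 0 g \<in> U" using MU by blast
  then have "[:0, 0, 1:] dvd pev (tline b) g" by (simp add: U_def)
  moreover have "pev (tline b) g = [:0, 1:] * (smult (b - a 0) (\<Prod>i\<in>{1..<k}. [:b - a i, b ^ 3 - a i ^ 3:]))"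
    by (simp add: g_def lam_mu_eval pc.ev_prod)
  moreover have "[:0, 0, 1:] = [:0, 1:] * [:0, 1 :: 'k:]" by simp
  ultimately have "[:0, 1:] dvd smult (b - a 0) (\<Prod>i\<in>{1..<k}. [:b - a i, b ^ 3 - a i ^ 3:])"
    by (simp only: dvd_mult_cancel_left) simp
  then obtain p where "smult (b - a 0) (\<Prod>i\<in>{1..<k}. [:b - a i, b ^ 3 - a i ^ 3:]) = [:0, 1:] * p"
    by (elim dvdE)
  from arg_cong[OF this, of "\<lambda>p. poly p 0"]
  have "poly (smult (b - a 0) (\<Prod>i\<in>{1..<k}. [:b - a i, b ^ 3 - a i ^ 3:])) 0 = 0"
    by (simp only: poly_mult) simp
  then have "(b - a 0) * (\<Prod>i\<in>{1..<k}. b - a i) = 0" by (simp add: poly_prod)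
  then show False using b k by auto
qed

theorem scheme_reg_C: "scheme_reg n C = ereal (real k)"
  unfolding scheme_reg_def regularity_def
proof (rule antisym)
  have "(INF r\<in>{r. regular n [0] (single 0 ` C) r}. ereal (of_int r)) \<le> ereal (of_int (int k))"
    using regular_C by (intro INF_lower) simp
  then show "(INF r\<in>{r. regular n [0] (single 0 ` C) r}. ereal (of_int r)) \<le> ereal (real k)"
    by simp
  show "ereal (real k) \<le> (INF r\<in>{r. regular n [0] (single 0 ` C) r}. ereal (of_int r))"
  proof (rule INF_greatest)
    fix r assume "r \<in> {r. regular n [0] (single 0 ` C) r}"
    then have "int k \<le> r" using not_regular_C by simp
    then show "ereal (real k) \<le> ereal (of_int r)" by (simp add: of_nat_le_iff[symmetric, where 'a=int])
  qed
qed

end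

context tangent_lines
begin

section \<open>Regularity of finite sections\<close>

text \<open>
  Three of the other lines are absorbed by a quadric through the spine, which costs one degree less
  than three linear forms but leaves a double zero at the node.
\<close>

lemma double_on_line:
  assumes i: "i < k" and v: "degree v \<le> k - 4"
  shows "\<exists>f\<in>forms n (k - 2). res (Some i) f = pCons 0 (pCons 0 v) \<and>
    (\<forall>M\<in>comps - {Some i}. res M f = 0)"
proof -
  have "3 \<le> card ({..<k} - {i})" using i k by simp
  then obtain T where T: "T \<subseteq> {..<k} - {i}" "card T = 3"
    using obtain_subset_with_card_n by metis
  then obtain p q r where pqr: "T = {p, q, r}" "p \<noteq> q" "p \<noteq> r" "q \<noteq> r"
    by (auto simp: card_3_iff)
  define E where "E = {..<k} - {i} - T"
  have "card E = k - 4" using T i by (simp add: E_def card_Diff_subset finite_subset)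
  define c where "c = (a i - a p) * (a i - a q) * (a i - a r)"
  have c: "c \<noteq> 0" using T pqr i a_eq_iff by (auto simp: c_def)
  have "degree (smult (1 / c) v) \<le> card E + 0" using v \<open>card E = k - 4\<close> c by simp
  then obtain g where g: "g \<in> forms n (card E + 0)" "\<forall>l\<in>E. res (Some l) g = 0"
    "res (Some i) g = smult (1 / c) v"
    using interpolate_line[of E i "smult (1 / c) v" 0] i by (auto simp: E_def)
  define f where "f = quadric (a p) (a q) (a r) * g"
  have "f \<in> forms n (2 + (card E + 0))"
    unfolding f_def using g(1) n by (intro forms_mult quadric_form)
  moreover have "2 + (card E + 0) = k - 2" using \<open>card E = k - 4\<close> k by simp
  ultimately have "f \<in> forms n (k - 2)" by metis
  moreover have "res (Some i) f = pCons 0 (pCons 0 v)"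
    using g(3) c by (simp add: f_def) (simp add: res_def quadric_eval c_def)
  moreover have "res M f = 0" if M: "M \<in> comps - {Some i}" for M
  proof (cases M)
    case None
    then show ?thesis by (simp add: f_def) (simp add: res_def quadric_eval)
  next
    case (Some j)
    then consider "j \<in> E" | "j \<in> {p, q, r}" using M pqr(1) by (auto simp: E_def)
    then show ?thesis
      using g(2) Some by cases (auto simp: f_def res_def quadric_eval)
  qed
  ultimately show ?thesis by blast
qed

text \<open>
  In degree \<open>k - 2\<close> the forms miss one dimension of the sections, and multiples of \<open>w\<close> fill it. On a
  line \<open>i\<close> whose node lies outside the hyperplane, \<open>w\<close> is invertible at the node; after everything
  has been moved to line \<open>i\<close> by interpolation on the others, it removes the linear term there.
\<close>

lemma tuples_decompose:
  assumes w: "w \<in> forms n 1" "res None w \<noteq> 0" and F: "F \<in> tuples (k - 2)"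
  shows "\<exists>z\<in>forms n (k - 2). \<exists>Y\<in>tuples (k - 3). \<forall>M\<in>comps. F M = res M z + res M w * Y M"
proof -
  have "\<exists>i<k. poly (res None w) (a i) \<noteq> 0"
  proof (rule ccontr)
    assume "\<not> (\<exists>i<k. poly (res None w) (a i) \<noteq> 0)"
    then have "a ` {..<k} \<subseteq> {x. poly (res None w) x = 0}" by auto
    then have "card (a ` {..<k}) \<le> card {x. poly (res None w) x = 0}"
      using poly_roots_finite[OF w(2)] by (intro card_mono)
    also have "\<dots> \<le> degree (res None w)" using card_poly_roots_bound[OF w(2)] .
    also have "\<dots> \<le> 1" using degree_res[OF w(1)] .
    finally show False using card_image[OF inj] k by simp
  qed
  then obtain i where i: "i < k" "poly (res (Some i) w) 0 \<noteq> 0" by (auto simp: res_glue)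
  let ?I = "{..<k} - {i}"
  have "Suc (k - 2) \<ge> card ?I" using i by simp
  then obtain f1 where f1: "f1 \<in> forms n (k - 2)" "\<forall>M\<in>insert None (Some ` ?I). res M f1 = F M"
    using lift_lines[of ?I "k - 2" F] F by auto
  have f1N: "res None f1 = F None" using f1(2) by simp
  define r where "r = F (Some i) - res (Some i) f1"
  have r: "degree r \<le> k - 2" "poly r 0 = 0"
    using F i degree_res[OF f1(1)] f1N by (auto simp: r_def tuples_def res_glue intro!: degree_diff_le)
  define c where "c = coeff r 1 / poly (res (Some i) w) 0"
  define s where "s = r - res (Some i) w * [:0, c:]"
  have "degree (res (Some i) w * [:0, c:]) \<le> 1 + 1"
    using degree_res[OF w(1), of "Some i"] by (intro order.trans[OF degree_mult_le] add_mono) auto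
  then have ds: "degree s \<le> k - 2" using r(1) k unfolding s_def by (intro degree_diff_le) auto
  have s0: "coeff s 0 = 0" using r(2) by (simp add: s_def poly_0_coeff_0)
  have s1: "coeff s 1 = 0" using i(2) by (simp add: s_def c_def poly_0_coeff_0)
  obtain v where v: "s = pCons 0 (pCons 0 v)"
  proof -
    obtain x s' where "s = pCons x s'" by (cases s)
    moreover obtain y v where "s' = pCons y v" by (cases s')
    ultimately show ?thesis using that s0 s1 by simp
  qed
  have "degree v \<le> k - 4" using ds v by (cases "v = 0") auto
  then obtain f2 where f2: "f2 \<in> forms n (k - 2)" "res (Some i) f2 = s"
    "\<forall>M\<in>comps - {Some i}. res M f2 = 0"
    using double_on_line[OF i(1)] v by metis
  define Y where "Y = (\<lambda>M. if M = Some i then [:0, c:] else 0)"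
  have "Y \<in> tuples (k - 3)" using k by (auto simp: tuples_def Y_def)
  moreover have "f1 + f2 \<in> forms n (k - 2)" using f1(1) f2(1) by (rule forms_add)
  moreover have "F M = res M (f1 + f2) + res M w * Y M" if "M \<in> comps" for M
  proof (cases "M = Some i")
    case True
    then show ?thesis using f2(2) by (simp add: Y_def r_def s_def)
  next
    case False
    then have "res M f1 = F M" using f1(2) that by (cases M) auto
    then show ?thesis using False f2(3) that by (simp add: Y_def)
  qed
  ultimately show ?thesis by blast
qed

lemma ex_not_root:
  assumes "finite A" "\<And>p. p \<in> A \<Longrightarrow> p \<noteq> (0 :: 'k poly)"
  shows "\<exists>t. \<forall>p\<in>A. poly p t \<noteq> 0"
proof -
  have "finite (\<Union>p\<in>A. {x. poly p x = 0})" using assms poly_roots_finite by blast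
  then obtain t where "t \<notin> (\<Union>p\<in>A. {x. poly p x = 0})"
    using infinite_alg_closed ex_new_if_finite by blast
  then show ?thesis by blast
qed

text \<open>A vector space over an infinite field is not a finite union of proper subspaces.\<close>

lemma common_nonvanishing:
  assumes add: "\<And>f g c. f \<in> V \<Longrightarrow> g \<in> V \<Longrightarrow> f + const c * g \<in> V" and zero: "0 \<in> V"
    and ne: "\<And>M. M \<in> comps \<Longrightarrow> \<exists>w\<in>V. res M w \<noteq> 0"
  shows "\<exists>w\<in>V. \<forall>M\<in>comps. res M w \<noteq> 0"
proof -
  have "\<exists>w\<in>V. \<forall>M\<in>A. res M w \<noteq> 0" if "finite A" "A \<subseteq> comps" for A
    using that
  proof (induction A rule: finite_induct)
    case empty
    then show ?case using zero by blast
  next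
    case (insert N A)
    then obtain w where w: "w \<in> V" "\<forall>M\<in>A. res M w \<noteq> 0" by auto
    obtain u where u: "u \<in> V" "res N u \<noteq> 0" using ne insert.prems by auto
    have "\<exists>x. poly (res M w) x \<noteq> 0 \<or> poly (res M u) x \<noteq> 0" if "M \<in> insert N A" for M
    proof -
      have "res M w \<noteq> 0 \<or> res M u \<noteq> 0" using that w u by auto
      then have "finite {x. poly (res M w) x = 0} \<or> finite {x. poly (res M u) x = 0}"
        using poly_roots_finite by blast
      then show ?thesis using infinite_alg_closed ex_new_if_finite
        by (metis (mono_tags, lifting) mem_Collect_eq)
    qed
    then obtain x where x: "\<And>M. M \<in> insert N A \<Longrightarrow>
        poly (res M w) (x M) \<noteq> 0 \<or> poly (res M u) (x M) \<noteq> 0" by metis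
    define P where "P = (\<lambda>M. [:poly (res M w) (x M), poly (res M u) (x M):]) ` insert N A"
    have "finite P" using insert.hyps by (simp add: P_def)
    moreover have "p \<noteq> 0" if "p \<in> P" for p using that x by (auto simp: P_def)
    ultimately obtain t where t: "\<forall>p\<in>P. poly p t \<noteq> 0" using ex_not_root by blast
    have "res M (w + const t * u) \<noteq> 0" if "M \<in> insert N A" for M
    proof -
      have "poly (res M (w + const t * u)) (x M) = poly [:poly (res M w) (x M), poly (res M u) (x M):] t"
        by simp
      also have "\<dots> \<noteq> 0" using t that by (auto simp: P_def)
      finally show ?thesis by (metis poly_0)
    qed
    then show ?case using add[OF w(1) u(1)] by blast
  qed
  then show ?thesis using finite_comps by blast
qed

text \<open>
  A form of degree \<open>k - 1\<close> is a combination of \<open>w\<close> and a general linear form \<open>l\<close> with sections as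
  coefficients. Modulo \<open>w\<close> the coefficient of \<open>l\<close> is a form, so the form lies in \<open>J + (l)\<close>. Powers of
  all variables then lie in \<open>J + (l)\<close>, and as \<open>J\<close> is saturated \<open>l\<close> is no zero divisor modulo \<open>J\<close>.
\<close>

lemma regular_section:
  assumes J: "closed_subscheme n J" and w: "w \<in> forms n 1" "\<And>M. M \<in> comps \<Longrightarrow> res M w \<noteq> 0"
    and mem: "\<And>c y. c \<in> C \<Longrightarrow> y \<in> poly_carrier n \<Longrightarrow> c + w * y \<in> J"
    and sat: "\<And>f. f \<in> poly_carrier n \<Longrightarrow> \<forall>j\<le>n. \<exists>c\<in>C. \<exists>y\<in>poly_carrier n. var j * f = c + w * y \<Longrightarrow> f \<in> J"
  shows "regular n [0] (single 0 ` J) (int (k - 1))"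
proof -
  have hJ: "homogeneous_ideal n J" and satJ: "saturation n J = J"
    using J by (auto simp: closed_subscheme_def)
  note Jd = homogeneous_idealD[OF hJ]
  define W where "W = (\<lambda>M. res M w)"
  define P where "P = (\<lambda>M. case M of None \<Rightarrow> [:- coeff (W M) 1, coeff (W M) 0:]
     | Some i \<Rightarrow> [:- coeff (W M) 1, coeff (W M) 0 * a i ^ 3 - coeff (W M) 1 * a i, coeff (W M) 0:])"
  have W: "W \<in> tuples 1" using res_tuples[OF w(1)] by (simp add: W_def)
  have ne: "P M \<noteq> 0" if "M \<in> comps" for M
  proof -
    have "W M = [:coeff (W M) 0, coeff (W M) 1:]"
      using W that by (intro degree_1_pCons) (auto simp: tuples_def)
    moreover have "W M \<noteq> 0" using w(2) that by (simp add: W_def)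
    ultimately have "coeff (W M) 0 \<noteq> 0 \<or> coeff (W M) 1 \<noteq> 0" by force
    then show ?thesis by (cases M) (auto simp: P_def)
  qed
  have "\<exists>t. \<forall>p\<in>P ` comps. poly p t \<noteq> 0"
    by (rule ex_not_root) (use finite_comps ne in auto)
  then obtain t where t: "\<forall>p\<in>P ` comps. poly p t \<noteq> 0" ..
  \<comment> \<open>The form \<open>x\<^sub>0 + t x\<^sub>1 + t\<^sup>2 x\<^sub>2\<close>; its determinant with \<open>w\<close> on the component \<open>M\<close> is \<open>P M\<close> at \<open>t\<close>.\<close>
  define cs where "cs = (\<lambda>j::nat. if j = 1 then t else if j = 2 then t ^ 2 else 0)"
  let ?l = "coord_seq n cs 0"
  have l: "?l \<in> forms n 1" by (rule coord_seq_form) simp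
  have lres: "res M ?l = 1 + smult t (param M 1) + smult (t ^ 2) (param M 2)" for M
  proof -
    have "(\<Sum>j=1..n. const (cs j) * var j :: 'k mpoly) = (\<Sum>j\<in>{1, 2}. const (cs j) * var j)"
      by (rule sum.mono_neutral_right) (use n in \<open>auto simp: cs_def\<close>)
    then show ?thesis by (simp add: coord_seq_def cs_def)
  qed
  have ind: "independent W (\<lambda>M. res M ?l)"
    unfolding independent_def
  proof
    fix M assume M: "M \<in> comps"
    then have "poly (P M) t \<noteq> 0" using t by blast
    then show "coeff (W M) 0 * coeff (res M ?l) 1 - coeff (W M) 1 * coeff (res M ?l) 0 \<noteq> 0"
      by (cases M) (simp_all add: P_def lres algebra_simps power2_eq_square)
  qed
  define e where "e = k - 3"
  have e: "k = Suc (Suc (Suc e))" "e \<ge> 1" using k by (auto simp: e_def)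
  have base: "\<exists>z\<in>poly_carrier n. f - ?l * z \<in> J" if f: "f \<in> forms n (Suc (Suc e))" for f
  proof -
    have "\<exists>X\<in>tuples (Suc e). \<exists>Z\<in>tuples (Suc e). \<forall>M\<in>comps. res M f = W M * X M + res M ?l * Z M"
      using res_tuples[OF f] res_tuples[OF l]
      by (intro tuples_combination[OF W _ ind]) auto
    then obtain X Z where XZ: "X \<in> tuples (Suc e)" "Z \<in> tuples (Suc e)"
      "\<forall>M\<in>comps. res M f = W M * X M + res M ?l * Z M" by blast
    have e': "k - 2 = Suc e" "k - 3 = e" using e by auto
    then have "Z \<in> tuples (k - 2)" using XZ(2) by metis
    from tuples_decompose[OF w(1) w(2)[OF comps_iff(1)] this]
    obtain z Y where z: "z \<in> forms n (Suc e)" and Y: "Y \<in> tuples e"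
      "\<forall>M\<in>comps. Z M = res M z + res M w * Y M" unfolding e' by blast
    define G where "G = (\<lambda>M. X M + res M ?l * Y M)"
    have G: "G \<in> tuples (Suc e)"
      using tuples_add[OF XZ(1)] tuples_mult[OF res_tuples[OF l] Y(1)] by (simp add: G_def)
    define g where "g = f - ?l * z"
    have g: "g \<in> forms n (Suc (Suc e))"
      using f forms_mult[OF l z] by (auto simp: g_def intro: forms_diff)
    have gG: "res M g = res M w * G M" if "M \<in> comps" for M
      using XZ(3) Y(2) that by (simp add: g_def G_def W_def algebra_simps)
    have "\<exists>c\<in>C. \<exists>y\<in>poly_carrier n. var j * g = c + w * y" if j: "j \<le> n" for j
    proof -
      have "(\<lambda>M. res M (var j) * G M) \<in> tuples (1 + Suc e)"
        by (intro tuples_mult G res_tuples forms_var j)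
      then obtain y where y: "y \<in> forms n (Suc (Suc e))" "\<forall>M\<in>comps. res M y = res M (var j) * G M"
        using lift_tuples[of "Suc (Suc e)" "\<lambda>M. res M (var j) * G M"] e by auto
      have fm: "var j * g - w * y \<in> forms n (Suc (Suc (Suc e)))"
        using forms_var_mult[OF j g] forms_mult[OF w(1) y(1)] by (auto intro: forms_diff)
      have "var j * g - w * y \<in> C"
        unfolding C_form[OF fm] using gG y(2) by (simp add: algebra_simps)
      then show ?thesis using y(1) forms_carrier
        by (intro bexI[of _ "var j * g - w * y"] bexI[of _ y]) auto
    qed
    then have "g \<in> J" using sat g forms_carrier by blast
    then show ?thesis using z forms_carrier by (auto simp: g_def)
  qed
  have gen: "\<exists>z\<in>poly_carrier n. f - ?l * z \<in> J" if "f \<in> forms n d" "d \<ge> Suc (Suc e)" for d f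
    using that(2,1)
  proof (induction d arbitrary: f rule: dec_induct)
    case base
    then show ?case using \<open>\<And>f. f \<in> forms n (Suc (Suc e)) \<Longrightarrow> _\<close> by blast
  next
    case (step d)
    obtain A where A: "\<forall>j\<le>n. A j \<in> forms n d" "f = (\<Sum>j\<le>n. var j * A j)"
      using forms_decompose[OF step.prems] by blast
    then have "\<forall>j. \<exists>z. j \<le> n \<longrightarrow> z \<in> poly_carrier n \<and> A j - ?l * z \<in> J" using step.IH by blast
    then obtain z where z: "\<And>j. j \<le> n \<Longrightarrow> z j \<in> poly_carrier n \<and> A j - ?l * z j \<in> J" by metis
    have "f - ?l * (\<Sum>j\<le>n. var j * z j) = (\<Sum>j\<le>n. var j * (A j - ?l * z j))"
      by (simp add: A(2) sum_distrib_left sum_subtractf algebra_simps)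
    also have "\<dots> \<in> J"
    proof -
      have "(\<Sum>j\<in>B. var j * (A j - ?l * z j)) \<in> J" if "B \<subseteq> {..n}" for B
        using finite_subset[OF that finite_atMost] that
        by (induction B rule: finite_induct) (use z in \<open>auto intro!: Jd(2-4) carrier_var\<close>)
      then show ?thesis by blast
    qed
    finally show ?case using z
      by (intro bexI[of _ "\<Sum>j\<le>n. var j * z j"]) (auto intro!: carrier_sum poly_carrier_mult)
  qed
  have k1: "k - 1 = Suc (Suc e)" using e by simp
  show ?thesis
    unfolding k1
  proof (rule regular_criterion[OF hJ, where c = cs], goal_cases)
    case (3 d f)
    have f: "f \<in> poly_carrier n" using 3(2) forms_carrier by blast
    have "var i ^ Suc (Suc e) * f \<in> J" if i: "i \<le> n" for i
    proof -
      have vi: "var i ^ Suc (Suc e) \<in> forms n (Suc (Suc e))" using i by (intro forms_power forms_var)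
      obtain z where z: "z \<in> poly_carrier n" "var i ^ Suc (Suc e) - ?l * z \<in> J"
        using base[OF vi] by blast
      have "f * (var i ^ Suc (Suc e) - ?l * z) + z * (?l * f) \<in> J"
        by (rule Jd(3)[OF Jd(4)[OF f z(2)] Jd(4)[OF z(1) 3(3)]])
      then show ?thesis by (simp add: algebra_simps)
    qed
    then have "f \<in> saturation n J" using f unfolding saturation_def by blast
    then show ?case using satJ by simp
  next
    case (4 d f s)
    then show ?case using gen by blast
  next
    case (5 d f)
    then obtain z where "z \<in> poly_carrier n" "f - ?l * z \<in> J" using gen by blast
    then show ?case by (intro bexI[of _ z] bexI[of _ 0]) auto
  qed (use n in auto)
qed

text \<open>
  If no hyperplane through \<open>L\<close> met some component properly, \<open>L\<close> would contain that component and
  the intersection would have infinitely many points. So a suitable \<open>w\<close> exists, whatever the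
  dimension of \<open>L\<close>.
\<close>

theorem scheme_reg_secant:
  assumes L: "linear_subspace n L" and fin: "finite_subscheme n (scheme_inter n C L)"
  shows "scheme_reg n (scheme_inter n C L) \<le> ereal (real (k - 1))"
proof -
  let ?R = "poly_ring n :: 'k mpoly ring"
  let ?J = "scheme_inter n C L"
  interpret R: cring ?R by (rule cring_poly_ring)
  obtain W where W: "W \<subseteq> forms n 1" "L = saturation n (Idl\<^bsub>?R\<^esub> W)"
    using L by (auto simp: linear_subspace_def)
  define I where "I = Idl\<^bsub>?R\<^esub> W"
  have Wc: "W \<subseteq> carrier ?R" using W(1) forms_carrier by (auto simp: poly_ring_def)
  have "ideal I ?R" unfolding I_def using R.genideal_ideal[OF Wc] .
  then have I: "I \<subseteq> poly_carrier n" "0 \<in> I" "\<And>f g. f \<in> I \<Longrightarrow> g \<in> I \<Longrightarrow> f + g \<in> I"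
    "\<And>f g. f \<in> poly_carrier n \<Longrightarrow> g \<in> I \<Longrightarrow> f * g \<in> I"
    unfolding ideal_iff by auto
  have WI: "W \<subseteq> I" unfolding I_def using R.genideal_self[OF Wc] .
  have IL: "I \<subseteq> L"
  proof
    fix f assume f: "f \<in> I"
    then have "\<forall>i\<le>n. \<exists>k. var i ^ k * f \<in> I" by (intro allI impI exI[of _ 0]) simp
    then show "f \<in> L" using I(1) f by (auto simp: W(2) saturation_def I_def)
  qed
  have sum_iff: "f \<in> C <+>\<^bsub>?R\<^esub> L \<longleftrightarrow> (\<exists>c\<in>C. \<exists>g\<in>L. f = c + g)" for f
    by (auto simp: set_add_def' poly_ring_def)
  have CLc: "c + g \<in> poly_carrier n" if "c \<in> C" "g \<in> L" for c g
    using that by (auto simp: C_def W(2) saturation_def intro: poly_carrier_add)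
  have closed: "closed_subscheme n ?J" using fin by (simp add: finite_subscheme_def)
  have "\<exists>w\<in>I \<inter> forms n 1. res M w \<noteq> 0" if M: "M \<in> comps" for M
  proof (rule ccontr)
    let ?V = "line_ideal M"
    note V = homogeneous_idealD[OF homogeneous_ideal_vanishing[of n "param M"]]
    assume "\<not> (\<exists>w\<in>I \<inter> forms n 1. res M w \<noteq> 0)"
    then have "W \<subseteq> ?V" using W(1) WI vanishing_form by (fastforce simp: res_def)
    then have "I \<subseteq> ?V"
      unfolding I_def using homogeneous_ideal_vanishing
      by (intro R.genideal_minimal) (auto simp: homogeneous_ideal_def)
    have v0: "var 0 ^ e \<in> poly_carrier n - ?V" for e
      using vanishing_power[of "var 0" n e "param M"] var_vanishing_iff[of 0 n "param M"]
      by (auto intro: carrier_power)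
    have strip: "f \<in> ?V" if "f \<in> poly_carrier n" "var 0 ^ e * f \<in> ?V" for f e
      using vanishing_prime[of "var 0 ^ e" n f] v0[of e] that by blast
    have sat: "saturation n K \<subseteq> ?V" if "K \<subseteq> ?V" for K
    proof
      fix f assume "f \<in> saturation n K"
      then obtain e where "f \<in> poly_carrier n" "var 0 ^ e * f \<in> K" unfolding saturation_def by blast
      then show "f \<in> ?V" using strip \<open>K \<subseteq> ?V\<close> by blast
    qed
    then have "L \<subseteq> ?V" using \<open>I \<subseteq> ?V\<close> by (simp add: W(2) I_def)
    moreover have "C \<subseteq> ?V" using M by (auto simp: C_def)
    ultimately have "C <+>\<^bsub>?R\<^esub> L \<subseteq> ?V" using V(3) unfolding subset_iff sum_iff by blast
    then have "?J \<subseteq> ?V" unfolding scheme_inter_def by (rule sat)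
    then have "{P \<in> Proj n. ?V \<subseteq> P} \<subseteq> topspace (underlying_space n ?J)"
      by (auto simp: topspace_underlying)
    moreover have "infinite {P \<in> Proj n. ?V \<subseteq> P}"
    proof (cases M)
      case None
      then show ?thesis using infinite_line_points[of spine 1 n] n by simp
    next
      case (Some i)
      then show ?thesis using infinite_line_points[of "tline (a i)" 2 n] n by simp
    qed
    ultimately show False using fin finite_subset by (auto simp: finite_subscheme_def)
  qed
  then have "\<exists>w\<in>I \<inter> forms n 1. \<forall>M\<in>comps. res M w \<noteq> 0"
    using I by (intro common_nonvanishing) (auto intro: forms_add forms_const_mult)
  then obtain w where w: "w \<in> I" "w \<in> forms n 1" "\<And>M. M \<in> comps \<Longrightarrow> res M w \<noteq> 0" by blast
  have wy: "c + w * y \<in> C <+>\<^bsub>?R\<^esub> L" if "c \<in> C" "y \<in> poly_carrier n" for c y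
    using that I(4)[OF that(2) w(1)] IL by (auto simp: sum_iff mult.commute)
  have "regular n [0] (single 0 ` ?J) (int (k - 1))"
  proof (rule regular_section[OF closed w(2,3)])
    fix c y :: "'k mpoly" assume cy: "c \<in> C" "y \<in> poly_carrier n"
    then obtain c' g where "c' \<in> C" "g \<in> L" "c + w * y = c' + g" using wy sum_iff by blast
    then have "c + w * y \<in> poly_carrier n" using CLc by metis
    moreover have "\<forall>i\<le>n. \<exists>e. var i ^ e * (c + w * y) \<in> C <+>\<^bsub>?R\<^esub> L"
      using wy[OF cy] by (intro allI impI exI[of _ 0]) simp
    ultimately show "c + w * y \<in> ?J" by (simp add: scheme_inter_def saturation_def)
  next
    fix f :: "'k mpoly" assume f: "f \<in> poly_carrier n"
      and m: "\<forall>j\<le>n. \<exists>c\<in>C. \<exists>y\<in>poly_carrier n. var j * f = c + w * y"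
    have "\<exists>e. var j ^ e * f \<in> C <+>\<^bsub>?R\<^esub> L" if "j \<le> n" for j
      using m that wy by (intro exI[of _ 1]) fastforce
    then show "f \<in> ?J" using f by (simp add: scheme_inter_def saturation_def)
  qed
  then have "scheme_reg n ?J \<le> ereal (of_int (int (k - 1)))"
    unfolding scheme_reg_def regularity_def by (intro INF_lower) simp
  then show ?thesis by simp
qed

end

section \<open>The Zariski topology\<close>

lemma ProjD:
  assumes "P \<in> Proj n"
  shows "homogeneous_ideal n P" "1 \<notin> P" "\<exists>i\<le>n. var i \<notin> P"
    "f \<in> poly_carrier n \<Longrightarrow> g \<in> poly_carrier n \<Longrightarrow> f * g \<in> P \<Longrightarrow> f \<in> P \<or> g \<in> P"
proof -
  have "primeideal P (poly_ring n)" using assms by (simp add: Proj_def)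
  then interpret primeideal P "poly_ring n" .
  show "homogeneous_ideal n P" "\<exists>i\<le>n. var i \<notin> P" using assms by (auto simp: Proj_def)
  show "1 \<notin> P" using one_imp_carrier I_notcarr by (auto simp: poly_ring_def)
  show "f \<in> P \<or> g \<in> P" if "f \<in> poly_carrier n" "g \<in> poly_carrier n" "f * g \<in> P"
    using that I_prime[of f g] by (simp add: poly_ring_def)
qed

lemma zariski_nbhd:
  fixes U :: "'k::field mpoly set set"
  assumes "openin (zariski n) U" "P \<in> U"
  shows "\<exists>d. \<exists>f\<in>forms n d. f \<notin> P \<and> {Q \<in> Proj n. f \<notin> Q} \<subseteq> U"
proof -
  have "generate_topology_on {{P \<in> Proj n. f \<notin> P} | f. \<exists>d. f \<in> forms n d} U"
    using assms(1) openin_topology_generated_by unfolding zariski_def by blast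
  then show ?thesis using assms(2)
  proof (induction U)
    case (Int U V)
    then obtain d e and f g :: "'k mpoly" where f: "f \<in> forms n d" "f \<notin> P" "{Q \<in> Proj n. f \<notin> Q} \<subseteq> U"
      and g: "g \<in> forms n e" "g \<notin> P" "{Q \<in> Proj n. g \<notin> Q} \<subseteq> V" by blast
    have "P \<in> Proj n"
      using Int.prems Int.hyps(1) openin_topology_generated_by_iff
        openin_subset[of "zariski n" U] topspace_zariski unfolding zariski_def by blast
    then have "f * g \<notin> P" using ProjD(4)[of P n f g] f g forms_carrier by blast
    moreover have "{Q \<in> Proj n. f * g \<notin> Q} \<subseteq> U \<inter> V"
    proof
      fix Q assume "Q \<in> {Q \<in> Proj n. f * g \<notin> Q}"
      then have Q: "Q \<in> Proj n" "f * g \<notin> Q" by auto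
      note I = homogeneous_idealD(4)[OF ProjD(1)[OF Q(1)]]
      have "f \<notin> Q" using Q(2) I[of g f] forms_carrier[OF g(1)] by (auto simp: mult.commute)
      moreover have "g \<notin> Q" using Q(2) I[of f g] forms_carrier[OF f(1)] by auto
      ultimately show "Q \<in> U \<inter> V" using f(3) g(3) Q(1) by blast
    qed
    ultimately show ?case using forms_mult[OF f(1) g(1)] by blast
  next
    case (UN K)
    then obtain V where V: "V \<in> K" "P \<in> V" by blast
    from UN.IH[OF V] V(1) show ?case by blast
  qed auto
qed

lemma zariski_open_downward:
  assumes "openin (zariski n) U" "Q \<in> U" "P \<in> Proj n" "P \<subseteq> Q"
  shows "P \<in> U"
proof -
  obtain d f where "f \<notin> Q" "{Q \<in> Proj n. f \<notin> Q} \<subseteq> U"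
    using zariski_nbhd[OF assms(1,2)] by blast
  then show ?thesis using assms(3,4) by blast
qed

lemma closedin_zariski_form: "f \<in> forms n d \<Longrightarrow> closedin (zariski n) {Q \<in> Proj n. f \<in> Q}"
proof -
  assume f: "f \<in> forms n d"
  then have "openin (zariski n) {P \<in> Proj n. f \<notin> P}"
    unfolding zariski_def openin_topology_generated_by_iff
    by (intro generate_topology_on.Basis) blast
  moreover have "topspace (zariski n) - {Q \<in> Proj n. f \<in> Q} = {P \<in> Proj n. f \<notin> P}"
    by (auto simp: topspace_zariski)
  ultimately show ?thesis by (simp add: closedin_def topspace_zariski)
qed

lemma subset_homogeneous:
  assumes I: "homogeneous_ideal n I" and J: "homogeneous_ideal n J"
    and forms: "\<And>d f. f \<in> forms n d \<Longrightarrow> f \<in> I \<Longrightarrow> f \<in> J"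
  shows "I \<subseteq> J"
proof
  fix f assume f: "f \<in> I"
  obtain N where N: "\<forall>d\<ge>N. hom_component d f = 0" using ex_degree_bound by blast
  have "hom_component d f \<in> J" for d
    using forms[OF hom_component_forms] homogeneous_idealD(1,5)[OF I f] by blast
  then have "(\<Sum>d<M. hom_component d f) \<in> J" for M
    by (induction M) (auto intro: homogeneous_idealD(2,3)[OF J])
  then show "f \<in> J" using sum_hom_components[OF N] by metis
qed

lemma closedin_zariski_ideal:
  assumes "homogeneous_ideal n I"
  shows "closedin (zariski n) {Q \<in> Proj n. I \<subseteq> Q}"
proof -
  let ?F = "{f \<in> I. \<exists>d. f \<in> forms n d}"
  have eq: "{Q \<in> Proj n. I \<subseteq> Q} = (\<Inter>f\<in>?F. {Q \<in> Proj n. f \<in> Q})"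
  proof
    show "(\<Inter>f\<in>?F. {Q \<in> Proj n. f \<in> Q}) \<subseteq> {Q \<in> Proj n. I \<subseteq> Q}"
    proof
      fix Q assume Q: "Q \<in> (\<Inter>f\<in>?F. {Q \<in> Proj n. f \<in> Q})"
      moreover have "0 \<in> ?F" using homogeneous_idealD(2)[OF assms] forms_0 by blast
      ultimately have "Q \<in> Proj n" by blast
      moreover have "I \<subseteq> Q"
        by (rule subset_homogeneous[OF assms ProjD(1)[OF \<open>Q \<in> Proj n\<close>]]) (use Q in blast)
      ultimately show "Q \<in> {Q \<in> Proj n. I \<subseteq> Q}" by blast
    qed
  qed blast
  have "?F \<noteq> {}" using homogeneous_idealD(2)[OF assms] forms_0 by blast
  then show ?thesis unfolding eq
    by (intro closedin_Inter) (use closedin_zariski_form in auto)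
qed

context tangent_lines
begin

abbreviation curve_space :: "'k mpoly set topology" where "curve_space \<equiv> underlying_space n C"

definition line_points :: "nat option \<Rightarrow> 'k mpoly set set" where
  "line_points M = {Q \<in> Proj n. line_ideal M \<subseteq> Q}"

lemma C_subset: "M \<in> comps \<Longrightarrow> C \<subseteq> line_ideal M"
  by (auto simp: C_def)

lemma generic_point: "line_ideal M \<in> line_points M"
  using vanishing_Proj[of 0 n "param M"] by (simp add: line_points_def)

lemma topspace_curve: "topspace curve_space = (\<Union>M\<in>comps. line_points M)"
proof
  show "topspace curve_space \<subseteq> (\<Union>M\<in>comps. line_points M)"
  proof
    fix P assume "P \<in> topspace curve_space"
    then have P: "P \<in> Proj n" "C \<subseteq> P" by (auto simp: topspace_underlying)
    have "\<exists>f\<in>poly_carrier n. f \<notin> P \<and> (\<forall>M\<in>A. f \<in> line_ideal M)"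
      if "finite A" "\<And>M. M \<in> A \<Longrightarrow> \<not> line_ideal M \<subseteq> P" for A
      using that
    proof (induction A rule: finite_induct)
      case empty
      then show ?case using ProjD(2)[OF P(1)] by (intro bexI[of _ 1]) auto
    next
      case (insert M A)
      obtain f where f: "f \<in> poly_carrier n" "f \<notin> P" "\<forall>M\<in>A. f \<in> line_ideal M"
        using insert.IH insert.prems by blast
      obtain g where g: "g \<in> line_ideal M" "g \<notin> P" using insert.prems by blast
      note V = homogeneous_idealD[OF homogeneous_ideal_vanishing[of n "param _"]]
      have gc: "g \<in> poly_carrier n" using V(1)[OF g(1)] .
      have "f * g \<in> line_ideal N" if "N \<in> insert M A" for N
        using that f(3) g(1) V(4)[OF f(1), of g N] V(4)[OF gc, of f N] by (auto simp: mult.commute)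
      moreover have "f * g \<notin> P" using ProjD(4)[OF P(1) f(1) gc] f(2) g(2) by blast
      ultimately show ?case using poly_carrier_mult[OF f(1) gc] by blast
    qed
    from this[OF finite_comps] have "\<exists>M\<in>comps. line_ideal M \<subseteq> P"
      using P(2) by (auto simp: C_def)
    then show "P \<in> (\<Union>M\<in>comps. line_points M)" using P(1) by (auto simp: line_points_def)
  qed
  show "(\<Union>M\<in>comps. line_points M) \<subseteq> topspace curve_space"
    using C_subset by (fastforce simp: topspace_underlying line_points_def)
qed

lemma open_downward:
  assumes "openin curve_space U" "Q \<in> U" "P \<in> topspace curve_space" "P \<subseteq> Q"
  shows "P \<in> U"
proof -
  obtain V where V: "openin (zariski n) V" "U = V \<inter> {P. C \<subseteq> P}"
    using assms(1) unfolding underlying_space_def openin_subtopology by blast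
  then show ?thesis using zariski_open_downward[OF V(1), of Q P] assms by (auto simp: topspace_underlying)
qed

lemma closed_upward:
  assumes "closedin curve_space K" "P \<in> K" "Q \<in> topspace curve_space" "P \<subseteq> Q"
  shows "Q \<in> K"
proof (rule ccontr)
  assume "Q \<notin> K"
  then have "P \<in> topspace curve_space - K"
    using assms open_downward[of "topspace curve_space - K" Q P] closedin_subset[OF assms(1)]
    by (auto simp: closedin_def)
  then show False using assms(2) by blast
qed

lemma closedin_line_points: "M \<in> comps \<Longrightarrow> closedin curve_space (line_points M)"
proof -
  assume M: "M \<in> comps"
  have "line_points M = line_points M \<inter> {P. C \<subseteq> P}" using C_subset[OF M] by (auto simp: line_points_def)
  moreover have "closedin (zariski n) (line_points M)"
    unfolding line_points_def by (rule closedin_zariski_ideal[OF homogeneous_ideal_vanishing])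
  ultimately show ?thesis unfolding underlying_space_def closedin_subtopology by blast
qed

lemma closedin_form: "f \<in> forms n d \<Longrightarrow> closedin curve_space {Q \<in> topspace curve_space. f \<in> Q}"
proof -
  assume "f \<in> forms n d"
  then have "closedin (zariski n) {Q \<in> Proj n. f \<in> Q}" by (rule closedin_zariski_form)
  moreover have "{Q \<in> topspace curve_space. f \<in> Q} = {Q \<in> Proj n. f \<in> Q} \<inter> {P. C \<subseteq> P}"
    by (auto simp: topspace_underlying)
  ultimately show ?thesis unfolding underlying_space_def closedin_subtopology by blast
qed

lemma line_points_subset: "M \<in> comps \<Longrightarrow> closedin curve_space K \<Longrightarrow> line_ideal M \<in> K \<Longrightarrow> line_points M \<subseteq> K"
  using closed_upward[of K "line_ideal M"] topspace_curve by (auto simp: line_points_def)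

lemma irreducible_line_points: "M \<in> comps \<Longrightarrow> irreducible_closed curve_space (line_points M)"
  unfolding irreducible_closed_def
  using closedin_line_points line_points_subset[of M] generic_point[of M] by blast

lemma irreducible_in_line:
  assumes "irreducible_closed curve_space A"
  shows "\<exists>M\<in>comps. A \<subseteq> line_points M"
proof -
  have "\<exists>M\<in>S. A \<subseteq> line_points M" if "finite S" "S \<subseteq> comps" "A \<subseteq> (\<Union>M\<in>S. line_points M)" for S
    using that
  proof (induction S rule: finite_induct)
    case empty
    then show ?case using assms by (auto simp: irreducible_closed_def)
  next
    case (insert M S)
    have "closedin curve_space (\<Union>N\<in>S. line_points N)"
      using insert.hyps insert.prems closedin_line_points by (intro closedin_Union) auto
    moreover have "closedin curve_space (line_points M)" using insert.prems closedin_line_points by simp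
    moreover have "A \<subseteq> line_points M \<union> (\<Union>N\<in>S. line_points N)" using insert.prems by simp
    ultimately have "A \<subseteq> line_points M \<or> A \<subseteq> (\<Union>N\<in>S. line_points N)"
      using assms unfolding irreducible_closed_def by blast
    then show ?case using insert by auto
  qed
  moreover have "A \<subseteq> topspace curve_space" using assms closedin_subset by (auto simp: irreducible_closed_def)
  ultimately show ?thesis using finite_comps topspace_curve by auto
qed

definition pvar :: "nat option \<Rightarrow> nat" where "pvar M = (case M of None \<Rightarrow> 1 | Some i \<Rightarrow> 2)"

lemma param_pvar: "param M (pvar M) = [:0, 1:]"
  by (cases M) (simp_all add: pvar_def)

lemma pvar_le: "pvar M \<le> n" using n by (cases M) (simp_all add: pvar_def)

lemma res_bform: "degree p \<le> d \<Longrightarrow> res M (bform (pvar M) d p) = p"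
  unfolding res_def by (rule pev_bform) (simp_all add: param_pvar)

lemma bform_pvar_form: "bform (pvar M) d p \<in> forms n d"
  using bform_form pvar_le .

text \<open>The difference of two forms with the same restriction lies in the ideal of the line.\<close>

lemma line_points_cong:
  assumes "Q \<in> line_points M" "f \<in> forms n d" "g \<in> forms n d" "res M f = res M g"
  shows "f \<in> Q \<longleftrightarrow> g \<in> Q"
proof -
  have "f - g \<in> line_ideal M"
    using vanishing_form[OF forms_diff[OF assms(2,3)]] assms(4) by (simp add: res_def)
  then have d: "f - g \<in> Q" and Q: "homogeneous_ideal n Q"
    using assms(1) ProjD(1) by (auto simp: line_points_def)
  show ?thesis
    using homogeneous_idealD(3)[OF Q d, of g] homogeneous_ideal_diff[OF Q _ d, of f] by auto
qed

text \<open>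
  Modulo the ideal of the line and \<open>l\<close>, every form is a multiple of a power of one further variable
  \<open>y\<close>, and \<open>y \<in> Q\<close> would put all variables into \<open>Q\<close>.
\<close>

lemma line_point_unique_subset:
  assumes Q: "Q \<in> line_points M" and Q': "Q' \<in> line_points M"
    and l: "l \<in> forms n 1" "res M l \<noteq> 0" "l \<in> Q" "l \<in> Q'"
  shows "Q \<subseteq> Q'"
proof -
  let ?b = "pvar M"
  have P: "Q \<in> Proj n" "Q' \<in> Proj n" using Q Q' by (auto simp: line_points_def)
  note I = homogeneous_idealD[OF ProjD(1)[OF P(1)]]
  note I' = homogeneous_idealD[OF ProjD(1)[OF P(2)]]
  define p where "p = coeff (res M l) 0"
  define q where "q = coeff (res M l) 1"
  have rl: "res M l = [:p, q:]"
    unfolding p_def q_def using degree_res[OF l(1)] by (rule degree_1_pCons)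
  have v: "(var 0 :: 'k mpoly) \<in> forms n 1" "(var ?b :: 'k mpoly) \<in> forms n 1" using pvar_le by (auto intro: forms_var[simplified])
  have comb: "const x * var 0 + const y * var ?b \<in> forms n 1" for x y :: 'k
    using v by (intro forms_add forms_const_mult)
  have not_both: "\<not> (var 0 \<in> Q \<and> var ?b \<in> Q)"
  proof
    assume b: "var 0 \<in> Q \<and> var ?b \<in> Q"
    have "var j \<in> Q" if j: "j \<le> n" for j
    proof -
      let ?g = "const (coeff (param M j) 0) * var 0 + const (coeff (param M j) 1) * var ?b"
      have "?g \<in> Q" using b by (intro I(3) I(4)) auto
      moreover have "res M (var j) = res M ?g"
        using degree_1_pCons[OF degree_param[of M j]] by (simp add: param_pvar)
      ultimately show ?thesis using line_points_cong[OF Q forms_var[OF j] comb] by blast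
    qed
    then show False using ProjD(3)[OF P(1)] by blast
  qed
  have lQ: "const p * var 0 + const q * var ?b \<in> Q"
    using line_points_cong[OF Q l(1) comb, of p q] l(3) rl by (simp add: param_pvar)
  have unit: "f \<in> Q" if "const c * f \<in> Q" "c \<noteq> 0" for c f
  proof -
    have "const (inverse c) * (const c * f) \<in> Q" by (rule I(4)[OF carrier_const that(1)])
    then show ?thesis using that by (simp add: mult_single mult.assoc[symmetric])
  qed
  define y where "y = (if q \<noteq> 0 then 0 else ?b)"
  have yQ: "var y \<notin> Q"
  proof
    assume yQ: "var y \<in> Q"
    show False
    proof (cases "q = 0")
      case True
      then have "const p * var 0 \<in> Q" "p \<noteq> 0" using lQ l(2) rl by auto
      then show False using unit yQ True not_both by (simp add: y_def)
    next
      case False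
      then have "(const p * var 0 + const q * var ?b) - const p * var 0 \<in> Q"
        using lQ yQ by (intro homogeneous_ideal_diff[OF ProjD(1)[OF P(1)]] I(4)) (auto simp: y_def)
      then have "var ?b \<in> Q" using unit False by simp
      then show False using yQ False not_both by (simp add: y_def)
    qed
  qed
  have yf: "(var y :: 'k mpoly) \<in> forms n 1" using v by (simp add: y_def)
  have power: "c = 0" if "const c * var y ^ d \<in> Q" for c d
  proof (rule ccontr)
    assume "c \<noteq> 0"
    then have "var y ^ d \<in> Q" using unit that by blast
    then show False
    proof (induction d)
      case 0
      then show ?case using ProjD(2)[OF P(1)] by simp
    next
      case (Suc d)
      then show ?case using ProjD(4)[OF P(1), of "var y" "var y ^ d"] yQ
          forms_carrier[OF yf] by (auto intro: carrier_power)
    qed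
  qed
  have form: "f \<in> Q'" if f: "f \<in> forms n d" "f \<in> Q" for f d
  proof -
    have deg: "degree (res M f) \<le> d" using degree_res[OF f(1)] .
    have "\<exists>c s. res M f = [:c:] * param M y ^ d + res M l * s \<and> (s = 0 \<or> Suc (degree s) \<le> d)"
    proof (cases "q = 0")
      case True
      then have p: "p \<noteq> 0" using l(2) rl by auto
      define r where "r = res M f - monom (coeff (res M f) d) d"
      have "degree r \<le> d" unfolding r_def using deg by (intro degree_diff_le degree_monom_le)
      moreover have "coeff r d = 0" by (simp add: r_def)
      ultimately have "r = 0 \<or> Suc (degree r) \<le> d"
        by (metis Suc_leI leading_coeff_0_iff order_le_less)
      moreover have "res M f = [:coeff (res M f) d:] * param M y ^ d + res M l * smult (1 / p) r"
        using True p by (simp add: rl y_def param_pvar r_def monom_altdef)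
      ultimately show ?thesis using p
        by (intro exI[of _ "coeff (res M f) d"] exI[of _ "smult (1 / p) r"]) auto
    next
      case False
      define x where "x = - p / q"
      define s where "s = smult (1 / q) (synthetic_div (res M f) x)"
      have "res M f = [:poly (res M f) x:] + [:- x, 1:] * synthetic_div (res M f) x"
        using synthetic_div_correct'[of x "res M f"] by (metis add.commute)
      also have "[:- x, 1:] * synthetic_div (res M f) x = [:p, q:] * s"
      proof -
        have "[:p, q:] = smult q [:- x, 1:]" using False by (simp add: x_def)
        then show ?thesis using False by (simp only: s_def mult_smult_left mult_smult_right) simp
      qed
      finally have "res M f = [:poly (res M f) x:] * param M y ^ d + res M l * s"
        using False by (simp add: rl y_def)
      moreover have "s = 0 \<or> Suc (degree s) \<le> d"
      proof (cases "degree (res M f) = 0")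
        case True
        then show ?thesis by (auto simp: s_def synthetic_div_eq_0_iff)
      next
        case False
        then show ?thesis using deg \<open>q \<noteq> 0\<close> by (simp add: s_def degree_synthetic_div)
      qed
      ultimately show ?thesis by blast
    qed
    then obtain c s where cs: "res M f = [:c:] * param M y ^ d + res M l * s"
      "s = 0 \<or> Suc (degree s) \<le> d" by blast
    define g where "g = (if s = 0 then 0 else l * bform ?b (d - 1) s)"
    have "res M g = res M l * s" using cs(2) by (auto simp: g_def intro: res_bform)
    have gf: "g \<in> forms n d"
      using cs(2) forms_mult[OF l(1) bform_pvar_form[of M "d - 1" s]] by (auto simp: g_def)
    have cf: "const c * var y ^ d + g \<in> forms n d"
      using forms_const_mult[OF forms_power[OF yf]] gf by (rule forms_add)
    have e: "res M f = res M (const c * var y ^ d + g)"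
      using cs(1) \<open>res M g = _\<close> by (simp add: res_def)
    have gQ: "g \<in> Q" "g \<in> Q'"
      using I(4)[of "bform ?b (d - 1) s" l] I'(4)[of "bform ?b (d - 1) s" l] I(2) I'(2) l(3,4)
        forms_carrier[OF bform_pvar_form] by (auto simp: g_def mult.commute)
    have "const c * var y ^ d + g \<in> Q" using line_points_cong[OF Q f(1) cf e] f(2) by blast
    from homogeneous_ideal_diff[OF ProjD(1)[OF P(1)] this gQ(1)]
    have "c = 0" using power by simp
    then show ?thesis using line_points_cong[OF Q' f(1) cf e] gQ(2) by simp
  qed
  show ?thesis by (rule subset_homogeneous[OF ProjD(1)[OF P(1)] ProjD(1)[OF P(2)]]) (rule form)
qed

text \<open>
  Over an algebraically closed field the restriction of the form to the line splits into linear
  factors, and an irreducible set lies in the zero set of one of them.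
\<close>

lemma irreducible_linear:
  assumes A: "irreducible_closed curve_space A" "A \<subseteq> line_points M"
  shows "\<lbrakk>g \<in> forms n d; res M g \<noteq> 0; \<And>Q. Q \<in> A \<Longrightarrow> g \<in> Q\<rbrakk>
    \<Longrightarrow> \<exists>l\<in>forms n 1. res M l \<noteq> 0 \<and> (\<forall>Q\<in>A. l \<in> Q)"
proof (induction d arbitrary: g)
  case 0
  obtain Q where Q: "Q \<in> A" using A(1) by (auto simp: irreducible_closed_def)
  have "degree (res M g) = 0" using degree_res[OF 0(1)] by simp
  then obtain c where c: "res M g = [:c:]" using degree_eq_zeroE by blast
  have P: "Q \<in> Proj n" using Q A(2) by (auto simp: line_points_def)
  have "const c \<in> Q"
    using line_points_cong[OF _ 0(1) forms_const, of Q M c] Q A(2) 0(3) c by auto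
  then have "const (inverse c) * const c \<in> Q"
    using homogeneous_idealD(4)[OF ProjD(1)[OF P], of "const (inverse c)" "const c"] by simp
  then show ?case using ProjD(2)[OF P] 0(2) c by (simp add: mult_single)
next
  case (Suc d)
  let ?p = "res M g"
  have "\<exists>l\<in>forms n 1. \<exists>p'. res M l \<noteq> 0 \<and> res M l * p' = ?p \<and> degree p' \<le> d"
  proof (cases "degree ?p = 0")
    case True
    then show ?thesis by (intro bexI[of _ "var 0"] exI[of _ ?p]) (auto intro: forms_var[simplified])
  next
    case False
    then obtain x where x: "poly ?p x = 0" using alg_closed_imp_poly_has_root by blast
    then obtain p' where p': "?p = [:- x, 1:] * p'" by (metis poly_eq_0_iff_dvd dvdE)
    have "p' \<noteq> 0" using p' Suc.prems(2) by auto
    then have "degree ?p = Suc (degree p')" unfolding p' by (subst degree_mult_eq) auto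
    then have "degree p' \<le> d" using degree_res[OF Suc.prems(1), of M] by simp
    moreover have "var (pvar M) - const x * var 0 \<in> forms n 1"
      using pvar_le by (intro forms_diff forms_const_mult forms_var) auto
    moreover have "res M (var (pvar M) - const x * var 0) = [:- x, 1:]" by (simp add: param_pvar)
    ultimately show ?thesis using p' by (metis pCons_eq_0_iff one_neq_zero)
  qed
  then obtain l p' where l: "l \<in> forms n 1" "res M l \<noteq> 0" "res M l * p' = ?p" "degree p' \<le> d" by blast
  define g' where "g' = bform (pvar M) d p'"
  have g': "g' \<in> forms n d" "res M g' = p'" using l(4) by (simp_all add: g'_def bform_pvar_form res_bform)
  have lg: "l * g' \<in> forms n (Suc d)" using forms_mult[OF l(1) g'(1)] by simp
  have "A \<subseteq> {Q \<in> topspace curve_space. l \<in> Q} \<union> {Q \<in> topspace curve_space. g' \<in> Q}"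
  proof
    fix Q assume Q: "Q \<in> A"
    then have QM: "Q \<in> line_points M" using A(2) by blast
    then have "l * g' \<in> Q"
      using line_points_cong[OF QM lg Suc.prems(1)] Suc.prems(3)[OF Q] l(3) g'(2) by simp
    then have "l \<in> Q \<or> g' \<in> Q"
      using ProjD(4)[of Q n l g'] QM forms_carrier[OF l(1)] forms_carrier[OF g'(1)]
      by (auto simp: line_points_def)
    moreover have "Q \<in> topspace curve_space"
      using A(1) Q closedin_subset by (auto simp: irreducible_closed_def)
    ultimately show "Q \<in> {Q \<in> topspace curve_space. l \<in> Q} \<union> {Q \<in> topspace curve_space. g' \<in> Q}" by blast
  qed
  then have "A \<subseteq> {Q \<in> topspace curve_space. l \<in> Q} \<or> A \<subseteq> {Q \<in> topspace curve_space. g' \<in> Q}"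
    using A(1) closedin_form[OF l(1)] closedin_form[OF g'(1)] unfolding irreducible_closed_def by blast
  then show ?case
  proof
    assume "A \<subseteq> {Q \<in> topspace curve_space. l \<in> Q}"
    then show ?thesis using l by blast
  next
    assume "A \<subseteq> {Q \<in> topspace curve_space. g' \<in> Q}"
    then have "\<And>Q. Q \<in> A \<Longrightarrow> g' \<in> Q" by blast
    moreover have "res M g' \<noteq> 0" using g'(2) l(3) Suc.prems(2) by auto
    ultimately show ?thesis using Suc.IH[OF g'(1)] by blast
  qed
qed

lemma proper_irreducible_point:
  assumes A: "irreducible_closed curve_space A" "A \<subseteq> line_points M" "A \<noteq> line_points M" and M: "M \<in> comps"
    and Q: "Q \<in> A" "Q' \<in> A"
  shows "Q = Q'"
proof -
  have cl: "closedin curve_space A" using A(1) by (simp add: irreducible_closed_def)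
  obtain K where K: "closedin (zariski n) K" "A = K \<inter> {P. C \<subseteq> P}"
    using cl unfolding underlying_space_def closedin_subtopology by blast
  have "line_ideal M \<notin> A" using line_points_subset[OF M cl] A(2,3) by blast
  then have "line_ideal M \<in> Proj n - K"
    using K(2) C_subset[OF M] generic_point[of M] by (auto simp: line_points_def)
  moreover have "openin (zariski n) (Proj n - K)"
    using K(1) by (simp add: closedin_def topspace_zariski)
  ultimately obtain d f where f: "f \<in> forms n d" "f \<notin> line_ideal M"
    "{Q \<in> Proj n. f \<notin> Q} \<subseteq> Proj n - K" using zariski_nbhd by blast
  have "res M f \<noteq> 0" using f(2) vanishing_form[OF f(1)] by (simp add: res_def)
  moreover have "f \<in> Q" if "Q \<in> A" for Q
    using f(3) that K(2) A(2) by (auto simp: line_points_def)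
  ultimately obtain l where l: "l \<in> forms n 1" "res M l \<noteq> 0" "\<forall>Q\<in>A. l \<in> Q"
    using irreducible_linear[OF A(1,2) f(1)] by blast
  show ?thesis
    using line_point_unique_subset[of Q M Q' l] line_point_unique_subset[of Q' M Q l] Q A(2) l by blast
qed

definition closed_point :: "nat option \<Rightarrow> 'k \<Rightarrow> 'k mpoly set" where
  "closed_point M x = vanishing n (\<lambda>j. [:poly (param M j) x:])"

lemma closed_point_line: "closed_point M x \<in> line_points M"
  using vanishing_subset_point[of n "param M" x] vanishing_Proj[of 0 n "\<lambda>j. [:poly (param M j) x:]"]
  by (simp add: closed_point_def line_points_def)

lemma closed_point_node: "closed_point (Some i) 0 = closed_point None (a i)"
proof -
  have "(\<lambda>j. [:poly (tline (a i) j) 0:]) = (\<lambda>j. [:poly (spine j) (a i):])"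
    by (auto simp: fun_eq_iff tline_def spine_def)
  then show ?thesis by (simp add: closed_point_def)
qed

lemma irreducible_closed_point:
  assumes M: "M \<in> comps"
  shows "irreducible_closed curve_space {closed_point M x}"
proof -
  let ?l = "var (pvar M) - const x * var 0"
  have l: "?l \<in> forms n 1" using pvar_le by (intro forms_diff forms_const_mult forms_var) auto
  have rl: "res M ?l \<noteq> 0" by (simp add: param_pvar)
  have lp: "?l \<in> closed_point M x" unfolding closed_point_def vanishing_form[OF l] by (simp add: param_pvar)
  have eq: "{closed_point M x} = line_points M \<inter> {Q \<in> topspace curve_space. ?l \<in> Q}"
  proof
    show "{closed_point M x} \<subseteq> line_points M \<inter> {Q \<in> topspace curve_space. ?l \<in> Q}"
      using closed_point_line[of M x] lp M topspace_curve by auto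
    show "line_points M \<inter> {Q \<in> topspace curve_space. ?l \<in> Q} \<subseteq> {closed_point M x}"
    proof
      fix Q assume Q: "Q \<in> line_points M \<inter> {Q \<in> topspace curve_space. ?l \<in> Q}"
      then have "Q \<subseteq> closed_point M x" "closed_point M x \<subseteq> Q"
        using line_point_unique_subset[OF _ closed_point_line l rl _ lp, of Q]
          line_point_unique_subset[OF closed_point_line _ l rl lp, of Q] by auto
      then show "Q \<in> {closed_point M x}" by blast
    qed
  qed
  have "closedin curve_space {closed_point M x}"
    unfolding eq by (rule closedin_Int[OF closedin_line_points[OF M] closedin_form[OF l]])
  then show ?thesis by (auto simp: irreducible_closed_def)
qed

theorem krull_dim_C: "krull_dim curve_space = 1"
  unfolding krull_dim_def
proof (rule antisym)
  let ?D = "{d::nat. \<exists>A. (\<forall>i\<le>d. irreducible_closed curve_space (A i)) \<and> (\<forall>i<d. A i \<subset> A (Suc i))}"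
  show "(SUP d\<in>?D. ereal (real d)) \<le> 1"
  proof (rule SUP_least)
    fix d assume "d \<in> ?D"
    then obtain A where A: "\<forall>i\<le>d. irreducible_closed curve_space (A i)" "\<forall>i<d. A i \<subset> A (Suc i)" by blast
    have "\<not> d \<ge> 2"
    proof
      assume d: "d \<ge> 2"
      have A0: "A 0 \<subset> A 1" and A1: "A 1 \<subset> A 2"
        using A(2)[rule_format, of 0] A(2)[rule_format, of 1] d by (auto simp: numeral_2_eq_2)
      have ir: "irreducible_closed curve_space (A 0)" "irreducible_closed curve_space (A 1)"
        "irreducible_closed curve_space (A 2)" using A(1) d by auto
      obtain M where M: "M \<in> comps" "A 2 \<subseteq> line_points M" using irreducible_in_line[OF ir(3)] by blast
      then have "A 1 \<subseteq> line_points M" "A 1 \<noteq> line_points M" using A1 by auto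
      note single = proper_irreducible_point[OF ir(2) this M(1)]
      obtain P where P: "P \<in> A 0" using ir(1) by (auto simp: irreducible_closed_def)
      obtain Q where Q: "Q \<in> A 1" "Q \<notin> A 0" using A0 by blast
      have "P \<in> A 1" using P A0 by blast
      then show False using single[OF Q(1)] P Q(2) by blast
    qed
    then show "ereal (real d) \<le> 1" by simp
  qed
  have "1 \<in> ?D"
  proof (intro CollectI exI[of _ "\<lambda>i. if i = 0 then {closed_point None 0} else line_points None"] conjI allI impI)
    fix i :: nat
    show "irreducible_closed curve_space (if i = 0 then {closed_point None 0} else line_points None)"
      using irreducible_closed_point[of None 0] irreducible_line_points[of None] by simp
    assume "i < 1"
    have "var 1 \<in> closed_point None 0" using n by (simp add: closed_point_def var_vanishing_iff)
    moreover have "var 1 \<notin> line_ideal None" using n by (simp add: var_vanishing_iff)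
    ultimately have "{closed_point None 0} \<subset> line_points None"
      using closed_point_line[of None 0] generic_point[of None] by auto
    then show "(if i = 0 then {closed_point None 0} else line_points None)
        \<subset> (if Suc i = 0 then {closed_point None 0} else line_points None)" using \<open>i < 1\<close> by simp
  qed
  then have "ereal (real 1) \<le> (SUP d\<in>?D. ereal (real d))" by (rule SUP_upper)
  then show "1 \<le> (SUP d\<in>?D. ereal (real d))" by (simp add: one_ereal_def)
qed

text \<open>Lines are irreducible, and each of them meets the spine.\<close>

theorem connected_C: "connected_space curve_space"
  unfolding connected_space_def
proof clarify
  fix E F
  assume E: "openin curve_space E" and F: "openin curve_space F" and cover: "topspace curve_space \<subseteq> E \<union> F"
    and disj: "E \<inter> F = {}" and ne: "E \<noteq> {}" "F \<noteq> {}"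
  have sub: "E \<subseteq> topspace curve_space" "F \<subseteq> topspace curve_space" using E F openin_subset by auto
  have full: "\<exists>X\<in>{E, F}. line_points M \<subseteq> X" if M: "M \<in> comps" for M
  proof -
    have "line_points M \<subseteq> X" if "line_ideal M \<in> X" "openin curve_space Y" "topspace curve_space \<subseteq> X \<union> Y" "X \<inter> Y = {}" for X Y
    proof
      fix Q assume Q: "Q \<in> line_points M"
      then have "Q \<in> topspace curve_space" using topspace_curve M by blast
      have "Q \<notin> Y"
      proof
        assume "Q \<in> Y"
        moreover have "line_ideal M \<in> topspace curve_space"
          using generic_point[of M] topspace_curve M by blast
        ultimately have "line_ideal M \<in> Y"
          using open_downward[of Y Q] that(2) Q by (auto simp: line_points_def)
        then show False using that(1,4) by blast
      qed
      then show "Q \<in> X" using \<open>Q \<in> topspace curve_space\<close> that(3) by blast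
    qed
    note sub = this[OF _ F cover disj] this[of F E]
    have "line_ideal M \<in> E \<or> line_ideal M \<in> F"
      using generic_point[of M] topspace_curve M cover by blast
    then show ?thesis
    proof
      assume "line_ideal M \<in> E"
      then show ?thesis using sub(1) by simp
    next
      assume "line_ideal M \<in> F"
      then show ?thesis using sub(2) E cover disj by (simp add: Un_commute Int_commute)
    qed
  qed
  obtain X where X: "X \<in> {E, F}" "line_points None \<subseteq> X" using full[of None] by auto
  have "line_points M \<subseteq> X" if M: "M \<in> comps" for M
  proof (cases M)
    case (Some i)
    obtain Y where Y: "Y \<in> {E, F}" "line_points M \<subseteq> Y" using full[OF M] by blast
    have "closed_point None (a i) \<in> X \<inter> Y"
      using X(2) Y(2) closed_point_line[of None "a i"] closed_point_line[of M 0] closed_point_node Some by auto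
    then have "X = Y" using X(1) Y(1) disj by auto
    then show ?thesis using Y by simp
  qed (use X in simp)
  then have "topspace curve_space \<subseteq> X" using topspace_curve by auto
  then show False using X(1) sub ne disj by blast
qed

end

section \<open>Hilbert polynomial and degree\<close>

interpretation mp: vector_space "smul :: 'k::field \<Rightarrow> 'k mpoly \<Rightarrow> 'k mpoly"
  by (rule vector_space_smul)

lemma smul_const: "smul c f = const c * f" for f :: "'k::field mpoly"
  by (simp add: smul_def mult_map_scale_conv_mult)

lemma forms_finite_span:
  obtains B :: "'k::field mpoly set" where "finite B" "forms n d \<subseteq> mp.span B"
proof -
  define B :: "'k mpoly set" where
    "B = (\<lambda>m. single m 1) ` {m. supp m \<subseteq> {..n} \<and> mdeg m \<le> d}"
  have "f \<in> mp.span B" if f: "f \<in> forms n d" for f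
  proof -
    have "f = (\<Sum>m\<in>supp f. single m (coef f m))"
      by (rule poly_mapping_sum_single) auto
    also have "\<dots> = (\<Sum>m\<in>supp f. smul (coef f m) (single m 1))"
      by (simp add: smul_const mult_single)
    also have "\<dots> \<in> mp.span B"
      using forms_supp[OF f] by (intro mp.span_sum mp.span_scale mp.span_base) (auto simp: B_def)
    finally show ?thesis .
  qed
  moreover have "finite B" using finite_monomials by (simp add: B_def)
  ultimately show ?thesis using that by blast
qed

lemma dim_quotient:
  fixes b :: "'i \<Rightarrow> 'k::field mpoly"
  assumes U: "mp.subspace U" "U \<subseteq> S" and S: "S \<subseteq> mp.span B" "finite B"
    and I: "finite I" "b ` I \<subseteq> S"
    and indep: "\<And>c. (\<Sum>x\<in>I. smul (c x) (b x)) \<in> U \<Longrightarrow> \<forall>x\<in>I. c x = 0"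
    and span: "\<And>f. f \<in> S \<Longrightarrow> \<exists>c. f - (\<Sum>x\<in>I. smul (c x) (b x)) \<in> U"
  shows "vdim S = vdim U + card I"
proof -
  obtain B0 where B0: "B0 \<subseteq> U" "mp.independent B0" "U \<subseteq> mp.span B0" "card B0 = vdim U"
    using mp.basis_exists[of U] by blast
  have fin: "finite B0" using mp.independent_span_bound[OF S(2) B0(2)] B0(1) U(2) S(1) by blast
  have inj: "inj_on b I"
  proof (rule inj_onI, rule ccontr)
    fix x y assume xy: "x \<in> I" "y \<in> I" "b x = b y" "x \<noteq> y"
    define c where "c = (\<lambda>z. if z = x then 1 else if z = y then - 1 else (0::'k))"
    have "(\<Sum>z\<in>I. smul (c z) (b z)) = (\<Sum>z\<in>{x, y}. smul (c z) (b z))"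
      using xy I(1) by (intro sum.mono_neutral_right) (auto simp: c_def)
    also have "\<dots> = 0" using xy by (simp add: c_def)
    finally have "(\<Sum>z\<in>I. smul (c z) (b z)) \<in> U" using U(1) mp.subspace_0 by metis
    then show False using indep xy by (force simp: c_def)
  qed
  have disj: "B0 \<inter> b ` I = {}"
  proof (rule ccontr)
    assume "B0 \<inter> b ` I \<noteq> {}"
    then obtain x where x: "x \<in> I" "b x \<in> U" using B0(1) by blast
    have "(\<Sum>z\<in>I. smul (if z = x then 1 else 0) (b z)) = b x"
      using x I(1) by (simp add: if_distrib[of "\<lambda>c. smul c _"] cong: if_cong)
    then show False using indep[of "\<lambda>z. if z = x then 1 else 0"] x by auto
  qed
  have "mp.independent (B0 \<union> b ` I)"
  proof
    assume "mp.dependent (B0 \<union> b ` I)"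
    then obtain u where u: "\<exists>v\<in>B0 \<union> b ` I. u v \<noteq> 0" "(\<Sum>v\<in>B0 \<union> b ` I. smul (u v) v) = 0"
      using mp.dependent_finite[of "B0 \<union> b ` I"] fin I(1) by auto
    have "(\<Sum>v\<in>B0 \<union> b ` I. smul (u v) v) = (\<Sum>v\<in>B0. smul (u v) v) + (\<Sum>v\<in>b ` I. smul (u v) v)"
      using fin I(1) disj by (intro sum.union_disjoint) auto
    then have e: "(\<Sum>v\<in>b ` I. smul (u v) v) = - (\<Sum>v\<in>B0. smul (u v) v)"
      using u(2) by (simp add: eq_neg_iff_add_eq_0 add.commute)
    have "(\<Sum>v\<in>B0. smul (u v) v) \<in> U"
      using B0(1) U(1) by (intro mp.subspace_sum mp.subspace_scale) auto
    then have "(\<Sum>v\<in>b ` I. smul (u v) v) \<in> U" using e U(1) mp.subspace_neg by metis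
    then have "(\<Sum>x\<in>I. smul (u (b x)) (b x)) \<in> U" by (simp add: sum.reindex[OF inj] o_def)
    then have z: "\<forall>x\<in>I. u (b x) = 0" by (rule indep)
    then have "(\<Sum>v\<in>b ` I. smul (u v) v) = 0" by (intro sum.neutral) auto
    then have "(\<Sum>v\<in>B0. smul (u v) v) = 0" using e by simp
    then have "\<forall>v\<in>B0. u v = 0" using mp.dependent_finite[OF fin] B0(2) by blast
    then show False using u(1) z by blast
  qed
  moreover have "S \<subseteq> mp.span (B0 \<union> b ` I)"
  proof
    fix f assume "f \<in> S"
    then obtain c where c: "f - (\<Sum>x\<in>I. smul (c x) (b x)) \<in> U" using span by blast
    then have "f - (\<Sum>x\<in>I. smul (c x) (b x)) \<in> mp.span (B0 \<union> b ` I)"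
      using B0(3) mp.span_mono[of B0 "B0 \<union> b ` I"] by blast
    moreover have "(\<Sum>x\<in>I. smul (c x) (b x)) \<in> mp.span (B0 \<union> b ` I)"
      by (intro mp.span_sum mp.span_scale mp.span_base) auto
    ultimately have "(f - (\<Sum>x\<in>I. smul (c x) (b x))) + (\<Sum>x\<in>I. smul (c x) (b x))
        \<in> mp.span (B0 \<union> b ` I)" by (rule mp.span_add)
    then show "f \<in> mp.span (B0 \<union> b ` I)" by simp
  qed
  moreover have "B0 \<union> b ` I \<subseteq> S" using B0(1) U(2) I(2) by blast
  ultimately have "card (B0 \<union> b ` I) = vdim S" by (intro mp.basis_card_eq_dim)
  then show ?thesis
    using card_Un_disjoint[OF fin finite_imageI[OF I(1)] disj] card_image[OF inj] B0(4) by simp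
qed

lemma poly_eventually_unique:
  fixes p q :: "real poly"
  assumes "\<forall>\<^sub>F t in sequentially. poly p (real t) = poly q (real t)"
  shows "p = q"
proof (rule ccontr)
  assume "p \<noteq> q"
  then have fin: "finite {x. poly (p - q) x = 0}" by (intro poly_roots_finite) simp
  obtain N where N: "\<And>t. t \<ge> N \<Longrightarrow> poly p (real t) = poly q (real t)"
    using assms unfolding eventually_sequentially by blast
  have "real ` {N..} \<subseteq> {x. poly (p - q) x = 0}" using N by auto
  then have "finite (real ` {N..})" using fin finite_subset by blast
  then have "finite {N..}" by (rule finite_imageD) (simp add: inj_on_def)
  then show False using infinite_Ici by blast
qed

context tangent_lines
begin

lemma subspace_C_forms: "mp.subspace (C \<inter> forms n t)"
  using homogeneous_idealD(2,3,4)[OF homogeneous_ideal_C]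
  by (auto simp: mp.subspace_def smul_const forms_add forms_const_mult)

text \<open>A monomial on the spine must be continued by constants on the lines, to agree with them at the nodes.\<close>

definition section_index :: "nat \<Rightarrow> (nat option \<times> nat) set" where
  "section_index t = Pair None ` {..t} \<union> (\<Union>i<k. Pair (Some i) ` {1..t})"

definition section_basis :: "nat option \<times> nat \<Rightarrow> nat option \<Rightarrow> 'k poly" where
  "section_basis x N = (case x of (None, j) \<Rightarrow> (case N of None \<Rightarrow> monom 1 j | Some i \<Rightarrow> [:a i ^ j:])
     | (Some i, j) \<Rightarrow> if N = Some i then monom 1 j else 0)"

lemma section_index_iff:
  "(M, j) \<in> section_index t \<longleftrightarrow> M \<in> comps \<and> j \<le> t \<and> (M = None \<or> 1 \<le> j)"
  by (cases M) (auto simp: section_index_def image_iff)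

lemma finite_section_index: "finite (section_index t)" by (simp add: section_index_def)

lemma card_section_index: "card (section_index t) = Suc t + k * t"
proof -
  have "card (\<Union>i<k. Pair (Some i) ` {1..t}) = (\<Sum>i<k. card (Pair (Some i) ` {1..t} :: (nat option \<times> nat) set))"
    by (rule card_UN_disjoint) auto
  also have "\<dots> = k * t" by (simp add: card_image inj_on_def)
  finally have "card (\<Union>i<k. Pair (Some i) ` {1..t}) = k * t" .
  moreover have "card (Pair (None :: nat option) ` {..t}) = Suc t" by (simp add: card_image inj_on_def)
  ultimately show ?thesis
    unfolding section_index_def by (subst card_Un_disjoint) auto
qed

lemma section_basis_tuples: "x \<in> section_index t \<Longrightarrow> section_basis x \<in> tuples t"
  by (cases x; cases "fst x")
     (auto simp: tuples_def section_basis_def section_index_iff ball_comps degree_monom_eq poly_monom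
       power_0_left)

lemma coeff_section_basis:
  assumes "(N, j) \<in> section_index t" "y \<in> section_index t"
  shows "coeff (section_basis y N) j = (if y = (N, j) then 1 else 0)"
  using assms
  by (cases y; cases "fst y"; cases N)
     (auto simp: section_basis_def section_index_iff coeff_pCons split: nat.splits)

text \<open>
  The arithmetic genus is \<open>0\<close>: each of the \<open>k\<close> lines adds \<open>t\<close> to the \<open>t + 1\<close> sections of the spine.
\<close>

lemma hilbert_function_C:
  assumes t: "Suc t \<ge> k"
  shows "hilbert_function n C t = int (Suc t + k * t)"
proof -
  let ?I = "section_index t"
  have "\<exists>f\<in>forms n t. \<forall>M\<in>comps. res M f = section_basis x M" if "x \<in> ?I" for x
    using lift_tuples[OF t section_basis_tuples[OF that]] .
  then obtain b where b: "\<And>x. x \<in> ?I \<Longrightarrow> b x \<in> forms n t \<and> (\<forall>M\<in>comps. res M (b x) = section_basis x M)"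
    by metis
  have coeff: "coeff (res N (\<Sum>x\<in>?I. smul (c x) (b x))) j = c (N, j)" if x: "(N, j) \<in> ?I" for c N j
  proof -
    have N: "N \<in> comps" using x by (simp add: section_index_iff)
    have "coeff (res N (\<Sum>x\<in>?I. smul (c x) (b x))) j = (\<Sum>y\<in>?I. c y * coeff (section_basis y N) j)"
      using b N by (simp add: res_sum smul_const coeff_sum)
    also have "\<dots> = (\<Sum>y\<in>?I. if y = (N, j) then c y else 0)"
      using coeff_section_basis[OF x] by (intro sum.cong) auto
    also have "\<dots> = c (N, j)" using x finite_section_index by simp
    finally show ?thesis .
  qed
  obtain B :: "'k mpoly set" where B: "finite B" "forms n t \<subseteq> mp.span B" by (rule forms_finite_span)
  have "vdim (forms n t :: 'k mpoly set) = vdim (C \<inter> forms n t) + card ?I"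
  proof (rule dim_quotient[OF subspace_C_forms _ B(2,1) finite_section_index])
    show "C \<inter> forms n t \<subseteq> forms n t" by blast
    show "b ` ?I \<subseteq> forms n t" using b by blast
    fix c assume "(\<Sum>x\<in>?I. smul (c x) (b x)) \<in> C \<inter> forms n t"
    then have "\<forall>N\<in>comps. res N (\<Sum>x\<in>?I. smul (c x) (b x)) = 0" using C_form by blast
    then have "c (N, j) = 0" if "(N, j) \<in> ?I" for N j
      using coeff[OF that, of c] that by (simp add: section_index_iff)
    then show "\<forall>x\<in>?I. c x = 0" by auto
  next
    fix f :: "'k mpoly" assume f: "f \<in> forms n t"
    define c where "c = (\<lambda>(N, j). coeff (res N f) j)"
    define g where "g = f - (\<Sum>x\<in>?I. smul (c x) (b x))"
    have "(\<Sum>x\<in>?I. smul (c x) (b x)) \<in> forms n t"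
      using b by (intro forms_sum) (auto simp: smul_const intro: forms_const_mult)
    then have g: "g \<in> forms n t" using f by (simp add: g_def forms_diff)
    have gc: "coeff (res N g) j = 0" if "(N, j) \<in> ?I" for N j
      using coeff[OF that, of c] by (simp add: g_def c_def)
    have big: "coeff (res N g) j = 0" if "j > t" for N j
      using degree_res[OF g, of N] that by (intro coeff_eq_0) simp
    have None: "res None g = 0"
      using gc[of None] big[of _ None] by (intro poly_eqI) (metis coeff_0 comps_iff(1) not_le section_index_iff)
    have "res M g = 0" if M: "M \<in> comps" for M
    proof (rule poly_eqI)
      fix j
      show "coeff (res M g) j = coeff 0 j"
      proof (cases "(M, j) \<in> ?I \<or> j > t")
        case True
        then show ?thesis using gc big by auto
      next
        case False
        then have "M \<noteq> None" "j = 0" using M by (auto simp: section_index_iff)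
        then show ?thesis using res_glue[of _ g] None by (auto simp: poly_0_coeff_0)
      qed
    qed
    then have "g \<in> C \<inter> forms n t" using C_form[OF g] g by blast
    then show "\<exists>c. f - (\<Sum>x\<in>?I. smul (c x) (b x)) \<in> C \<inter> forms n t" unfolding g_def by blast
  qed
  then show ?thesis by (simp add: hilbert_function_def card_section_index)
qed

lemma hilbert_polynomial_C: "hilbert_polynomial n C = [:1, real k + 1:]"
  unfolding hilbert_polynomial_def
proof (rule the_equality)
  have "poly [:1, real k + 1:] (real t) = of_int (hilbert_function n C t)" if "t \<ge> k" for t
    using hilbert_function_C[of t] that by (simp add: algebra_simps)
  then show ev: "\<forall>\<^sub>F t in sequentially. poly [:1, real k + 1:] (real t) = of_int (hilbert_function n C t)"
    unfolding eventually_sequentially by blast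
  fix p :: "real poly"
  assume "\<forall>\<^sub>F t in sequentially. poly p (real t) = of_int (hilbert_function n C t)"
  with ev have "\<forall>\<^sub>F t in sequentially. poly p (real t) = poly [:1, real k + 1:] (real t)"
    by eventually_elim simp
  then show "p = [:1, real k + 1:]" by (rule poly_eventually_unique)
qed

lemma scheme_degree_C: "scheme_degree n C = real k + 1"
proof -
  have "degree [:1, real k + 1:] = 1" by simp
  then show ?thesis by (simp add: scheme_degree_def hilbert_polynomial_C)
qed

section \<open>The span, and the conclusion\<close>

lemma saturation_C: "saturation n C = C"
proof
  show "C \<subseteq> saturation n C"
  proof
    fix f assume f: "f \<in> C"
    then have "\<forall>i\<le>n. \<exists>e. var i ^ e * f \<in> C" by (intro allI impI exI[of _ 0]) simp
    then show "f \<in> saturation n C" using f by (auto simp: saturation_def C_def)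
  qed
  show "saturation n C \<subseteq> C"
  proof
    fix f assume "f \<in> saturation n C"
    then obtain e where f: "f \<in> poly_carrier n" "var 0 ^ e * f \<in> C" unfolding saturation_def by blast
    have v: "var 0 \<notin> line_ideal M" for M by (simp add: var_vanishing_iff)
    have "f \<in> line_ideal M" if "M \<in> comps" for M
      using vanishing_prime[of "var 0 ^ e" n f "param M"] vanishing_power[of "var 0" n e "param M"] f that v
      by (auto simp: C_def carrier_power)
    then show "f \<in> C" using f(1) by (simp add: C_def)
  qed
qed

lemma reduced_C: "reduced_subscheme n C"
  unfolding reduced_subscheme_def closed_subscheme_def
proof (intro conjI ballI allI impI homogeneous_ideal_C saturation_C)
  fix f e assume f: "f \<in> poly_carrier n" "f ^ e \<in> C"
  then have "f \<in> line_ideal M" if "M \<in> comps" for M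
    using that vanishing_power[OF f(1), of e "param M"] by (simp add: C_def)
  then show "f \<in> C" using f(1) by (simp add: C_def)
qed

lemma linear_forms_in_C:
  assumes w: "w \<in> forms n 1" "w \<in> C"
  obtains c where "w = (\<Sum>j=4..n. smul (c j) (var j))"
proof -
  obtain A where A: "\<forall>j\<le>n. A j \<in> forms n 0" "w = (\<Sum>j\<le>n. var j * A j)"
    using forms_decompose[of w n 0] w(1) by auto
  define c where "c = (\<lambda>j. coef (A j) 0)"
  have cA: "A j = const (c j)" if "j \<le> n" for j
    using A(1) forms_0_const that unfolding c_def by blast
  have "w = (\<Sum>j\<le>n. const (c j) * var j)"
    unfolding A(2) using cA by (intro sum.cong) (auto simp: mult.commute)
  also have "{..n} = {0, 1, 2, 3} \<union> {4..n}" using n by auto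
  also have "(\<Sum>j\<in>{0, 1, 2, 3} \<union> {4..n}. const (c j) * var j)
      = (\<Sum>j\<in>{0, 1, 2, 3}. const (c j) * var j) + (\<Sum>j=4..n. const (c j) * var j)"
    by (rule sum.union_disjoint) auto
  finally have w': "w = (\<Sum>j\<in>{0, 1, 2, 3}. const (c j) * var j) + (\<Sum>j=4..n. const (c j) * var j)" .
  have "param M j = 0" if "j \<in> {4..n}" for M j
    using that by (cases M) (auto simp: spine_def tline_def)
  then have "res M w = [:c 0:] + smult (c 1) (param M 1) + smult (c 2) (param M 2) + smult (c 3) (param M 3)" for M
    unfolding w' by (simp add: res_sum)
  moreover have "res M w = 0" if "M \<in> comps" for M using C_form[OF w(1)] w(2) that by blast
  ultimately have e: "[:c 0:] + smult (c 1) (param M 1) + smult (c 2) (param M 2) + smult (c 3) (param M 3) = 0"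
    if "M \<in> comps" for M using that by metis
  have 01: "c 0 = 0" "c 1 = 0" using e[of None] by auto
  have "c 2 + a i * c 3 = 0" if "i < k" for i
    using e[of "Some i"] 01 that by (simp add: mult.commute)
  from this[of 0] this[of 1] have "c 2 + a 0 * c 3 = 0" "c 2 + a 1 * c 3 = 0" using k by auto
  moreover have "a 0 \<noteq> a 1" using a_eq_iff[of 0 1] k by simp
  ultimately have "c 3 = 0" by (metis add_left_cancel mult_cancel_right)
  then have "c 2 = 0" using \<open>c 2 + a 0 * c 3 = 0\<close> by simp
  then have "w = (\<Sum>j=4..n. smul (c j) (var j))"
    unfolding w' using 01 \<open>c 3 = 0\<close> by (simp add: smul_const)
  then show ?thesis by (rule that)
qed

lemma linear_dim_Span_C: "linear_dim n (Span n C) = 3"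
proof -
  let ?R = "poly_ring n :: 'k mpoly ring"
  interpret R: cring ?R by (rule cring_poly_ring)
  define W :: "'k mpoly set" where "W = var ` {4..n}"
  define L where "L = saturation n (Idl\<^bsub>?R\<^esub> W)"
  have Wf: "W \<subseteq> forms n 1" using forms_var by (auto simp: W_def)
  have fc: "V \<subseteq> carrier ?R" if "V \<subseteq> forms n 1" for V
    using that forms_carrier by (auto simp: poly_ring_def)
  have idl: "ideal (Idl\<^bsub>?R\<^esub> V) ?R" "V \<subseteq> Idl\<^bsub>?R\<^esub> V" if "V \<subseteq> forms n 1" for V
    using R.genideal_ideal[OF fc[OF that]] R.genideal_self[OF fc[OF that]] .
  have mono: "saturation n K \<subseteq> saturation n K'" if "K \<subseteq> K'" for K K' :: "'k mpoly set"
    using that by (fastforce simp: saturation_def)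
  have self: "V \<subseteq> saturation n (Idl\<^bsub>?R\<^esub> V)" if V: "V \<subseteq> forms n 1" for V
  proof
    fix f assume f: "f \<in> V"
    then have "\<forall>i\<le>n. \<exists>e. var i ^ e * f \<in> Idl\<^bsub>?R\<^esub> V"
      using idl(2)[OF V] by (intro allI impI exI[of _ 0]) auto
    moreover have "f \<in> poly_carrier n" using f V forms_carrier by blast
    ultimately show "f \<in> saturation n (Idl\<^bsub>?R\<^esub> V)" by (simp add: saturation_def)
  qed
  have "res M (var j) = 0" if "j \<in> {4..n}" for M j
    using that by (cases M) (auto simp: spine_def tline_def)
  then have "W \<subseteq> C" using C_form[OF forms_var] by (auto simp: W_def)
  then have "Idl\<^bsub>?R\<^esub> W \<subseteq> C"
    using homogeneous_ideal_C by (intro R.genideal_minimal) (auto simp: homogeneous_ideal_def)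
  then have LC: "L \<subseteq> C" unfolding L_def using mono saturation_C by metis
  have inW: "w \<in> mp.span W" "w \<in> Idl\<^bsub>?R\<^esub> W" if w: "w \<in> forms n 1" "w \<in> C" for w
  proof -
    obtain c where c: "w = (\<Sum>j=4..n. smul (c j) (var j))" using linear_forms_in_C[OF w] .
    show "w \<in> mp.span W" unfolding c by (intro mp.span_sum mp.span_scale mp.span_base) (auto simp: W_def)
    have I: "0 \<in> Idl\<^bsub>?R\<^esub> W" "\<And>f g. f \<in> Idl\<^bsub>?R\<^esub> W \<Longrightarrow> g \<in> Idl\<^bsub>?R\<^esub> W \<Longrightarrow> f + g \<in> Idl\<^bsub>?R\<^esub> W"
      "\<And>f g. f \<in> poly_carrier n \<Longrightarrow> g \<in> Idl\<^bsub>?R\<^esub> W \<Longrightarrow> f * g \<in> Idl\<^bsub>?R\<^esub> W"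
      using idl(1)[OF Wf] unfolding ideal_iff by auto
    have cv: "const (c j) * var j \<in> Idl\<^bsub>?R\<^esub> W" if "j \<in> {4..n}" for j
      using that idl(2)[OF Wf] by (intro I(3)) (auto simp: W_def)
    have "(\<Sum>j\<in>A. smul (c j) (var j)) \<in> Idl\<^bsub>?R\<^esub> W" if "A \<subseteq> {4..n}" for A
      using finite_subset[OF that finite_atLeastAtMost] that
      by (induction A rule: finite_induct)
         (use I(1,2) cv in \<open>auto simp: smul_const\<close>)
    then show "w \<in> Idl\<^bsub>?R\<^esub> W" unfolding c by blast
  qed
  have "Span n C = L"
    unfolding Span_def
  proof (rule Greatest_equality)
    show "linear_subspace n L \<and> L \<subseteq> C" using LC Wf by (auto simp: linear_subspace_def L_def)
    fix L' assume L': "linear_subspace n L' \<and> L' \<subseteq> C"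
    then obtain W' where W': "W' \<subseteq> forms n 1" "L' = saturation n (Idl\<^bsub>?R\<^esub> W')"
      by (auto simp: linear_subspace_def)
    then have "W' \<subseteq> C" using self[OF W'(1)] L' by blast
    then have "W' \<subseteq> Idl\<^bsub>?R\<^esub> W" using inW(2) W'(1) by blast
    then have "Idl\<^bsub>?R\<^esub> W' \<subseteq> Idl\<^bsub>?R\<^esub> W" by (intro R.genideal_minimal idl(1)[OF Wf])
    then show "L' \<le> L" unfolding W'(2) L_def by (rule mono)
  qed
  have inj: "inj_on (var :: nat \<Rightarrow> 'k mpoly) {4..n}"
  proof (rule inj_onI)
    fix i j assume "var i = (var j :: 'k mpoly)"
    then have "single i (1::nat) = single j 1"
      unfolding var_def by (metis lookup_single_eq lookup_single_not_eq zero_neq_one)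
    then show "i = j" by (metis lookup_single_eq lookup_single_not_eq zero_neq_one)
  qed
  have "mp.independent W"
  proof
    have "finite W" by (simp add: W_def)
    moreover assume "mp.dependent W"
    ultimately obtain u where u: "\<exists>v\<in>W. u v \<noteq> 0" "(\<Sum>v\<in>W. smul (u v) v) = 0"
      using mp.dependent_finite[of W] by auto
    then obtain i where i: "i \<in> {4..n}" "u (var i) \<noteq> 0" by (auto simp: W_def)
    have s: "single j (1::nat) = single i 1 \<longleftrightarrow> j = i" for j
      by (metis lookup_single_eq lookup_single_not_eq zero_neq_one)
    have "0 = coef (\<Sum>v\<in>W. smul (u v) v) (single i 1)" using u(2) by simp
    also have "\<dots> = (\<Sum>j=4..n. u (var j) * (if j = i then 1 else 0))"
      unfolding W_def using s
      by (simp add: sum.reindex[OF inj] lookup_sum) (simp add: var_def lookup_single when_def)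
    also have "\<dots> = (\<Sum>j=4..n. if j = i then u (var i) else 0)" by (intro sum.cong) auto
    also have "\<dots> = u (var i)" using i(1) by simp
    finally show False using i by simp
  qed
  moreover have "W \<subseteq> L \<inter> forms n 1" using self[OF Wf] Wf by (simp add: L_def)
  moreover have "L \<inter> forms n 1 \<subseteq> mp.span W" using LC inW(1) by blast
  ultimately have "card W = vdim (L \<inter> forms n 1)" by (intro mp.basis_card_eq_dim)
  moreover have "card W = n - 3" using card_image[OF inj] n by (simp add: W_def)
  ultimately show ?thesis using \<open>Span n C = L\<close> n by (simp add: linear_dim_def)
qed

lemma Xi_C: "Xi n C = real k"
  by (simp add: Xi_def scheme_degree_C linear_dim_Span_C)

theorem maximal_regularity_without_extremal_secant:
  "connected_curve n C" "maximal_regularity n C" "Xi n C = real k" "\<not> extremal_secant n C L"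
proof -
  show "connected_curve n C"
    using reduced_C krull_dim_C connected_C by (simp add: connected_curve_def curve_def)
  show "maximal_regularity n C" by (simp add: maximal_regularity_def scheme_reg_C Xi_C)
  show "Xi n C = real k" by (rule Xi_C)
  show "\<not> extremal_secant n C L"
  proof
    assume "extremal_secant n C L"
    then have "ereal (real k) \<le> ereal (real (k - 1))"
      using scheme_reg_secant[of L] by (simp add: extremal_secant_def Xi_C)
    then show False using k by simp
  qed
qed

end

lemma ex_curve_without_extremal_secant:
  fixes n m :: nat
  assumes "n \<ge> 3" "m \<ge> 4"
  shows "\<exists>C :: 'k::alg_closed_field mpoly set. connected_curve n C \<and> maximal_regularity n C \<and>
    Xi n C = real m \<and> \<not> (\<exists>L. extremal_secant n C L)"
proof -
  have "infinite (UNIV - {0 :: 'k})" using infinite_alg_closed by simp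
  then obtain a :: "nat \<Rightarrow> 'k" where a: "inj a" "range a \<subseteq> UNIV - {0}"
    using infinite_countable_subset by blast
  interpret tangent_lines n m a
    using assms a by unfold_locales (auto intro: inj_on_subset)
  show ?thesis using maximal_regularity_without_extremal_secant by blast
qed

theorem mainTheorem2:
  shows "(\<forall>n m :: nat. n \<ge> 4 \<longrightarrow> m \<ge> 4 \<longrightarrow>
            (\<exists>C :: 'k::alg_closed_field mpoly set.
               connected_curve n C \<and> maximal_regularity n C \<and> Xi n C = real m \<and>
               \<not> (\<exists>L. extremal_secant_line n C L))) \<and>
         (\<forall>m :: nat. m \<ge> 4 \<longrightarrow>
            (\<exists>C :: 'k mpoly set.
               connected_curve 4 C \<and> maximal_regularity 4 C \<and> Xi 4 C = real m \<and>
               \<not> (\<exists>L. extremal_secant 4 C L)))"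
proof (intro conjI allI impI)
  fix n m :: nat assume "n \<ge> 4" "m \<ge> 4"
  then obtain C :: "'k mpoly set" where "connected_curve n C" "maximal_regularity n C"
    "Xi n C = real m" "\<not> (\<exists>L. extremal_secant n C L)"
    using ex_curve_without_extremal_secant[of n m] by force
  then show "\<exists>C :: 'k mpoly set. connected_curve n C \<and> maximal_regularity n C \<and> Xi n C = real m \<and>
      \<not> (\<exists>L. extremal_secant_line n C L)"
    unfolding extremal_secant_line_def by blast
next
  fix m :: nat assume "m \<ge> 4"
  then show "\<exists>C :: 'k mpoly set. connected_curve 4 C \<and> maximal_regularity 4 C \<and> Xi 4 C = real m \<and>
      \<not> (\<exists>L. extremal_secant 4 C L)"
    by (intro ex_curve_without_extremal_secant) auto
qed

end
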